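(* Let $T$ be the $\aleph_0$-regular tree with root $e$ and let $d\colon\mathrm{Aut}(T)\to\mathcal B(\ell_2(T))$ be the derivation $d(g)=L^*\lambda(g)-\lambda(g)L^*$ (restricted to $\ell_2(T)$). Suppose that $G\leqslant\mathrm{GL}(\ell_2(T)\oplus\ell_2(T))$ is a bounded subgroup leaving the first copy of $\ell_2(T)$ invariant and containing $\lambda_d[\mathrm{Aut}(T)]$. Then there is a continuous homogeneous map $\psi\colon\ell_2(T)\to\ell_2(T)$ for which $$L^*+\psi\colon\ell_2(T)\to\ell_\infty(T)\quad\text{and}\quad L-\psi\colon\ell_1(T)\to\ell_2(T)$$ commute with $\lambda(g)$ for all $g\in\mathrm{Aut}(T)$ and so that every element of $G$ is of the form $$\begin{pmatrix} u & u\psi-\psi v\\ 0 & v\end{pmatrix}$$ for some $u,v\in\mathrm{GL}(\ell_2(T))$. Finally, the mappings $$\begin{pmatrix} u & u\psi-\psi v\\ 0 & v\end{pmatrix}\mapsto u\qquad\text{and}\qquad\begin{pmatrix} u & u\psi-\psi v\\ 0 & v\end{pmatrix}\mapsto v$$ are isomorphisms of topological groups, for the strong operator topologies, between $G$ and their respective images in $\mathrm{GL}(\ell_2(T))$.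
   Context: The $\aleph_0$-regular tree $T$ is the countable tree (connected, acyclic simple graph) in which every vertex has infinitely many neighbours; $T$ also denotes its vertex set, and $\mathrm{Aut}(T)$ is its group of graph automorphisms (not required to fix the root). $\mathbb C^T$ is the vector space of all functions $T\to\mathbb C$, and $\lambda$ is the action of $\mathrm{Aut}(T)$ on $\mathbb C^T$ by $\lambda(g)(x)=x(g^{-1}\,\cdot\,)$; each $\ell_p(T)\subseteq\mathbb C^T$ is $\lambda$-invariant. $\mathbf 1_s$ is the Dirac function at $s\in T$. A root $e\in T$ is fixed; $\hat e=e$, and for $s\neq e$, $\hat s$ is the penultimate vertex on the geodesic from $e$ to $s$. $L\colon\ell_1(T)\to\ell_1(T)$ is the bounded linear operator with $L(\mathbf 1_s)=\mathbf 1_{\hat s}$ for $s\ne e$ and $L(\mathbf 1_e)=0$, and $L^*\colon\ell_\infty(T)\to\ell_\infty(T)$ is its adjoint, so $(L^*x)(s)=x(\hat s)$ for $s\neq e$ and $(L^*x)(e)=0$. For every $g\in\mathrm{Aut}(T)$, the operator $L^*\lambda(g)-\lambda(g)L^*$ on $\ell_\infty(T)$ restricts to a bounded operator on $\ell_2(T)$ of norm at most $2$ (and agrees with $\lambda(g)L-L\lambda(g)$ on $\ell_1(T)$); $d(g)$ denotes this restriction to $\ell_2(T)$. The representation $\lambda_d\colon\mathrm{Aut}(T)\to\mathrm{GL}(\ell_2(T)\oplus\ell_2(T))$ is $\lambda_d(g)=\begin{pmatrix}\lambda(g)&d(g)\\0&\lambda(g)\end{pmatrix}$. $\mathrm{GL}(\cdot)$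 is the group of continuous linear automorphisms; a subgroup $G$ is bounded if $\sup_{S\in G}\|S\|<\infty$. A (possibly non-linear) map $\psi$ is homogeneous if $\psi(\alpha x)=\alpha\psi(x)$ for all scalars $\alpha$. *)

theory Defs
  imports "HOL-Analysis.Analysis" "HOL-Algebra.Group"
begin

section \<open>Complex normed spaces and the group of continuous linear automorphisms\<close>

text \<open>
  The operator type \<open>'a \<Rightarrow>\<^sub>L 'a\<close> of the library is real-linear; complex linearity is imposed
  separately, through a scalar multiplication extending the real one.
\<close>

class complex_normed_vector = real_normed_vector +
  fixes scaleC :: "complex \<Rightarrow> 'a \<Rightarrow> 'a"  (infixr \<open>*\<^sub>C\<close> 75)
  assumes scaleC_add_right: "c *\<^sub>C (x + y) = c *\<^sub>C x + c *\<^sub>C y"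
    and scaleC_add_left: "(c + c') *\<^sub>C x = c *\<^sub>C x + c' *\<^sub>C x"
    and scaleC_scaleC: "c *\<^sub>C (c' *\<^sub>C x) = (c * c') *\<^sub>C x"
    and scaleC_of_real: "complex_of_real r *\<^sub>C x = r *\<^sub>R x"
    and norm_scaleC: "norm (c *\<^sub>C x) = cmod c * norm x"

instantiation prod :: (complex_normed_vector, complex_normed_vector) complex_normed_vector
begin

definition scaleC_prod :: "complex \<Rightarrow> 'a \<times> 'b \<Rightarrow> 'a \<times> 'b"
  where "scaleC_prod c z = (c *\<^sub>C fst z, c *\<^sub>C snd z)"

instance
proof
  fix c c' :: complex and r :: real and x y :: "'a \<times> 'b"
  show "c *\<^sub>C (x + y) = c *\<^sub>C x + c *\<^sub>C y"
    by (simp add: scaleC_prod_def scaleC_add_right)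
  show "(c + c') *\<^sub>C x = c *\<^sub>C x + c' *\<^sub>C x"
    by (simp add: scaleC_prod_def scaleC_add_left)
  show "c *\<^sub>C (c' *\<^sub>C x) = (c * c') *\<^sub>C x"
    by (simp add: scaleC_prod_def scaleC_scaleC)
  show "complex_of_real r *\<^sub>C x = r *\<^sub>R x"
    by (simp add: scaleC_prod_def scaleC_of_real scaleR_prod_def)
  have "norm (c *\<^sub>C x) = sqrt ((cmod c)\<^sup>2 * ((norm (fst x))\<^sup>2 + (norm (snd x))\<^sup>2))"
    by (simp add: scaleC_prod_def norm_prod_def norm_scaleC power_mult_distrib distrib_left)
  then show "norm (c *\<^sub>C x) = cmod c * norm x"
    by (simp add: real_sqrt_mult norm_prod_def)
qed

end

definition homogeneous :: "('a::complex_normed_vector \<Rightarrow> 'b::complex_normed_vector) \<Rightarrow> bool"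
  where "homogeneous f \<longleftrightarrow> (\<forall>c x. f (c *\<^sub>C x) = c *\<^sub>C f x)"

text \<open>A bounded real-linear operator is complex linear iff it is homogeneous.\<close>

definition GL :: "('a::complex_normed_vector \<Rightarrow>\<^sub>L 'a) monoid"
  where "GL = \<lparr>carrier = {S. homogeneous (blinfun_apply S) \<and>
                   (\<exists>R. S o\<^sub>L R = id_blinfun \<and> R o\<^sub>L S = id_blinfun)},
               mult = (o\<^sub>L), one = id_blinfun\<rparr>"

lemma group_GL: "group (GL :: ('a::complex_normed_vector \<Rightarrow>\<^sub>L 'a) monoid)"
proof (rule groupI)
  fix S T :: "'a \<Rightarrow>\<^sub>L 'a"
  assume S: "S \<in> carrier GL" and T: "T \<in> carrier GL"
  obtain R Q where R: "S o\<^sub>L R = id_blinfun" "R o\<^sub>L S = id_blinfun"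
    and Q: "T o\<^sub>L Q = id_blinfun" "Q o\<^sub>L T = id_blinfun"
    using S T by (auto simp: GL_def)
  have SR: "S (R x) = x" and RS: "R (S x) = x" and TQ: "T (Q x) = x" and QT: "Q (T x) = x" for x
    using R Q by (metis blinfun_apply_blinfun_compose blinfun_apply_id_blinfun)+
  have "(S o\<^sub>L T) o\<^sub>L (Q o\<^sub>L R) = id_blinfun" "(Q o\<^sub>L R) o\<^sub>L (S o\<^sub>L T) = id_blinfun"
    using SR RS TQ QT by (auto intro!: blinfun_eqI)
  then show "S \<otimes>\<^bsub>GL\<^esub> T \<in> carrier GL"
    using S T by (auto simp: GL_def homogeneous_def)
next
  show "\<one>\<^bsub>GL\<^esub> \<in> carrier (GL :: ('a \<Rightarrow>\<^sub>L 'a) monoid)"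
    by (auto simp: GL_def homogeneous_def intro!: exI[of _ id_blinfun] blinfun_eqI)
next
  fix S :: "'a \<Rightarrow>\<^sub>L 'a"
  assume S: "S \<in> carrier GL"
  then obtain R where R: "S o\<^sub>L R = id_blinfun" "R o\<^sub>L S = id_blinfun"
    by (auto simp: GL_def)
  have SR: "S (R x) = x" and RS: "R (S x) = x" for x
    using R by (metis blinfun_apply_blinfun_compose blinfun_apply_id_blinfun)+
  have "R (c *\<^sub>C x) = c *\<^sub>C R x" for c x
  proof -
    have "S (c *\<^sub>C R x) = c *\<^sub>C x"
      using S by (simp add: GL_def homogeneous_def SR)
    then show ?thesis by (metis RS)
  qed
  then have "R \<in> carrier GL"
    using R by (auto simp: GL_def homogeneous_def)
  then show "\<exists>y\<in>carrier GL. y \<otimes>\<^bsub>GL\<^esub> S = \<one>\<^bsub>GL\<^esub>"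
    using R by (auto simp: GL_def)
qed (auto simp: GL_def intro!: blinfun_eqI)


section \<open>Topological groups\<close>

definition topological_group :: "('a, 'm) monoid_scheme \<Rightarrow> 'a topology \<Rightarrow> bool"
  where "topological_group \<G> X \<longleftrightarrow>
    group \<G> \<and> topspace X = carrier \<G> \<and>
    continuous_map (prod_topology X X) X (\<lambda>(a, b). a \<otimes>\<^bsub>\<G>\<^esub> b) \<and>
    continuous_map X X (\<lambda>a. inv\<^bsub>\<G>\<^esub> a)"

definition topological_group_iso ::
    "('a, 'm) monoid_scheme \<Rightarrow> 'a topology \<Rightarrow> ('b, 'n) monoid_scheme \<Rightarrow> 'b topology \<Rightarrow> ('a \<Rightarrow> 'b) \<Rightarrow> bool"
  where "topological_group_iso \<G> X \<H> Y f \<longleftrightarrow>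
    topological_group \<G> X \<and> topological_group \<H> Y \<and> f \<in> iso \<G> \<H> \<and> homeomorphic_map X Y f"

text \<open>The image of \<open>G\<close> is taken inside \<open>GL\<close>; both carry the strong operator topology.\<close>

definition SOT_iso_onto_image ::
    "('a::complex_normed_vector \<Rightarrow>\<^sub>L 'a) set \<Rightarrow>
     (('a \<Rightarrow>\<^sub>L 'a) \<Rightarrow> ('b::complex_normed_vector \<Rightarrow>\<^sub>L 'b)) \<Rightarrow> bool"
  where "SOT_iso_onto_image G f \<longleftrightarrow>
    f ` G \<subseteq> carrier GL \<and>
    topological_group_iso (GL\<lparr>carrier := G\<rparr>) (subtopology strong_operator_topology G)
      (GL\<lparr>carrier := f ` G\<rparr>) (subtopology strong_operator_topology (f ` G)) f"


section \<open>Sequence spaces over a set of vertices\<close>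

definition ell1_set :: "('v \<Rightarrow> complex) set"
  where "ell1_set = {x. (\<lambda>s. cmod (x s)) summable_on UNIV}"

definition ell2_set :: "('v \<Rightarrow> complex) set"
  where "ell2_set = {x. (\<lambda>s. (cmod (x s))\<^sup>2) summable_on UNIV}"

definition ellinf_set :: "('v \<Rightarrow> complex) set"
  where "ellinf_set = {x. bounded (range x)}"

lemma ell2_setI:
  assumes "\<And>F. finite F \<Longrightarrow> L2_set (\<lambda>s. cmod (x s)) F \<le> C"
  shows "x \<in> ell2_set" and "sqrt (\<Sum>\<^sub>\<infinity>s. (cmod (x s))\<^sup>2) \<le> C"
proof -
  have C: "0 \<le> C" using assms[of "{}"] by simp
  have b: "(\<Sum>s\<in>F. (cmod (x s))\<^sup>2) \<le> C\<^sup>2" if "finite F" for F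
    using assms[OF that] C
    by (metis L2_set_def real_sqrt_le_iff real_sqrt_unique)
  show 1: "x \<in> ell2_set"
    unfolding ell2_set_def mem_Collect_eq
    by (rule nonneg_bdd_above_summable_on) (auto intro!: bdd_aboveI2[where M = "C\<^sup>2"] b)
  have "(\<Sum>\<^sub>\<infinity>s. (cmod (x s))\<^sup>2) \<le> C\<^sup>2"
    using 1 by (intro infsum_le_finite_sums) (auto simp: ell2_set_def b)
  then show "sqrt (\<Sum>\<^sub>\<infinity>s. (cmod (x s))\<^sup>2) \<le> C"
    using C by (simp add: real_le_lsqrt)
qed

lemma L2_set_le_ell2_norm:
  assumes "x \<in> ell2_set" "finite F"
  shows "L2_set (\<lambda>s. cmod (x s)) F \<le> sqrt (\<Sum>\<^sub>\<infinity>s. (cmod (x s))\<^sup>2)"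
  unfolding L2_set_def using assms
  by (intro real_sqrt_le_mono finite_sum_le_infsum) (auto simp: ell2_set_def)

lemma ell2_set_add:
  assumes x: "x \<in> ell2_set" and y: "y \<in> ell2_set"
  shows "(\<lambda>s. x s + y s) \<in> ell2_set"
    and "sqrt (\<Sum>\<^sub>\<infinity>s. (cmod (x s + y s))\<^sup>2)
      \<le> sqrt (\<Sum>\<^sub>\<infinity>s. (cmod (x s))\<^sup>2) + sqrt (\<Sum>\<^sub>\<infinity>s. (cmod (y s))\<^sup>2)"
proof -
  have *: "L2_set (\<lambda>s. cmod (x s + y s)) F
      \<le> sqrt (\<Sum>\<^sub>\<infinity>s. (cmod (x s))\<^sup>2) + sqrt (\<Sum>\<^sub>\<infinity>s. (cmod (y s))\<^sup>2)" if F: "finite F" for F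
  proof -
    have "L2_set (\<lambda>s. cmod (x s + y s)) F \<le> L2_set (\<lambda>s. cmod (x s) + cmod (y s)) F"
      by (rule L2_set_mono) (auto intro: norm_triangle_ineq)
    also have "\<dots> \<le> L2_set (\<lambda>s. cmod (x s)) F + L2_set (\<lambda>s. cmod (y s)) F"
      by (rule L2_set_triangle_ineq)
    finally show ?thesis
      using L2_set_le_ell2_norm[OF x F] L2_set_le_ell2_norm[OF y F] by linarith
  qed
  show "(\<lambda>s. x s + y s) \<in> ell2_set" using ell2_setI(1)[OF *] .
  show "sqrt (\<Sum>\<^sub>\<infinity>s. (cmod (x s + y s))\<^sup>2)
      \<le> sqrt (\<Sum>\<^sub>\<infinity>s. (cmod (x s))\<^sup>2) + sqrt (\<Sum>\<^sub>\<infinity>s. (cmod (y s))\<^sup>2)"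
    using ell2_setI(2)[OF *] .
qed

lemma ell2_set_scale: "x \<in> ell2_set \<Longrightarrow> (\<lambda>s. c * x s) \<in> ell2_set"
  unfolding ell2_set_def
  by (auto simp: norm_mult power_mult_distrib intro: summable_on_cmult_right)

lemma ell2_set_uminus: "x \<in> ell2_set \<Longrightarrow> (\<lambda>s. - x s) \<in> ell2_set"
  by (simp add: ell2_set_def)

lemma ell2_set_diff: "x \<in> ell2_set \<Longrightarrow> y \<in> ell2_set \<Longrightarrow> (\<lambda>s. x s - y s) \<in> ell2_set"
  using ell2_set_add(1)[of x "\<lambda>s. - y s"] ell2_set_uminus[of y] by simp

lemma ell1_subset_ell2: "ell1_set \<subseteq> ell2_set"
proof
  fix x :: "'v \<Rightarrow> complex"
  assume x: "x \<in> ell1_set"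
  show "x \<in> ell2_set"
  proof (rule ell2_setI(1))
    fix F :: "'v set"
    assume F: "finite F"
    have "L2_set (\<lambda>s. cmod (x s)) F \<le> (\<Sum>s\<in>F. cmod (x s))"
      by (rule L2_set_le_sum) auto
    also have "\<dots> \<le> (\<Sum>\<^sub>\<infinity>s. cmod (x s))"
      using x F by (intro finite_sum_le_infsum) (auto simp: ell1_set_def)
    finally show "L2_set (\<lambda>s. cmod (x s)) F \<le> (\<Sum>\<^sub>\<infinity>s. cmod (x s))" .
  qed
qed

typedef 'v ell2 = "ell2_set :: ('v \<Rightarrow> complex) set"
  morphisms ell2_fun Abs_ell2
  by (rule exI[of _ "\<lambda>_. 0"]) (simp add: ell2_set_def)

setup_lifting type_definition_ell2

instantiation ell2 :: (type) real_vector
begin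

lift_definition zero_ell2 :: "'a ell2" is "\<lambda>_. 0" by (simp add: ell2_set_def)
lift_definition plus_ell2 :: "'a ell2 \<Rightarrow> 'a ell2 \<Rightarrow> 'a ell2" is "\<lambda>x y s. x s + y s"
  by (rule ell2_set_add(1))
lift_definition uminus_ell2 :: "'a ell2 \<Rightarrow> 'a ell2" is "\<lambda>x s. - x s"
  by (rule ell2_set_uminus)
lift_definition minus_ell2 :: "'a ell2 \<Rightarrow> 'a ell2 \<Rightarrow> 'a ell2" is "\<lambda>x y s. x s - y s"
  by (rule ell2_set_diff)
lift_definition scaleR_ell2 :: "real \<Rightarrow> 'a ell2 \<Rightarrow> 'a ell2" is "\<lambda>r x s. complex_of_real r * x s"
  by (rule ell2_set_scale)

instance
  by standard (transfer; auto simp: algebra_simps)+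

end

instantiation ell2 :: (type) complex_normed_vector
begin

lift_definition scaleC_ell2 :: "complex \<Rightarrow> 'a ell2 \<Rightarrow> 'a ell2" is "\<lambda>c x s. c * x s"
  by (rule ell2_set_scale)
lift_definition norm_ell2 :: "'a ell2 \<Rightarrow> real" is "\<lambda>x. sqrt (\<Sum>\<^sub>\<infinity>s. (cmod (x s))\<^sup>2)" .
definition dist_ell2 :: "'a ell2 \<Rightarrow> 'a ell2 \<Rightarrow> real" where "dist_ell2 x y = norm (x - y)"
definition sgn_ell2 :: "'a ell2 \<Rightarrow> 'a ell2" where "sgn_ell2 x = x /\<^sub>R norm x"
definition uniformity_ell2 :: "('a ell2 \<times> 'a ell2) filter"
  where "uniformity_ell2 = (INF e\<in>{0 <..}. principal {(x, y). dist x y < e})"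
definition open_ell2 :: "'a ell2 set \<Rightarrow> bool"
  where "open_ell2 U = (\<forall>x\<in>U. \<forall>\<^sub>F (x', y) in uniformity. x' = x \<longrightarrow> y \<in> U)"

instance
proof
  fix c c' :: complex and r :: real and x y :: "'a ell2"
  show "dist x y = norm (x - y)" by (rule dist_ell2_def)
  show "sgn x = x /\<^sub>R norm x" by (rule sgn_ell2_def)
  show "uniformity = (INF e\<in>{0 <..}. principal {(x, y :: 'a ell2). dist x y < e})"
    by (rule uniformity_ell2_def)
  show "open U = (\<forall>x\<in>U. \<forall>\<^sub>F (x', y) in uniformity. x' = x \<longrightarrow> y \<in> U)" for U :: "'a ell2 set"
    by (rule open_ell2_def)
  show "norm x = 0 \<longleftrightarrow> x = 0"
  proof transfer
    fix x :: "'a \<Rightarrow> complex"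
    assume x: "x \<in> ell2_set"
    show "sqrt (\<Sum>\<^sub>\<infinity>s. (cmod (x s))\<^sup>2) = 0 \<longleftrightarrow> x = (\<lambda>_. 0)"
    proof
      assume 0: "sqrt (\<Sum>\<^sub>\<infinity>s. (cmod (x s))\<^sup>2) = 0"
      have "cmod (x s) \<le> 0" for s
        using L2_set_le_ell2_norm[OF x, of "{s}"] unfolding 0 by (simp add: L2_set_def)
      then show "x = (\<lambda>_. 0)" by (simp add: fun_eq_iff)
    next
      assume "x = (\<lambda>_. 0)"
      then show "sqrt (\<Sum>\<^sub>\<infinity>s. (cmod (x s))\<^sup>2) = 0" by simp
    qed
  qed
  show "norm (x + y) \<le> norm x + norm y" by transfer (rule ell2_set_add(2))
  show "c *\<^sub>C (x + y) = c *\<^sub>C x + c *\<^sub>C y" by transfer (auto simp: algebra_simps)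
  show "(c + c') *\<^sub>C x = c *\<^sub>C x + c' *\<^sub>C x" by transfer (auto simp: algebra_simps)
  show "c *\<^sub>C c' *\<^sub>C x = (c * c') *\<^sub>C x" by transfer (auto simp: algebra_simps)
  show "complex_of_real r *\<^sub>C x = r *\<^sub>R x" by transfer auto
  show *: "norm (c *\<^sub>C x) = cmod c * norm x" for c :: complex and x :: "'a ell2"
    by transfer (simp add: norm_mult power_mult_distrib infsum_cmult_right' real_sqrt_mult)
  have "r *\<^sub>R x = complex_of_real r *\<^sub>C x" by transfer auto
  then show "norm (r *\<^sub>R x) = \<bar>r\<bar> * norm x" by (simp add: *)
qed

end

text \<open>Passage between operators on functions and on the type \<open>ell2\<close>; the former are used only on
  \<open>ell2_set\<close>, the latter only if \<open>A\<close> preserves \<open>ell2_set\<close>.\<close>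

definition on_fun :: "('v ell2 \<Rightarrow> 'v ell2) \<Rightarrow> ('v \<Rightarrow> complex) \<Rightarrow> ('v \<Rightarrow> complex)"
  where "on_fun f x = ell2_fun (f (Abs_ell2 x))"

definition on_ell2 :: "(('v \<Rightarrow> complex) \<Rightarrow> ('v \<Rightarrow> complex)) \<Rightarrow> 'v ell2 \<Rightarrow> 'v ell2"
  where "on_ell2 A x = Abs_ell2 (A (ell2_fun x))"


section \<open>The tree and its automorphisms\<close>

text \<open>A graph is a symmetric irreflexive relation \<open>E\<close>; the vertex set is the whole type \<open>'v\<close>.
  Walks are given by their lists of vertices.\<close>

definition walk :: "('v \<Rightarrow> 'v \<Rightarrow> bool) \<Rightarrow> 'v \<Rightarrow> 'v \<Rightarrow> 'v list \<Rightarrow> bool"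
  where "walk E a b p \<longleftrightarrow> p \<noteq> [] \<and> hd p = a \<and> last p = b \<and> successively E p"

definition graph_cycle :: "('v \<Rightarrow> 'v \<Rightarrow> bool) \<Rightarrow> 'v list \<Rightarrow> bool"
  where "graph_cycle E p \<longleftrightarrow> 3 \<le> length p \<and> distinct p \<and> successively E p \<and> E (last p) (hd p)"

definition aleph0_regular_tree :: "('v \<Rightarrow> 'v \<Rightarrow> bool) \<Rightarrow> bool"
  where "aleph0_regular_tree E \<longleftrightarrow>
    countable (UNIV :: 'v set) \<and> symp E \<and> irreflp E \<and>
    (\<forall>a b. \<exists>p. walk E a b p) \<and> (\<nexists>p. graph_cycle E p) \<and>
    (\<forall>s. infinite {t. E s t})"

definition geodesic :: "('v \<Rightarrow> 'v \<Rightarrow> bool) \<Rightarrow> 'v \<Rightarrow> 'v \<Rightarrow> 'v list \<Rightarrow> bool"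
  where "geodesic E a b p \<longleftrightarrow> walk E a b p \<and> (\<forall>q. walk E a b q \<longrightarrow> length p \<le> length q)"

definition hat :: "('v \<Rightarrow> 'v \<Rightarrow> bool) \<Rightarrow> 'v \<Rightarrow> 'v \<Rightarrow> 'v"
  where "hat E e s = (if s = e then e else (THE t. \<exists>p. geodesic E e s (p @ [t, s])))"

definition Aut :: "('v \<Rightarrow> 'v \<Rightarrow> bool) \<Rightarrow> ('v \<Rightarrow> 'v) set"
  where "Aut E = {g. bij g \<and> (\<forall>s t. E (g s) (g t) \<longleftrightarrow> E s t)}"

definition lam :: "('v \<Rightarrow> 'v) \<Rightarrow> ('v \<Rightarrow> complex) \<Rightarrow> ('v \<Rightarrow> complex)"
  where "lam g x = (\<lambda>s. x (inv_into UNIV g s))"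

definition commutes_with_Aut ::
    "('v \<Rightarrow> 'v \<Rightarrow> bool) \<Rightarrow> ('v \<Rightarrow> complex) set \<Rightarrow> ('v \<Rightarrow> complex) set \<Rightarrow>
     (('v \<Rightarrow> complex) \<Rightarrow> ('v \<Rightarrow> complex)) \<Rightarrow> bool"
  where "commutes_with_Aut E X Y A \<longleftrightarrow>
    (\<forall>x\<in>X. A x \<in> Y) \<and> (\<forall>g\<in>Aut E. \<forall>x\<in>X. A (lam g x) = lam g (A x))"


section \<open>The operators and the representation\<close>

text \<open>On \<open>ell1_set\<close>, \<open>Lop E e\<close> is the norm-convergent sum of \<open>x s\<close> times the Dirac function at
  \<open>hat E e s\<close>, over all \<open>s \<noteq> e\<close>.\<close>

definition Lop :: "('v \<Rightarrow> 'v \<Rightarrow> bool) \<Rightarrow> 'v \<Rightarrow> ('v \<Rightarrow> complex) \<Rightarrow> ('v \<Rightarrow> complex)"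
  where "Lop E e x = (\<lambda>t. \<Sum>\<^sub>\<infinity>s\<in>{s. s \<noteq> e \<and> hat E e s = t}. x s)"

definition Lstar :: "('v \<Rightarrow> 'v \<Rightarrow> bool) \<Rightarrow> 'v \<Rightarrow> ('v \<Rightarrow> complex) \<Rightarrow> ('v \<Rightarrow> complex)"
  where "Lstar E e x = (\<lambda>s. if s = e then 0 else x (hat E e s))"

definition lam2 :: "('v \<Rightarrow> 'v) \<Rightarrow> 'v ell2 \<Rightarrow> 'v ell2"
  where "lam2 g = on_ell2 (lam g)"

definition deriv_op :: "('v \<Rightarrow> 'v \<Rightarrow> bool) \<Rightarrow> 'v \<Rightarrow> ('v \<Rightarrow> 'v) \<Rightarrow> 'v ell2 \<Rightarrow> 'v ell2"
  where "deriv_op E e g = on_ell2 (\<lambda>x s. Lstar E e (lam g x) s - lam g (Lstar E e x) s)"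

text \<open>The matrix with rows \<open>(u, w)\<close> and \<open>(0, v)\<close>; \<open>w\<close> need not be linear a priori.\<close>

definition upper_triangular :: "('a \<Rightarrow> 'a) \<Rightarrow> ('a \<Rightarrow> 'a) \<Rightarrow> ('a \<Rightarrow> 'a) \<Rightarrow> 'a::plus \<times> 'a \<Rightarrow> 'a \<times> 'a"
  where "upper_triangular u w v = (\<lambda>(x, y). (u x + w y, v y))"

definition lambda_d ::
    "('v \<Rightarrow> 'v \<Rightarrow> bool) \<Rightarrow> 'v \<Rightarrow> ('v \<Rightarrow> 'v) \<Rightarrow> ('v ell2 \<times> 'v ell2) \<Rightarrow>\<^sub>L ('v ell2 \<times> 'v ell2)"
  where "lambda_d E e g = Blinfun (upper_triangular (lam2 g) (deriv_op E e g) (lam2 g))"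

definition upper_left :: "(('a::real_normed_vector \<times> 'a) \<Rightarrow>\<^sub>L ('a \<times> 'a)) \<Rightarrow> 'a \<Rightarrow>\<^sub>L 'a"
  where "upper_left S = Blinfun (\<lambda>x. fst (S (x, 0)))"

definition lower_right :: "(('a::real_normed_vector \<times> 'a) \<Rightarrow>\<^sub>L ('a \<times> 'a)) \<Rightarrow> 'a \<Rightarrow>\<^sub>L 'a"
  where "lower_right S = Blinfun (\<lambda>y. snd (S (0, y)))"

lemma blinfun_apply_upper_left: "upper_left S x = fst (S (x, 0))"
  unfolding upper_left_def
  by (subst bounded_linear_Blinfun_apply)
    (intro bounded_linear_compose[OF bounded_linear_fst]
      bounded_linear_compose[OF blinfun.bounded_linear_right]
      bounded_linear_Pair bounded_linear_ident bounded_linear_zero refl)+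

lemma blinfun_apply_lower_right: "lower_right S y = snd (S (0, y))"
  unfolding lower_right_def
  by (subst bounded_linear_Blinfun_apply)
    (intro bounded_linear_compose[OF bounded_linear_snd]
      bounded_linear_compose[OF blinfun.bounded_linear_right]
      bounded_linear_Pair bounded_linear_ident bounded_linear_zero refl)+

lemma corners_of_upper_triangular:
  assumes S: "blinfun_apply S = upper_triangular (blinfun_apply u) w (blinfun_apply v)"
  shows "upper_left S = u" and "lower_right S = v"
proof -
  have "S (0, 0) = 0" by (metis blinfun.zero_right zero_prod_def)
  then have "w 0 = 0"
    by (auto simp: S upper_triangular_def zero_prod_def blinfun.zero_right)
  then show "upper_left S = u" "lower_right S = v"
    by (auto intro!: blinfun_eqI simp: blinfun_apply_upper_left blinfun_apply_lower_right S upper_triangular_def)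
qed

section \<open>Well-definedness\<close>

subsection \<open>Predecessors in a tree\<close>

definition joined_avoiding :: "('v \<Rightarrow> 'v \<Rightarrow> bool) \<Rightarrow> 'v \<Rightarrow> 'v \<Rightarrow> 'v \<Rightarrow> bool"
  where "joined_avoiding E s a b \<longleftrightarrow> (\<exists>p. walk E a b p \<and> s \<notin> set p)"

lemma joined_avoiding_trans:
  assumes "joined_avoiding E s a b" "joined_avoiding E s b c"
  shows "joined_avoiding E s a c"
proof -
  obtain p q where p: "walk E a b p" "s \<notin> set p" and q: "walk E b c q" "s \<notin> set q"
    using assms unfolding joined_avoiding_def by blast
  obtain q' where q': "q = b # q'"
    using q by (cases q) (auto simp: walk_def)
  have "walk E a c (p @ q')"
    using p(1) q(1) unfolding q' walk_def
    by (cases q') (auto simp: successively_append_iff)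
  then show ?thesis
    unfolding joined_avoiding_def using p q q' by (intro exI[of _ "p @ q'"]) auto
qed

lemma joined_avoiding_sym:
  assumes "symp E" "joined_avoiding E s a b"
  shows "joined_avoiding E s b a"
proof -
  obtain p where p: "walk E a b p" "s \<notin> set p"
    using assms unfolding joined_avoiding_def by blast
  have "(\<lambda>x y. E y x) = E" using assms(1) by (auto simp: symp_def fun_eq_iff)
  then have "successively E (rev p) = successively E p"
    by (metis successively_rev)
  then have "walk E b a (rev p)"
    using p(1) by (simp add: walk_def hd_rev last_rev)
  then show ?thesis unfolding joined_avoiding_def using p by (intro exI[of _ "rev p"]) auto
qed

lemma joined_avoiding_edge:
  assumes "E a b" "s \<noteq> a" "s \<noteq> b"
  shows "joined_avoiding E s a b"
  unfolding joined_avoiding_def walk_def using assms by (intro exI[of _ "[a, b]"]) simp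

lemma neighbour_avoiding_unique:
  assumes T: "aleph0_regular_tree E" and E: "E t s" "E t' s" and av: "joined_avoiding E s t t'"
  shows "t = t'"
proof (rule ccontr)
  assume ne: "t \<noteq> t'"
  define P where "P = (\<lambda>p. walk E t t' p \<and> s \<notin> set p)"
  obtain p0 where "P p0"
    using av by (auto simp: joined_avoiding_def P_def)
  from ex_has_least_nat[of P, OF this, of length]
  obtain p where p: "P p" and min: "\<And>q. P q \<Longrightarrow> length p \<le> length q"
    by blast
  have "distinct p"
  proof (rule ccontr)
    assume "\<not> distinct p"
    then obtain xs ys zs y where p_eq: "p = xs @ [y] @ ys @ [y] @ zs"
      using not_distinct_decomp by blast
    have "P (xs @ [y] @ zs)"
      using p unfolding P_def p_eq walk_def
      by (cases xs; cases zs) (auto simp: successively_append_iff successively_Cons hd_append)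
    from min[OF this] show False by (simp add: p_eq)
  qed
  moreover have "2 \<le> length p"
    using p ne unfolding P_def walk_def
    by (cases p rule: remdups_adj.cases) auto
  moreover have "E s t" using E(1) T by (auto simp: aleph0_regular_tree_def symp_def)
  ultimately have "graph_cycle E (s # p)"
    using p E(2) unfolding P_def graph_cycle_def walk_def
    by (auto simp: successively_Cons)
  then show False using T unfolding aleph0_regular_tree_def by blast
qed

lemma geodesic_penultimate:
  assumes "geodesic E a s (p @ [t, s])"
  shows "E t s" "joined_avoiding E s a t"
proof -
  have w: "walk E a s (p @ [t, s])"
    and min: "\<And>q. walk E a s q \<Longrightarrow> length (p @ [t, s]) \<le> length q"
    using assms by (auto simp: geodesic_def)
  show "E t s" using w by (auto simp: walk_def successively_append_iff)
  have w': "walk E a t (p @ [t])"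
    using w by (cases p) (auto simp: walk_def successively_append_iff successively_Cons hd_append)
  have "s \<notin> set (p @ [t])"
  proof
    assume "s \<in> set (p @ [t])"
    then obtain xs ys where d: "p @ [t] = xs @ s # ys" by (meson split_list)
    have "walk E a s (xs @ [s])"
      using w' unfolding d walk_def by (cases xs) (auto simp: successively_append_iff successively_Cons hd_append)
    from min[OF this] have "length (p @ [t]) < length (xs @ [s])" by simp
    then show False by (simp add: d)
  qed
  then show "joined_avoiding E s a t" using w' unfolding joined_avoiding_def by blast
qed

lemma geodesic_exists:
  assumes T: "aleph0_regular_tree E" and "s \<noteq> a"
  shows "\<exists>t p. geodesic E a s (p @ [t, s])"
proof -
  obtain q0 where "walk E a s q0"
    using T unfolding aleph0_regular_tree_def by blast
  from ex_has_least_nat[of "walk E a s", OF this, of length]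
  obtain q where q: "geodesic E a s q"
    by (auto simp: geodesic_def)
  then have "q \<noteq> []" "hd q = a" "last q = s" by (auto simp: geodesic_def walk_def)
  then obtain q' where q': "q = q' @ [s]" by (metis append_butlast_last_id)
  then have "q' \<noteq> []" using \<open>hd q = a\<close> \<open>s \<noteq> a\<close> by auto
  then obtain p t where "q' = p @ [t]" by (metis append_butlast_last_id)
  then show ?thesis using q q' by auto
qed

lemma hat_iff:
  assumes T: "aleph0_regular_tree E" and "s \<noteq> a"
  shows "hat E a s = t \<longleftrightarrow> E t s \<and> joined_avoiding E s a t"
proof -
  have sym: "symp E" using T by (simp add: aleph0_regular_tree_def)
  have uniq: "t = t'" if "E t s" "joined_avoiding E s a t" "E t' s" "joined_avoiding E s a t'" for t t'
    using neighbour_avoiding_unique[OF T that(1,3)]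
      joined_avoiding_trans[OF joined_avoiding_sym[OF sym that(2)] that(4)] by blast
  obtain t0 p0 where g: "geodesic E a s (p0 @ [t0, s])"
    using geodesic_exists[OF assms] by blast
  note t0 = geodesic_penultimate[OF g]
  have "(THE t. \<exists>p. geodesic E a s (p @ [t, s])) = t0"
  proof (rule the_equality)
    show "\<exists>p. geodesic E a s (p @ [t0, s])" using g by blast
    show "t = t0" if "\<exists>p. geodesic E a s (p @ [t, s])" for t
      using that uniq[OF _ _ t0] geodesic_penultimate[of E a s _ t] by blast
  qed
  then have "hat E a s = t0" using \<open>s \<noteq> a\<close> by (simp add: hat_def)
  then show ?thesis using t0 uniq by blast
qed

lemma hat_geodesic:
  assumes T: "aleph0_regular_tree E" and "s \<noteq> a" and "geodesic E a s (p @ [t, s])"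
  shows "hat E a s = t"
  using geodesic_penultimate[OF assms(3)] by (simp add: hat_iff[OF T \<open>s \<noteq> a\<close>])

lemma hat_change_root:
  assumes T: "aleph0_regular_tree E" and E: "E a b" and s: "s \<noteq> a" "s \<noteq> b"
  shows "hat E a s = hat E b s"
proof -
  have "E b a" using T E by (auto simp: aleph0_regular_tree_def symp_def)
  then have "joined_avoiding E s b (hat E a s)"
    using hat_iff[OF T s(1), of "hat E a s"] joined_avoiding_edge[of E b a s] s
    by (metis joined_avoiding_trans)
  then show ?thesis
    using hat_iff[OF T s(1), of "hat E a s"] hat_iff[OF T s(2), of "hat E a s"] by auto
qed

lemma finite_hat_differs:
  assumes T: "aleph0_regular_tree E"
  shows "finite {s. hat E a s \<noteq> hat E b s}"
proof -
  have "finite {s. hat E a s \<noteq> hat E b s}" if "walk E a b p" for p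
    using that
  proof (induction p arbitrary: a)
    case Nil
    then show ?case by (simp add: walk_def)
  next
    case (Cons x p)
    then have x: "x = a" by (simp add: walk_def)
    show ?case
    proof (cases p)
      case Nil
      then have "a = b" using Cons.prems by (auto simp: walk_def)
      then show ?thesis by simp
    next
      case (Cons y q)
      then have "E a y" "walk E y b p"
        using Cons.prems x by (auto simp: walk_def)
      then have "finite {s. hat E y s \<noteq> hat E b s}"
        using Cons.IH by blast
      moreover have "{s. hat E a s \<noteq> hat E b s} \<subseteq> {a, y} \<union> {s. hat E y s \<noteq> hat E b s}"
        using hat_change_root[OF T \<open>E a y\<close>] by auto
      ultimately show ?thesis by (meson finite.emptyI finite_UnI finite_insert finite_subset)
    qed
  qed
  moreover obtain p where "walk E a b p" using T unfolding aleph0_regular_tree_def by blast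
  ultimately show ?thesis by blast
qed

lemma Aut_inv_apply:
  assumes "g \<in> Aut E"
  shows "inv_into UNIV g (g s) = s" "g (inv_into UNIV g s) = s"
  using assms by (auto simp: Aut_def bij_is_inj bij_is_surj inv_f_f surj_f_inv_f)

lemma hat_Aut:
  assumes T: "aleph0_regular_tree E" and g: "g \<in> Aut E"
  shows "hat E (g a) (g s) = g (hat E a s)"
proof (cases "s = a")
  case True
  then show ?thesis by (simp add: hat_def)
next
  case False
  have inj: "inj g" using g by (auto simp: Aut_def bij_is_inj)
  have "g s \<noteq> g a" using False inj by (auto dest: injD)
  obtain p where p: "walk E a (hat E a s) p" "s \<notin> set p" and E: "E (hat E a s) s"
    using hat_iff[OF T False, of "hat E a s"] by (auto simp: joined_avoiding_def)
  have "(\<lambda>x y. E (g x) (g y)) = E" using g by (auto simp: Aut_def)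
  then have "successively E (map g p) = successively E p"
    by (metis successively_map)
  then have "walk E (g a) (g (hat E a s)) (map g p)"
    using p(1) by (simp add: walk_def hd_map last_map)
  moreover have "g s \<notin> set (map g p)" using p(2) inj by (auto dest: injD)
  ultimately have "joined_avoiding E (g s) (g a) (g (hat E a s))"
    unfolding joined_avoiding_def by blast
  moreover have "E (g (hat E a s)) (g s)" using E g by (auto simp: Aut_def)
  ultimately show ?thesis using hat_iff[OF T \<open>g s \<noteq> g a\<close>] by blast
qed

lemma bij_inv_Aut: "g \<in> Aut E \<Longrightarrow> bij (inv_into UNIV g)"
  by (auto simp: Aut_def bij_imp_bij_inv)


subsection \<open>The operators\<close>

lemma lam_ell2:
  assumes g: "g \<in> Aut E" and x: "x \<in> ell2_set"
  shows "lam g x \<in> ell2_set"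
    and "(\<Sum>\<^sub>\<infinity>s. (cmod (lam g x s))\<^sup>2) = (\<Sum>\<^sub>\<infinity>s. (cmod (x s))\<^sup>2)"
proof -
  have bij: "bij_betw (inv_into UNIV g) UNIV UNIV"
    using bij_inv_Aut[OF g] .
  show "lam g x \<in> ell2_set"
    using x summable_on_reindex_bij_betw[OF bij, of "\<lambda>s. (cmod (x s))\<^sup>2"]
    by (simp add: ell2_set_def lam_def)
  show "(\<Sum>\<^sub>\<infinity>s. (cmod (lam g x s))\<^sup>2) = (\<Sum>\<^sub>\<infinity>s. (cmod (x s))\<^sup>2)"
    using infsum_reindex_bij_betw[OF bij, of "\<lambda>s. (cmod (x s))\<^sup>2"]
    by (simp add: lam_def)
qed

lemma ell2_fun_lam2: "g \<in> Aut E \<Longrightarrow> ell2_fun (lam2 g x) = lam g (ell2_fun x)"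
  by (simp add: lam2_def on_ell2_def Abs_ell2_inverse lam_ell2(1) ell2_fun)

lemma norm_lam2: "g \<in> Aut E \<Longrightarrow> norm (lam2 g x) = norm x"
  by (simp add: norm_ell2.rep_eq ell2_fun_lam2 lam_ell2(2) ell2_fun)

lemma bounded_linear_ell2I:
  fixes f :: "'v ell2 \<Rightarrow> 'v ell2"
  assumes "\<And>x. ell2_fun (f x) = A (ell2_fun x)"
    and "\<And>x y s. A (\<lambda>s. x s + y s) s = A x s + A y s"
    and "\<And>c x s. A (\<lambda>s. c * x s) s = c * A x s"
    and "\<And>x. norm (f x) \<le> C * norm x"
  shows "bounded_linear f" "homogeneous f"
proof -
  show "bounded_linear f"
  proof (rule bounded_linear_intro)
    show "f (x + y) = f x + f y" for x y
      by (rule iffD1[OF ell2_fun_inject]) (auto simp: assms(1,2) plus_ell2.rep_eq)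
    show "f (r *\<^sub>R x) = r *\<^sub>R f x" for r x
      by (rule iffD1[OF ell2_fun_inject]) (auto simp: assms(1,3) scaleR_ell2.rep_eq)
    show "norm (f x) \<le> norm x * C" for x
      using assms(4)[of x] by (simp add: mult.commute)
  qed
  show "homogeneous f"
    unfolding homogeneous_def
  proof (intro allI)
    show "f (c *\<^sub>C x) = c *\<^sub>C f x" for c x
      by (rule iffD1[OF ell2_fun_inject]) (auto simp: assms(1,3) scaleC_ell2.rep_eq)
  qed
qed

lemma lam2_bounded_linear:
  assumes "g \<in> Aut E"
  shows "bounded_linear (lam2 g)" and "homogeneous (lam2 g)"
proof -
  have a: "lam g (\<lambda>s. x s + y s) s = lam g x s + lam g y s" for x y s
    by (simp add: lam_def)
  have b: "lam g (\<lambda>s. c * x s) s = c * lam g x s" for c x s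
    by (simp add: lam_def)
  have c: "norm (lam2 g x) \<le> 1 * norm x" for x
    by (simp add: norm_lam2[OF assms])
  show "bounded_linear (lam2 g)" and "homogeneous (lam2 g)"
    using bounded_linear_ell2I[where f = "lam2 g" and A = "lam g", OF ell2_fun_lam2[OF assms] a b c] .
qed

lemma cmod_le_norm_ell2: "cmod (ell2_fun x s) \<le> norm x"
  using L2_set_le_ell2_norm[OF ell2_fun, of "{s}" x] by (simp add: L2_set_def norm_ell2.rep_eq)

lemma deriv_finite_support:
  assumes T: "aleph0_regular_tree E" and g: "g \<in> Aut E"
  shows "\<exists>F. finite F \<and> (\<forall>x s. s \<notin> F \<longrightarrow> Lstar E e (lam g x) s = lam g (Lstar E e x) s)"
proof (intro exI conjI allI impI)
  let ?F = "{e, g e} \<union> {s. hat E e s \<noteq> hat E (g e) s}"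
  show "finite ?F" using finite_hat_differs[OF T] by simp
  fix x :: "'a \<Rightarrow> complex" and s
  assume s: "s \<notin> ?F"
  have "hat E e (inv_into UNIV g s) = inv_into UNIV g (hat E e s)"
    using hat_Aut[OF T g, of e "inv_into UNIV g s"] s by (simp add: Aut_inv_apply[OF g])
  moreover have "inv_into UNIV g s \<noteq> e"
    using s Aut_inv_apply(2)[OF g, of s] by auto
  ultimately show "Lstar E e (lam g x) s = lam g (Lstar E e x) s"
    using s by (simp add: Lstar_def lam_def)
qed

lemma deriv_op:
  assumes T: "aleph0_regular_tree E" and g: "g \<in> Aut E"
  shows "ell2_fun (deriv_op E e g x) =
      (\<lambda>s. Lstar E e (lam g (ell2_fun x)) s - lam g (Lstar E e (ell2_fun x)) s)"
    and "bounded_linear (deriv_op E e g)" "homogeneous (deriv_op E e g)"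
proof -
  define D where "D = (\<lambda>x s. Lstar E e (lam g x) s - lam g (Lstar E e x) s)"
  obtain F where F: "finite F" "\<And>x s. s \<notin> F \<Longrightarrow> D x s = 0"
    using deriv_finite_support[OF T g, of e] unfolding D_def by auto
  have D_le: "cmod (D (ell2_fun x) s) \<le> 2 * norm x" for x s
  proof -
    have "cmod (Lstar E e (lam g (ell2_fun x)) s) \<le> norm x"
      and "cmod (lam g (Lstar E e (ell2_fun x)) s) \<le> norm x"
      by (auto simp: Lstar_def lam_def cmod_le_norm_ell2)
    then show ?thesis
      using norm_triangle_ineq4[of "Lstar E e (lam g (ell2_fun x)) s" "lam g (Lstar E e (ell2_fun x)) s"]
      unfolding D_def by linarith
  qed
  have L2: "L2_set (\<lambda>s. cmod (D (ell2_fun x) s)) H \<le> (2 * card F) * norm x" if "finite H" for x H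
  proof -
    have "L2_set (\<lambda>s. cmod (D (ell2_fun x) s)) H \<le> (\<Sum>s\<in>H. cmod (D (ell2_fun x) s))"
      by (rule L2_set_le_sum) auto
    also have "\<dots> = (\<Sum>s\<in>H \<inter> F. cmod (D (ell2_fun x) s))"
      using that F(2) by (intro sum.mono_neutral_right) auto
    also have "\<dots> \<le> (\<Sum>s\<in>F. cmod (D (ell2_fun x) s))"
      using F(1) by (intro sum_mono2) auto
    also have "\<dots> \<le> (\<Sum>s\<in>F. 2 * norm x)"
      by (intro sum_mono D_le)
    finally show ?thesis by simp
  qed
  have eq: "ell2_fun (deriv_op E e g x) = D (ell2_fun x)" for x
    unfolding deriv_op_def on_ell2_def D_def[symmetric]
    by (rule Abs_ell2_inverse) (rule ell2_setI(1)[OF L2])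
  show "ell2_fun (deriv_op E e g x) =
      (\<lambda>s. Lstar E e (lam g (ell2_fun x)) s - lam g (Lstar E e (ell2_fun x)) s)"
    by (simp add: eq D_def)
  have a: "D (\<lambda>s. x s + y s) s = D x s + D y s" for x y s
    by (simp add: D_def Lstar_def lam_def)
  have b: "D (\<lambda>s. c * x s) s = c * D x s" for c x s
    by (simp add: D_def Lstar_def lam_def right_diff_distrib)
  have c: "norm (deriv_op E e g x) \<le> (2 * card F) * norm x" for x
    unfolding norm_ell2.rep_eq eq using ell2_setI(2)[OF L2] by (simp add: norm_ell2.rep_eq)
  show "bounded_linear (deriv_op E e g)" "homogeneous (deriv_op E e g)"
    using bounded_linear_ell2I[where f = "deriv_op E e g" and A = D, OF eq a b c] .
qed

lemma blinfun_apply_lambda_d: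
  assumes T: "aleph0_regular_tree E" and g: "g \<in> Aut E"
  shows "blinfun_apply (lambda_d E e g) = upper_triangular (lam2 g) (deriv_op E e g) (lam2 g)"
proof -
  have "bounded_linear (upper_triangular (lam2 g) (deriv_op E e g) (lam2 g))"
    unfolding upper_triangular_def case_prod_beta
    by (intro bounded_linear_Pair bounded_linear_add
        bounded_linear_compose[OF lam2_bounded_linear(1)[OF g] bounded_linear_fst]
        bounded_linear_compose[OF lam2_bounded_linear(1)[OF g] bounded_linear_snd]
        bounded_linear_compose[OF deriv_op(2)[OF T g] bounded_linear_snd])
  then show ?thesis unfolding lambda_d_def by (rule bounded_linear_Blinfun_apply)
qed

lemma Lop_dirac:
  "Lop E e (\<lambda>r. if r = s then 1 else 0) =
    (if s = e then (\<lambda>_. 0) else (\<lambda>r. if r = hat E e s then 1 else 0))"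
proof
  fix t
  have "Lop E e (\<lambda>r. if r = s then 1 else 0) t =
      (\<Sum>\<^sub>\<infinity>r\<in>{r. r \<noteq> e \<and> hat E e r = t} \<inter> {s}. if r = s then 1 else 0)"
    unfolding Lop_def by (rule infsum_cong_neutral) auto
  then show "Lop E e (\<lambda>r. if r = s then 1 else 0) t =
      (if s = e then (\<lambda>_. 0) else (\<lambda>r. if r = hat E e s then 1 else 0)) t"
    by auto
qed

lemma Lop_ell1:
  assumes x: "x \<in> ell1_set"
  shows "Lop E e x \<in> ell1_set"
    and "(\<Sum>\<^sub>\<infinity>t. cmod (Lop E e x t)) \<le> (\<Sum>\<^sub>\<infinity>s. cmod (x s))"
proof -
  have b: "(\<Sum>t\<in>F. cmod (Lop E e x t)) \<le> (\<Sum>\<^sub>\<infinity>s. cmod (x s))" if F: "finite F" for F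
  proof -
    let ?A = "\<lambda>t. {s. s \<noteq> e \<and> hat E e s = t}"
    have sm: "(\<lambda>s. cmod (x s)) summable_on B" for B
      using x unfolding ell1_set_def by (auto intro: summable_on_subset_banach)
    have "(\<Sum>t\<in>F. cmod (Lop E e x t)) \<le> (\<Sum>t\<in>F. \<Sum>\<^sub>\<infinity>s\<in>?A t. cmod (x s))"
      unfolding Lop_def by (intro sum_mono norm_infsum_bound sm)
    also have "\<dots> = (\<Sum>\<^sub>\<infinity>s\<in>(\<Union>t\<in>F. ?A t). cmod (x s))"
      using F by (intro sum_infsum sm) auto
    also have "\<dots> \<le> (\<Sum>\<^sub>\<infinity>s. cmod (x s))"
      by (intro infsum_mono2 sm) auto
    finally show ?thesis .
  qed
  show 1: "Lop E e x \<in> ell1_set"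
    unfolding ell1_set_def mem_Collect_eq
    by (rule nonneg_bdd_above_summable_on) (auto intro!: bdd_aboveI2[OF b])
  show "(\<Sum>\<^sub>\<infinity>t. cmod (Lop E e x t)) \<le> (\<Sum>\<^sub>\<infinity>s. cmod (x s))"
    using 1 by (intro infsum_le_finite_sums b) (auto simp: ell1_set_def)
qed

end

theory Submission
  imports Defs
begin

text \<open>
  Write \<open>H\<close> for the space of square-summable functions on the tree, \<open>X\<close> for the first summand of \<open>H \<times> H\<close>, and
  \<open>u, w, v\<close> for the entries of a member \<open>S\<close> of \<open>G\<close>, so that \<open>S (x, y) = (u x + w y, v y)\<close>.

  The map \<open>\<psi>\<close> comes from an invariant norm. Since \<open>G\<close> is a bounded group on a Hilbert space, the supremum
  of the norms \<open>\<parallel>S z\<parallel>\<close> over \<open>S\<close> in \<open>G\<close> is an equivalent norm preserved by \<open>G\<close>, and its square is strongly convex,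
  being a supremum of Hilbert norms squared with a common modulus of convexity
  (\<open>invariant_norm_strongly_convex\<close>). So it has exactly one minimum on each fibre \<open>H \<times> {y}\<close>, and this
  minimum is attained at \<open>(- \<psi> y, y)\<close>. As \<open>G\<close> permutes the fibres and preserves the norm, \<open>S\<close> maps the
  minimal point over \<open>y\<close> to the minimal point over \<open>v y\<close>, which says \<open>w y = u (\<psi> y) - \<psi> (v y)\<close>. Homogeneity and
  continuity of \<open>\<psi>\<close> follow from those of the norm. For \<open>S = \<lambda>\<^sub>d(g)\<close> the formula for \<open>w\<close> reads
  \<open>L\<^sup>* \<lambda>(g) - \<lambda>(g) L\<^sup>* = \<lambda>(g) \<psi> - \<psi> \<lambda>(g)\<close>, so \<open>L\<^sup>* + \<psi>\<close> commutes with \<open>\<lambda>(g)\<close>. On summable functions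
  \<open>L\<^sup>* + L\<close> is the adjacency operator, which commutes with \<open>\<lambda>(g)\<close>, and therefore so does \<open>L - \<psi>\<close>.

  That \<open>S \<mapsto> u\<close> and \<open>S \<mapsto> v\<close> are isomorphisms of topological groups amounts to this: \<open>S\<close> tends strongly to
  the identity as soon as one diagonal entry does. Consider the filter of neighbourhoods of the identity
  that is pulled back along the chosen entry, and the closed space \<open>Y\<close> of vectors \<open>z\<close> with \<open>S z \<longlongrightarrow> z\<close> along
  this filter. The filter is invariant under conjugation, so \<open>Y\<close> is invariant under \<open>G\<close>. Averaging over
  orbits of small neighbourhoods, with limits provided by strong convexity, gives a bounded projection onto \<open>Y\<close>
  that commutes with \<open>G\<close> (\<open>equivariant_projection\<close>). The representation of the automorphism group on \<open>H\<close> is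
  irreducible (\<open>invariant_subspace_UNIV\<close>), so if \<open>Y\<close> were not the whole space, either \<open>Y\<close> would be \<open>X\<close> (for the
  entry \<open>u\<close>) or \<open>Y\<close> would be a complement of \<open>X\<close> (for the entry \<open>v\<close>). Both yield an invariant complement of \<open>X\<close>,
  that is, a bounded operator \<open>\<theta>\<close> with \<open>\<theta> \<lambda>(g) - \<lambda>(g) \<theta> = d(g)\<close> for all \<open>g\<close>. But the derivation is not
  inner (\<open>derivation_not_inner\<close>): such a \<open>\<theta>\<close> would send the Dirac functions at all the infinitely many
  neighbours of the root to functions with value \<open>-1\<close> at the root.
\<close>

section \<open>Strong convexity and adjoints in Hilbert spaces\<close>

text \<open>
  By strong convexity the midpoint of two nearly minimal points is even better unless they are close
  to each other, so minimising sequences are Cauchy. The second conclusion makes the minimum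
  quantitative: every nearly minimal point is near \<open>m\<close>. All later uniqueness, continuity and
  convergence arguments rest on it.
\<close>

lemma strongly_convex_minimum:
  fixes q :: "'a::banach \<Rightarrow> real"
  assumes A: "closed A" "convex A" "A \<noteq> {}"
    and cont: "continuous_on UNIV q" and c: "0 < c"
    and conv: "\<And>x y. q (midpoint x y) \<le> (q x + q y) / 2 - c * (norm (x - y))\<^sup>2"
    and below: "\<And>x. B \<le> q x"
  obtains m where "m \<in> A" "\<And>a. a \<in> A \<Longrightarrow> 2 * c * (norm (a - m))\<^sup>2 \<le> q a - q m"
proof -
  define r where "r = Inf (q ` A)"
  have bdd: "bdd_below (q ` A)" using below by (auto intro!: bdd_belowI2)
  have r_le: "r \<le> q a" if "a \<in> A" for a
    unfolding r_def using that bdd by (intro cINF_lower)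
  have close: "2 * c * (norm (a - b))\<^sup>2 \<le> q a + q b - 2 * r" if "a \<in> A" "b \<in> A" for a b
  proof -
    have "midpoint a b \<in> A"
      using A(2) that by (meson convex_contains_segment midpoint_in_closed_segment subsetD)
    from r_le[OF this] conv[of a b] show ?thesis by argo
  qed
  \<comment> \<open>A minimising sequence.\<close>
  have "\<exists>a\<in>A. q a < r + inverse (real (Suc n))" for n
  proof -
    have "Inf (q ` A) < r + inverse (real (Suc n))" by (simp add: r_def)
    then show ?thesis using A(3) bdd by (subst (asm) cINF_less_iff) auto
  qed
  then obtain a where a: "\<And>n. a n \<in> A" "\<And>n. q (a n) < r + inverse (real (Suc n))"
    by metis
  have lim: "(\<lambda>n. q (a n)) \<longlonglongrightarrow> r"
  proof (rule tendsto_sandwich[OF _ _ tendsto_const])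
    show "\<forall>\<^sub>F n in sequentially. r \<le> q (a n)" using r_le a(1) by auto
    show "\<forall>\<^sub>F n in sequentially. q (a n) \<le> r + inverse (real (Suc n))"
      using a(2) by (auto intro!: always_eventually less_imp_le)
    show "(\<lambda>n. r + inverse (real (Suc n))) \<longlonglongrightarrow> r"
      using tendsto_add[OF tendsto_const LIMSEQ_inverse_real_of_nat, of r] by simp
  qed
  have "Cauchy a"
  proof (rule CauchyI)
    fix \<epsilon> :: real
    assume \<epsilon>: "0 < \<epsilon>"
    then have "0 < c * \<epsilon>\<^sup>2" using c by simp
    then have "\<forall>\<^sub>F n in sequentially. q (a n) < r + c * \<epsilon>\<^sup>2"
      using lim by (intro order_tendstoD(2)[OF lim]) auto
    then obtain M where M: "\<And>n. n \<ge> M \<Longrightarrow> q (a n) < r + c * \<epsilon>\<^sup>2"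
      by (auto simp: eventually_sequentially)
    show "\<exists>M. \<forall>m\<ge>M. \<forall>n\<ge>M. norm (a m - a n) < \<epsilon>"
    proof (intro exI allI impI)
      fix m n assume "m \<ge> M" "n \<ge> M"
      then have "2 * c * (norm (a m - a n))\<^sup>2 < 2 * c * \<epsilon>\<^sup>2"
        using close[OF a(1) a(1), of m n] M[of m] M[of n] by linarith
      then have "(norm (a m - a n))\<^sup>2 < \<epsilon>\<^sup>2" using c by simp
      then show "norm (a m - a n) < \<epsilon>" using \<epsilon> by (simp add: power_less_imp_less_base)
    qed
  qed
  then obtain m where m: "a \<longlonglongrightarrow> m" by (auto simp: Cauchy_convergent_iff convergent_def)
  have mA: "m \<in> A" using A(1) a(1) m by (metis closed_sequentially)
  have "(\<lambda>n. q (a n)) \<longlonglongrightarrow> q m"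
    by (rule continuous_on_tendsto_compose[OF cont m]) auto
  then have qm: "q m = r" using lim LIMSEQ_unique by blast
  show thesis
  proof
    show "m \<in> A" by fact
    show "2 * c * (norm (b - m))\<^sup>2 \<le> q b - q m" if "b \<in> A" for b
      using close[OF that mA] qm by simp
  qed
qed

text \<open>
  The representing vector is the minimum of the strongly convex function
  \<open>x \<mapsto> \<parallel>x\<parallel>\<^sup>2 - 2 f x\<close>.
\<close>

lemma Riesz_real:
  fixes f :: "'a::{real_inner, banach} \<Rightarrow> real"
  assumes "bounded_linear f"
  shows "\<exists>m. \<forall>x. f x = m \<bullet> x"
proof -
  interpret f: bounded_linear f by fact
  obtain K where K: "\<And>x. norm (f x) \<le> norm x * K" using f.bounded by blast
  define q where "q = (\<lambda>x. (norm x)\<^sup>2 - 2 * f x)"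
  have exp: "q (midpoint x y) = (q x + q y) / 2 - 1/4 * (norm (x - y))\<^sup>2" for x y
    unfolding q_def midpoint_def
    by (simp add: f.scaleR f.add power2_norm_eq_inner inner_simps inner_commute field_simps)
  have "- (K\<^sup>2) \<le> q x" for x
  proof -
    have "2 * f x \<le> 2 * (norm x * K)" using K[of x] by auto
    moreover have "0 \<le> (norm x - K)\<^sup>2" by simp
    ultimately show ?thesis unfolding q_def by (simp add: power2_diff)
  qed
  moreover have "continuous_on UNIV q"
    unfolding q_def by (intro continuous_intros f.continuous_on)
  ultimately obtain m where m: "\<And>a. 2 * (1/4) * (norm (a - m))\<^sup>2 \<le> q a - q m"
    using strongly_convex_minimum[OF closed_UNIV convex_UNIV UNIV_not_empty _ _ eq_refl[OF exp]] by auto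
  have "f k = m \<bullet> k" for k
  proof -
    define b where "b = m \<bullet> k - f k"
    \<comment> \<open>The first variation of \<open>q\<close> at its minimum in the direction \<open>k\<close>.\<close>
    have *: "0 \<le> t\<^sup>2 * (norm k)\<^sup>2 + 2 * t * b" for t
    proof -
      have "0 \<le> q (m + t *\<^sub>R k) - q m"
        by (rule order_trans[OF _ m]) simp
      moreover have "(norm (m + t *\<^sub>R k))\<^sup>2 = (norm m)\<^sup>2 + t\<^sup>2 * (norm k)\<^sup>2 + 2 * t * (m \<bullet> k)"
        unfolding power2_norm_eq_inner by (simp add: inner_add inner_commute power2_eq_square)
      ultimately show ?thesis
        unfolding q_def b_def by (simp add: f.scaleR f.add algebra_simps)
    qed
    \<comment> \<open>The step \<open>t = - b / d\<close> makes the quadratic negative unless \<open>b = 0\<close>; adding one covers \<open>k = 0\<close>.\<close>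
    define d where "d = (norm k)\<^sup>2 + 1"
    have d: "0 < d" "(norm k)\<^sup>2 \<le> d" by (auto simp: d_def add_nonneg_pos)
    have "0 \<le> (b/d)\<^sup>2 * (norm k)\<^sup>2 - 2 * (b/d) * b" using *[of "- b/d"] by simp
    also have "\<dots> \<le> (b/d)\<^sup>2 * d - 2 * (b/d) * b" using d by (simp add: mult_left_mono)
    also have "\<dots> = - (b\<^sup>2 / d)" using d by (simp add: field_simps power2_eq_square)
    finally have "b\<^sup>2 \<le> 0" using d by (simp add: field_simps)
    then show ?thesis by (simp add: b_def)
  qed
  then show ?thesis by blast
qed

text \<open>
  The adjoint for the real inner product, picked out by its characteristic identity; that one exists is
  the content of \<open>inner_adj\<close>.
\<close>

definition adj :: "('a::{real_inner, banach} \<Rightarrow>\<^sub>L 'a) \<Rightarrow> ('a \<Rightarrow>\<^sub>L 'a)"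
  where "adj S = (SOME R. \<forall>x y. blinfun_apply R x \<bullet> y = x \<bullet> blinfun_apply S y)"

lemma inner_adj: "blinfun_apply (adj S) x \<bullet> y = x \<bullet> blinfun_apply S y"
proof -
  have "\<forall>x. \<exists>m. \<forall>y. x \<bullet> blinfun_apply S y = m \<bullet> y"
    by (intro allI Riesz_real bounded_linear_compose[OF bounded_linear_inner_right blinfun.bounded_linear_right])
  then obtain R where R: "\<And>x y. R x \<bullet> y = x \<bullet> blinfun_apply S y" by metis
  have "bounded_linear R"
  proof (rule bounded_linear_intro)
    show "R (x + y) = R x + R y" for x y
      by (rule vector_eq_rdot[THEN iffD1]) (simp add: R inner_simps)
    show "R (r *\<^sub>R x) = r *\<^sub>R R x" for r x
      by (rule vector_eq_rdot[THEN iffD1]) (simp add: R inner_simps)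
    show "norm (R x) \<le> norm x * norm S" for x
    proof -
      have "norm (R x) * norm (R x) = x \<bullet> blinfun_apply S (R x)"
        by (simp add: R[symmetric] norm_eq_sqrt_inner)
      also have "\<dots> \<le> norm x * (norm S * norm (R x))"
        by (intro order_trans[OF norm_cauchy_schwarz] mult_left_mono norm_blinfun) simp
      finally show ?thesis by (cases "norm (R x) = 0") (auto simp: mult.assoc[symmetric] mult_le_cancel_right)
    qed
  qed
  then have "\<exists>R'. \<forall>x y. blinfun_apply R' x \<bullet> y = x \<bullet> blinfun_apply S y"
    using R by (metis bounded_linear_Blinfun_apply)
  from someI_ex[OF this] show ?thesis unfolding adj_def by blast
qed

lemma adj_eqI: "(\<And>x y. blinfun_apply R x \<bullet> y = x \<bullet> blinfun_apply S y) \<Longrightarrow> adj S = R"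
  by (intro blinfun_eqI vector_eq_rdot[THEN iffD1]) (simp add: inner_adj)

lemma adj_compose: "adj (S o\<^sub>L T) = adj T o\<^sub>L adj S"
  by (rule adj_eqI) (simp add: inner_adj)

lemma adj_id: "adj id_blinfun = id_blinfun"
  by (rule adj_eqI) simp

lemma adj_adj: "adj (adj S) = S"
  by (rule adj_eqI) (metis inner_adj inner_commute)

lemma norm_adj_le: "norm (adj S) \<le> norm S"
proof (rule norm_blinfun_bound)
  fix x
  have "norm (adj S x) * norm (adj S x) = x \<bullet> blinfun_apply S (adj S x)"
    by (simp only: inner_adj[of S x, symmetric] dot_square_norm power2_eq_square)
  also have "\<dots> \<le> norm x * (norm S * norm (adj S x))"
    by (intro order_trans[OF norm_cauchy_schwarz] mult_left_mono norm_blinfun) simp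
  finally show "norm (adj S x) \<le> norm S * norm x"
    by (cases "norm (adj S x) = 0") (auto simp: mult.assoc[symmetric] mult_le_cancel_right mult.commute)
qed simp

section \<open>The invariant norm of a bounded group\<close>

locale bounded_operator_group =
  fixes G :: "('a::{real_inner, banach} \<Rightarrow>\<^sub>L 'a) set"
  assumes id_mem: "id_blinfun \<in> G"
    and compose_mem: "S \<in> G \<Longrightarrow> T \<in> G \<Longrightarrow> S o\<^sub>L T \<in> G"
    and inverse_mem: "S \<in> G \<Longrightarrow> \<exists>R\<in>G. R o\<^sub>L S = id_blinfun \<and> S o\<^sub>L R = id_blinfun"
    and bounded: "bounded G"
begin

text \<open>
  The lower bound by one keeps this constant positive without a case distinction.
\<close>

definition group_bound :: real where "group_bound = (SOME B. 1 \<le> B \<and> (\<forall>S\<in>G. norm S \<le> B))"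

lemma group_bound: "1 \<le> group_bound" "S \<in> G \<Longrightarrow> norm S \<le> group_bound"
proof -
  obtain B where B: "\<forall>S\<in>G. norm S \<le> B" using bounded by (auto simp: bounded_iff)
  then have "\<exists>B. 1 \<le> B \<and> (\<forall>S\<in>G. norm S \<le> B)"
    by (intro exI[of _ "max 1 B"]) auto
  from someI_ex[OF this] show "1 \<le> group_bound" "S \<in> G \<Longrightarrow> norm S \<le> group_bound"
    unfolding group_bound_def[symmetric] by auto
qed

lemma norm_apply_le: "S \<in> G \<Longrightarrow> norm (blinfun_apply S x) \<le> group_bound * norm x"
  by (rule order_trans[OF norm_blinfun]) (simp add: group_bound mult_right_mono)

lemma norm_le_apply:
  assumes "S \<in> G"
  shows "norm x \<le> group_bound * norm (blinfun_apply S x)"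
proof -
  obtain R where R: "R \<in> G" "R o\<^sub>L S = id_blinfun" using inverse_mem[OF assms] by blast
  have "x = blinfun_apply R (blinfun_apply S x)"
    using R(2) by (metis blinfun_apply_blinfun_compose blinfun_apply_id_blinfun)
  then show ?thesis using norm_apply_le[OF R(1)] by metis
qed

definition invariant_norm :: "'a \<Rightarrow> real" where "invariant_norm x = (SUP S\<in>G. norm (blinfun_apply S x))"

lemma bdd_above_orbit: "bdd_above ((\<lambda>S. norm (blinfun_apply S x)) ` G)"
  using norm_apply_le by (auto intro!: bdd_aboveI2)

lemma norm_apply_le_invariant_norm: "S \<in> G \<Longrightarrow> norm (blinfun_apply S x) \<le> invariant_norm x"
  unfolding invariant_norm_def by (rule cSUP_upper[OF _ bdd_above_orbit])

lemma invariant_norm_leI: "(\<And>S. S \<in> G \<Longrightarrow> norm (blinfun_apply S x) \<le> r) \<Longrightarrow> invariant_norm x \<le> r"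
  unfolding invariant_norm_def using id_mem by (intro cSUP_least) auto

lemma norm_le_invariant_norm: "norm x \<le> invariant_norm x"
  using norm_apply_le_invariant_norm[OF id_mem] by simp

lemma invariant_norm_nonneg: "0 \<le> invariant_norm x"
  by (rule order_trans[OF norm_ge_zero norm_le_invariant_norm])

lemma invariant_norm_le: "invariant_norm x \<le> group_bound * norm x"
  by (rule invariant_norm_leI) (rule norm_apply_le)

lemma invariant_norm_triangle: "invariant_norm (x + y) \<le> invariant_norm x + invariant_norm y"
proof (rule invariant_norm_leI)
  fix S assume "S \<in> G"
  then show "norm (blinfun_apply S (x + y)) \<le> invariant_norm x + invariant_norm y"
    using norm_triangle_ineq[of "blinfun_apply S x" "blinfun_apply S y"]
      norm_apply_le_invariant_norm[of S x] norm_apply_le_invariant_norm[of S y]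
    by (simp add: blinfun.add_right)
qed

lemma invariant_norm_diff_le: "invariant_norm x - invariant_norm y \<le> group_bound * norm (x - y)"
  using invariant_norm_triangle[of "x - y" y] invariant_norm_le[of "x - y"] by simp

lemma continuous_on_invariant_norm: "continuous_on A invariant_norm"
proof (rule continuous_on_subset[OF _ subset_UNIV])
  have "\<bar>invariant_norm x - invariant_norm y\<bar> \<le> group_bound * norm (x - y)" for x y
    using invariant_norm_diff_le[of x y] invariant_norm_diff_le[of y x] by (simp add: norm_minus_commute)
  then have "group_bound-lipschitz_on UNIV invariant_norm"
    using group_bound(1) by (intro lipschitz_onI) (auto simp: dist_norm)
  then show "continuous_on UNIV invariant_norm" by (rule lipschitz_on_continuous_on)
qed

lemma invariant_norm_apply:
  assumes "S \<in> G"
  shows "invariant_norm (blinfun_apply S x) = invariant_norm x"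
proof (rule antisym)
  have le: "invariant_norm (blinfun_apply S x) \<le> invariant_norm x" if "S \<in> G" for S x
  proof (rule invariant_norm_leI)
    fix T assume "T \<in> G"
    then show "norm (blinfun_apply T (blinfun_apply S x)) \<le> invariant_norm x"
      using norm_apply_le_invariant_norm[OF compose_mem[OF _ that], of T x] by simp
  qed
  show "invariant_norm (blinfun_apply S x) \<le> invariant_norm x" by (rule le[OF assms])
  obtain R where R: "R \<in> G" "R o\<^sub>L S = id_blinfun" using inverse_mem[OF assms] by blast
  have "x = blinfun_apply R (blinfun_apply S x)"
    using R(2) by (metis blinfun_apply_blinfun_compose blinfun_apply_id_blinfun)
  then show "invariant_norm x \<le> invariant_norm (blinfun_apply S x)" using le[OF R(1)] by metis
qed

definition convexity_modulus :: real where "convexity_modulus = 1 / (4 * group_bound\<^sup>2)"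

lemma convexity_modulus_pos: "0 < convexity_modulus"
  using group_bound(1) by (simp add: convexity_modulus_def)

text \<open>
  The parallelogram law makes every function \<open>x \<mapsto> \<parallel>S x\<parallel>\<^sup>2\<close>, for \<open>S\<close> in the group, strongly
  convex. Boundedness of the inverses makes the modulus the same for all of them, and a supremum of
  functions that are strongly convex with a common modulus is again strongly convex.
\<close>

lemma invariant_norm_strongly_convex:
  "(invariant_norm (midpoint x y))\<^sup>2 \<le> ((invariant_norm x)\<^sup>2 + (invariant_norm y)\<^sup>2) / 2 - convexity_modulus * (norm (x - y))\<^sup>2"
    (is "_ \<le> ?r")
proof -
  have *: "(norm (blinfun_apply S (midpoint x y)))\<^sup>2 \<le> ?r" if S: "S \<in> G" for S
  proof -
    let ?a = "blinfun_apply S x" and ?b = "blinfun_apply S y"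
    have "blinfun_apply S (midpoint x y) = midpoint ?a ?b"
      by (simp add: midpoint_def blinfun.add_right blinfun.scaleR_right)
    moreover have "(norm (midpoint ?a ?b))\<^sup>2 = ((norm ?a)\<^sup>2 + (norm ?b)\<^sup>2) / 2 - 1/4 * (norm (?a - ?b))\<^sup>2"
      unfolding midpoint_def power2_norm_eq_inner by (simp add: inner_simps inner_commute field_simps)
    moreover have "(norm ?a)\<^sup>2 \<le> (invariant_norm x)\<^sup>2" "(norm ?b)\<^sup>2 \<le> (invariant_norm y)\<^sup>2"
      using norm_apply_le_invariant_norm[OF S] by (simp_all add: power_mono)
    moreover have "convexity_modulus * (norm (x - y))\<^sup>2 \<le> 1/4 * (norm (?a - ?b))\<^sup>2"
    proof -
      have "(norm (x - y))\<^sup>2 \<le> (group_bound * norm (?a - ?b))\<^sup>2"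
        using norm_le_apply[OF S, of "x - y"] by (intro power_mono) (simp_all add: blinfun.diff_right)
      then show ?thesis using group_bound(1) by (simp add: convexity_modulus_def power_mult_distrib field_simps)
    qed
    ultimately show ?thesis by (simp only:) argo
  qed
  have "invariant_norm (midpoint x y) \<le> sqrt ?r"
    using * by (intro invariant_norm_leI real_le_rsqrt)
  then have "(invariant_norm (midpoint x y))\<^sup>2 \<le> (sqrt ?r)\<^sup>2"
    by (intro power_mono invariant_norm_nonneg)
  moreover have "0 \<le> ?r" using *[OF id_mem] by (meson order_trans zero_le_power2)
  ultimately show ?thesis by simp
qed

lemma invariant_norm_minimum:
  assumes "closed A" "convex A" "A \<noteq> {}"
  obtains m where "m \<in> A" "\<And>a. a \<in> A \<Longrightarrow> 2 * convexity_modulus * (norm (a - m))\<^sup>2 \<le> (invariant_norm a)\<^sup>2 - (invariant_norm m)\<^sup>2"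
proof (rule strongly_convex_minimum[OF assms _ convexity_modulus_pos invariant_norm_strongly_convex])
  show "continuous_on UNIV (\<lambda>x. (invariant_norm x)\<^sup>2)"
    by (intro continuous_intros continuous_on_invariant_norm)
qed (auto intro: zero_le_power2)

lemma adj_group: "bounded_operator_group (adj ` G)"
proof
  show "id_blinfun \<in> adj ` G" using id_mem adj_id by (metis imageI)
  show "S o\<^sub>L T \<in> adj ` G" if "S \<in> adj ` G" "T \<in> adj ` G" for S T
    using that compose_mem by (auto simp: adj_compose[symmetric])
  show "\<exists>R\<in>adj ` G. R o\<^sub>L S = id_blinfun \<and> S o\<^sub>L R = id_blinfun" if S: "S \<in> adj ` G" for S
  proof -
    obtain T where T: "T \<in> G" "S = adj T" using S by blast
    obtain R where "R \<in> G" "R o\<^sub>L T = id_blinfun" "T o\<^sub>L R = id_blinfun"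
      using inverse_mem[OF T(1)] by blast
    with T show ?thesis by (intro bexI[of _ "adj R"]) (simp_all add: adj_compose[symmetric] adj_id)
  qed
  show "bounded (adj ` G)"
    using group_bound norm_adj_le by (auto simp: bounded_iff intro: order_trans)
qed

end

section \<open>Averaging near the identity\<close>

definition orbit_hull :: "('a::real_normed_vector \<Rightarrow>\<^sub>L 'a) set \<Rightarrow> 'a \<Rightarrow> 'a set"
  where "orbit_hull V z = closure (convex hull ((\<lambda>S. blinfun_apply S z) ` V))"

lemma orbit_hull_closed_convex: "closed (orbit_hull V z)" "convex (orbit_hull V z)"
  by (simp_all add: orbit_hull_def convex_closure)

lemma orbit_hull_mem: "S \<in> V \<Longrightarrow> blinfun_apply S z \<in> orbit_hull V z"
  unfolding orbit_hull_def by (meson closure_subset hull_inc imageI subsetD)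

lemma orbit_hull_least:
  assumes "closed A" "convex A" "\<And>S. S \<in> V \<Longrightarrow> blinfun_apply S z \<in> A"
  shows "orbit_hull V z \<subseteq> A"
  unfolding orbit_hull_def using assms by (intro closure_minimal hull_minimal) auto

lemma orbit_hull_mono: "V \<subseteq> W \<Longrightarrow> orbit_hull V z \<subseteq> orbit_hull W z"
  by (intro orbit_hull_least orbit_hull_closed_convex orbit_hull_mem) auto

lemma bounded_linear_orbit_hull:
  assumes f: "bounded_linear f" and m: "m \<in> orbit_hull V z"
    and *: "\<And>S. S \<in> V \<Longrightarrow> f (blinfun_apply S z) \<in> orbit_hull W y"
  shows "f m \<in> orbit_hull W y"
proof -
  interpret f: bounded_linear f by fact
  have "orbit_hull V z \<subseteq> f -` orbit_hull W y"
    by (intro orbit_hull_least convex_linear_vimage f.linear_axioms orbit_hull_closed_convex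
        continuous_closed_vimage linear_continuous_at f) (auto simp: *)
  then show ?thesis using m by auto
qed

text \<open>
  The filter stands for the neighbourhoods of the identity in some group topology that may be coarser
  than the strong operator topology; the last assumption says that multiplication is continuous at
  the identity. The filter of all sets containing the group is allowed as well, and then convergence
  to \<open>z\<close> means being fixed by the whole group.
\<close>

locale operator_group_filter = bounded_operator_group +
  fixes F :: "('a \<Rightarrow>\<^sub>L 'a) filter"
  assumes eventually_mem: "eventually (\<lambda>S. S \<in> G) F"
    and nontrivial: "F \<noteq> bot"
    and eventually_compose: "eventually Q F \<Longrightarrow>
      \<exists>Q'. eventually Q' F \<and> (\<forall>S T. Q' S \<longrightarrow> Q' T \<longrightarrow> Q (S o\<^sub>L T))"
begin

definition asymptotically_fixed :: "'a \<Rightarrow> bool"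
  where "asymptotically_fixed z \<longleftrightarrow> ((\<lambda>S. blinfun_apply S z) \<longlongrightarrow> z) F"

text \<open>
  The limit points of averages of \<open>S z\<close> as \<open>S\<close> tends to the identity.
\<close>

definition asymptotic_hull :: "'a \<Rightarrow> 'a set"
  where "asymptotic_hull z = (\<Inter>V\<in>{V. eventually (\<lambda>S. S \<in> V) F}. orbit_hull V z)"

lemma adj_filter: "operator_group_filter (adj ` G) (filtermap adj F)"
proof (intro operator_group_filter.intro adj_group operator_group_filter_axioms.intro)
  show "\<forall>\<^sub>F S in filtermap adj F. S \<in> adj ` G"
    using eventually_mem by (auto simp: eventually_filtermap elim: eventually_mono)
  show "filtermap adj F \<noteq> bot" using nontrivial by (simp add: filtermap_bot_iff)
  fix Q assume "eventually Q (filtermap adj F)"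
  then obtain Q' where Q': "eventually Q' F" "\<And>S T. Q' S \<Longrightarrow> Q' T \<Longrightarrow> Q (adj (S o\<^sub>L T))"
    unfolding eventually_filtermap using eventually_compose by blast
  show "\<exists>Q'. eventually Q' (filtermap adj F) \<and> (\<forall>S T. Q' S \<longrightarrow> Q' T \<longrightarrow> Q (S o\<^sub>L T))"
  proof (intro exI conjI allI impI)
    show "eventually (\<lambda>S. Q' (adj S)) (filtermap adj F)"
      using Q'(1) by (simp add: eventually_filtermap adj_adj)
    show "Q (S o\<^sub>L T)" if "Q' (adj S)" "Q' (adj T)" for S T
      using Q'(2)[OF that(2,1)] by (simp add: adj_compose adj_adj)
  qed
qed

text \<open>
  For each member \<open>V\<close> of the filter let \<open>M V\<close> be the vector of least invariant norm in the closed
  convex hull of \<open>V z\<close>. As \<open>V\<close> shrinks, these minimal norms increase to a finite limit, so strong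
  convexity makes \<open>M V\<close> converge to a vector \<open>m\<close> in all the hulls. If \<open>W\<close> is so small that \<open>W W\<close> lies in
  \<open>V\<close>, then \<open>S (M W)\<close> for \<open>S\<close> in \<open>W\<close> lies in the hull of \<open>V z\<close> and has the same norm as \<open>M W\<close>, which is
  nearly minimal there. Hence \<open>S\<close> moves \<open>m\<close> only a little.
\<close>

lemma asymptotically_fixed_point_exists:
  "\<exists>m\<in>asymptotic_hull z. asymptotically_fixed m"
proof -
  define \<V> where "\<V> = {V. eventually (\<lambda>S. S \<in> V) F \<and> V \<subseteq> G}"
  have Int: "V \<inter> W \<in> \<V>" if "V \<in> \<V>" "W \<in> \<V>" for V W
    using that by (auto simp: \<V>_def eventually_conj_iff)
  have G: "G \<in> \<V>" using eventually_mem by (simp add: \<V>_def)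
  have ne: "V \<noteq> {}" if "V \<in> \<V>" for V
    using that nontrivial by (auto simp: \<V>_def)
  have "\<exists>m\<in>orbit_hull V z. \<forall>a\<in>orbit_hull V z.
      2 * convexity_modulus * (norm (a - m))\<^sup>2 \<le> (invariant_norm a)\<^sup>2 - (invariant_norm m)\<^sup>2" if "V \<in> \<V>" for V
  proof -
    have "orbit_hull V z \<noteq> {}" using ne[OF that] orbit_hull_mem by blast
    from invariant_norm_minimum[OF orbit_hull_closed_convex this] show ?thesis by metis
  qed
  then obtain M where M: "\<And>V. V \<in> \<V> \<Longrightarrow> M V \<in> orbit_hull V z"
    and M_min: "\<And>V a. V \<in> \<V> \<Longrightarrow> a \<in> orbit_hull V z \<Longrightarrow>
      2 * convexity_modulus * (norm (a - M V))\<^sup>2 \<le> (invariant_norm a)\<^sup>2 - (invariant_norm (M V))\<^sup>2"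
    by metis
  define r where "r V = (invariant_norm (M V))\<^sup>2" for V
  have r_le: "r V \<le> (invariant_norm z)\<^sup>2" if V: "V \<in> \<V>" for V
  proof -
    obtain S where S: "S \<in> V" "S \<in> G" using ne[OF V] V by (auto simp: \<V>_def)
    have "0 \<le> 2 * convexity_modulus * (norm (blinfun_apply S z - M V))\<^sup>2"
      using convexity_modulus_pos by simp
    with M_min[OF V orbit_hull_mem[OF S(1)]] show ?thesis
      by (simp add: r_def invariant_norm_apply[OF S(2)])
  qed
  define R where "R = (SUP V\<in>\<V>. r V)"
  have bdd: "bdd_above (r ` \<V>)" using r_le by (auto intro!: bdd_aboveI2)
  have r_le_R: "r V \<le> R" if "V \<in> \<V>" for V
    unfolding R_def using that bdd by (rule cSUP_upper)
  \<comment> \<open>Points of the hull of \<open>V z\<close> with squared norm at most \<open>R\<close> are within \<open>\<delta> V\<close> of \<open>M V\<close>.\<close>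
  define \<delta> where "\<delta> V = sqrt ((R - r V) / (2 * convexity_modulus))" for V
  have near: "norm (a - M V) \<le> \<delta> V" if V: "V \<in> \<V>" and a: "a \<in> orbit_hull V z" "(invariant_norm a)\<^sup>2 \<le> R" for a V
  proof -
    have "2 * convexity_modulus * (norm (a - M V))\<^sup>2 \<le> R - r V"
      using M_min[OF V a(1)] a(2) by (simp add: r_def)
    then show ?thesis
      unfolding \<delta>_def using convexity_modulus_pos by (intro real_le_rsqrt) (simp add: field_simps)
  qed
  have near_sub: "norm (M V - M W) \<le> \<delta> W" if "V \<in> \<V>" "W \<in> \<V>" "V \<subseteq> W" for V W
    using that M orbit_hull_mono[OF that(3)] r_le_R[OF that(1)] by (intro near) (auto simp: r_def)
  have r_mono: "r W \<le> r V" if "V \<in> \<V>" "W \<in> \<V>" "V \<subseteq> W" for V W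
  proof -
    have "M V \<in> orbit_hull W z" using M[OF that(1)] orbit_hull_mono[OF that(3)] by blast
    from M_min[OF that(2) this] have "2 * convexity_modulus * (norm (M V - M W))\<^sup>2 \<le> r V - r W"
      by (simp add: r_def)
    moreover have "0 \<le> 2 * convexity_modulus * (norm (M V - M W))\<^sup>2" using convexity_modulus_pos by simp
    ultimately show ?thesis by linarith
  qed
  have \<delta>_mono: "\<delta> V \<le> \<delta> W" if "V \<in> \<V>" "W \<in> \<V>" "V \<subseteq> W" for V W
    unfolding \<delta>_def using r_mono[OF that] convexity_modulus_pos by (simp add: divide_right_mono)
  have near2: "norm (M V - M W) \<le> \<delta> V + \<delta> W" if "V \<in> \<V>" "W \<in> \<V>" for V W
    using near_sub[OF Int[OF that] that(1)] near_sub[OF Int[OF that] that(2)]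
      norm_triangle_ineq4[of "M (V \<inter> W) - M W" "M (V \<inter> W) - M V"] by simp
  have "\<exists>V\<in>\<V>. R - inverse (real (Suc n)) < r V" for n
    using less_cSUP_iff[OF _ bdd, of "R - inverse (real (Suc n))"] G by (auto simp: R_def[symmetric])
  then obtain V where V: "\<And>n. V n \<in> \<V>" and rV: "\<And>n. R - inverse (real (Suc n)) < r (V n)"
    by metis
  have lim0: "(\<lambda>n. \<delta> (V n)) \<longlonglongrightarrow> 0"
  proof -
    have "(\<lambda>n. R - r (V n)) \<longlonglongrightarrow> 0"
    proof (rule tendsto_sandwich[OF _ _ tendsto_const LIMSEQ_inverse_real_of_nat])
      show "\<forall>\<^sub>F n in sequentially. 0 \<le> R - r (V n)" using r_le_R V by auto
      show "\<forall>\<^sub>F n in sequentially. R - r (V n) \<le> inverse (real (Suc n))"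
        using rV by (auto intro!: always_eventually simp: less_imp_le algebra_simps)
    qed
    then have "(\<lambda>n. sqrt ((R - r (V n)) / (2 * convexity_modulus))) \<longlonglongrightarrow> sqrt (0 / (2 * convexity_modulus))"
      by (intro tendsto_intros) (use convexity_modulus_pos in auto)
    then show ?thesis by (simp add: \<delta>_def)
  qed
  have "Cauchy (\<lambda>n. M (V n))"
  proof (rule CauchyI)
    fix \<epsilon> :: real assume "0 < \<epsilon>"
    then have "\<forall>\<^sub>F n in sequentially. \<delta> (V n) < \<epsilon> / 2"
      by (intro order_tendstoD(2)[OF lim0]) auto
    then obtain K where K: "\<And>n. n \<ge> K \<Longrightarrow> \<delta> (V n) < \<epsilon> / 2"
      by (auto simp: eventually_sequentially)
    show "\<exists>K. \<forall>n\<ge>K. \<forall>k\<ge>K. norm (M (V n) - M (V k)) < \<epsilon>"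
      using K near2[OF V V] by (intro exI[of _ K] allI impI) (smt (verit) field_sum_of_halves)
  qed
  then obtain m where m: "(\<lambda>n. M (V n)) \<longlonglongrightarrow> m"
    by (auto simp: Cauchy_convergent_iff convergent_def)
  have near_m: "norm (m - M W) \<le> \<delta> W" if "W \<in> \<V>" for W
  proof (rule LIMSEQ_le)
    show "(\<lambda>n. norm (M (V n) - M W)) \<longlonglongrightarrow> norm (m - M W)"
      by (intro tendsto_intros m)
    show "(\<lambda>n. \<delta> (V n) + \<delta> W) \<longlonglongrightarrow> \<delta> W"
      using tendsto_add[OF lim0 tendsto_const] by simp
    show "\<exists>N. \<forall>n\<ge>N. norm (M (V n) - M W) \<le> \<delta> (V n) + \<delta> W"
      using near2[OF V that] by blast
  qed
  have hull: "m \<in> orbit_hull W z" if W: "W \<in> \<V>" for W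
  proof (rule closed_sequentially[OF orbit_hull_closed_convex(1)])
    show "M (W \<inter> V n) \<in> orbit_hull W z" for n
      using M[OF Int[OF W V]] orbit_hull_mono[of "W \<inter> V n" W] by blast
    show "(\<lambda>n. M (W \<inter> V n)) \<longlonglongrightarrow> m"
    proof (rule Lim_transform2[OF tendsto_const], rule Lim_null_comparison[OF _ lim0])
      show "\<forall>\<^sub>F n in sequentially. norm (m - M (W \<inter> V n)) \<le> \<delta> (V n)"
        using near_m[OF Int[OF W V]] \<delta>_mono[OF Int[OF W V] V]
        by (intro always_eventually allI order_trans[OF near_m[OF Int[OF W V]]]) auto
    qed
  qed
  show ?thesis
  proof (intro bexI[of _ m])
    show "m \<in> asymptotic_hull z"
      unfolding asymptotic_hull_def
    proof (intro INT_I)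
      fix W assume "W \<in> {V. \<forall>\<^sub>F S in F. S \<in> V}"
      then have "W \<inter> G \<in> \<V>" using eventually_mem by (auto simp: \<V>_def eventually_conj_iff)
      from hull[OF this] show "m \<in> orbit_hull W z" using orbit_hull_mono[of "W \<inter> G" W] by blast
    qed
    show "asymptotically_fixed m"
      unfolding asymptotically_fixed_def tendsto_iff
    proof (intro allI impI)
      fix \<epsilon> :: real assume \<epsilon>: "0 < \<epsilon>"
      then have "0 < \<epsilon> / (group_bound + 2)" using group_bound(1) by simp
      then have "\<forall>\<^sub>F n in sequentially. \<delta> (V n) < \<epsilon> / (group_bound + 2)"
        by (rule order_tendstoD(2)[OF lim0])
      then obtain n where n: "\<delta> (V n) < \<epsilon> / (group_bound + 2)"
        by (auto simp: eventually_sequentially)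
      let ?V = "V n"
      have "eventually (\<lambda>S. S \<in> ?V) F" using V[of n] by (simp add: \<V>_def)
      from eventually_compose[OF this] obtain Q where Q: "eventually Q F"
        "\<And>S T. Q S \<Longrightarrow> Q T \<Longrightarrow> S o\<^sub>L T \<in> ?V" by blast
      \<comment> \<open>Products of two members of \<open>W\<close> lie in \<open>V n\<close>.\<close>
      define W where "W = {S \<in> ?V. Q S}"
      have W: "W \<in> \<V>" "W \<subseteq> ?V" using V[of n] Q(1) by (auto simp: \<V>_def W_def eventually_conj_iff)
      have "dist (blinfun_apply S m) m < \<epsilon>" if S: "S \<in> W" for S
      proof -
        have SG: "S \<in> G" using S W(1) by (auto simp: \<V>_def)
        have "blinfun_apply S (M W) \<in> orbit_hull ?V z"
        proof (rule bounded_linear_orbit_hull[OF blinfun.bounded_linear_right M[OF W(1)]])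
          fix T assume "T \<in> W"
          then have "S o\<^sub>L T \<in> ?V" using S Q(2) by (simp add: W_def)
          from orbit_hull_mem[OF this, of z]
          show "blinfun_apply S (blinfun_apply T z) \<in> orbit_hull ?V z" by simp
        qed
        moreover have "(invariant_norm (blinfun_apply S (M W)))\<^sup>2 \<le> R"
          using r_le_R[OF W(1)] by (simp add: invariant_norm_apply[OF SG] r_def)
        ultimately have 1: "norm (blinfun_apply S (M W) - M ?V) \<le> \<delta> ?V"
          by (rule near[OF V])
        have "norm (m - M W) \<le> \<delta> ?V"
          using near_m[OF W(1)] \<delta>_mono[OF W(1) V W(2)] by linarith
        then have 2: "norm (blinfun_apply S (m - M W)) \<le> group_bound * \<delta> ?V"
          using norm_apply_le[OF SG, of "m - M W"] group_bound(1)
          by (meson mult_left_mono order_trans zero_le_one)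
        have "norm (blinfun_apply S m - m) =
            norm (blinfun_apply S (m - M W) + (blinfun_apply S (M W) - M ?V) + (M ?V - m))"
          by (simp add: blinfun.diff_right)
        also have "\<dots> \<le> norm (blinfun_apply S (m - M W)) + norm (blinfun_apply S (M W) - M ?V) + norm (M ?V - m)"
          by (meson add_right_mono norm_triangle_ineq order_trans)
        also have "\<dots> \<le> group_bound * \<delta> ?V + \<delta> ?V + \<delta> ?V"
          using 1 2 near_m[OF V, of n] by (simp add: norm_minus_commute)
        also have "\<dots> = (group_bound + 2) * \<delta> ?V" by (simp add: algebra_simps)
        also have "\<dots> < \<epsilon>" using n group_bound(1) by (simp add: field_simps)
        finally show ?thesis by (simp add: dist_norm)
      qed
      moreover have "eventually (\<lambda>S. S \<in> W) F" using W(1) by (simp add: \<V>_def)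
      ultimately show "\<forall>\<^sub>F S in F. dist (blinfun_apply S m) m < \<epsilon>"
        by (rule eventually_mono[rotated])
    qed
  qed
qed

text \<open>
  A vector \<open>f\<close> that the adjoints move little cannot distinguish \<open>S z\<close> from \<open>z\<close> when \<open>S\<close> is near the
  identity, hence cannot distinguish \<open>z\<close> from averages of such \<open>S z\<close>.
\<close>

lemma inner_asymptotic_hull:
  assumes f: "((\<lambda>S. blinfun_apply (adj S) f) \<longlongrightarrow> f) F" and m: "m \<in> asymptotic_hull z"
  shows "f \<bullet> m = f \<bullet> z"
proof -
  have "\<bar>f \<bullet> m - f \<bullet> z\<bar> \<le> \<epsilon> * norm z" if \<epsilon>: "0 < \<epsilon>" for \<epsilon>
  proof -
    let ?V = "{S. norm (blinfun_apply (adj S) f - f) < \<epsilon>}"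
    let ?A = "{w. f \<bullet> w \<le> f \<bullet> z + \<epsilon> * norm z} \<inter> {w. f \<bullet> w \<ge> f \<bullet> z - \<epsilon> * norm z}"
    have "orbit_hull ?V z \<subseteq> ?A"
    proof (intro orbit_hull_least convex_Int closed_Int)
      fix S assume "S \<in> ?V"
      have "\<bar>f \<bullet> blinfun_apply S z - f \<bullet> z\<bar> = \<bar>(blinfun_apply (adj S) f - f) \<bullet> z\<bar>"
        by (simp add: inner_adj inner_diff_left)
      also have "\<dots> \<le> norm (blinfun_apply (adj S) f - f) * norm z"
        by (rule Cauchy_Schwarz_ineq2)
      also have "\<dots> \<le> \<epsilon> * norm z"
        using \<open>S \<in> ?V\<close> by (intro mult_right_mono) auto
      finally show "blinfun_apply S z \<in> ?A" by auto
    qed (auto intro: closed_halfspace_le closed_halfspace_ge convex_halfspace_le convex_halfspace_ge)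
    moreover have "eventually (\<lambda>S. S \<in> ?V) F"
      using f \<epsilon> by (auto simp: tendsto_iff dist_norm)
    moreover from this m have "m \<in> orbit_hull ?V z" by (simp add: asymptotic_hull_def)
    ultimately have "m \<in> ?A" by blast
    then show ?thesis by (auto simp: abs_le_iff)
  qed
  note le = this
  have "\<bar>f \<bullet> m - f \<bullet> z\<bar> \<le> 0 + \<epsilon>" if \<epsilon>: "0 < \<epsilon>" for \<epsilon>
  proof -
    have "0 < norm z + 1" by (simp add: add_nonneg_pos)
    then have "\<epsilon> / (norm z + 1) * norm z \<le> \<epsilon>" "0 < \<epsilon> / (norm z + 1)"
      using \<epsilon> by (simp_all add: field_simps)
    then show ?thesis using le[of "\<epsilon> / (norm z + 1)"] by linarith
  qed
  then have "\<bar>f \<bullet> m - f \<bullet> z\<bar> \<le> 0" by (rule field_le_epsilon)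
  then show ?thesis by simp
qed

end

text \<open>
  Invariance of the filter under conjugation makes the space of asymptotically fixed vectors
  invariant under the group.
\<close>

locale normal_operator_filter = operator_group_filter +
  assumes filterlim_conjugate: "\<lbrakk>T \<in> G; R \<in> G; R o\<^sub>L T = id_blinfun; T o\<^sub>L R = id_blinfun\<rbrakk> \<Longrightarrow>
    filterlim (\<lambda>S. R o\<^sub>L S o\<^sub>L T) F F"
begin

text \<open>
  Averaging \<open>y\<close> itself over the adjoint group yields an \<open>f\<close> that is asymptotically fixed by the
  adjoints and still satisfies \<open>f \<bullet> y = y \<bullet> y\<close>, because \<open>y\<close> is asymptotically fixed by the
  original operators.
\<close>

lemma asymptotically_fixed_separated:
  assumes "asymptotically_fixed y" "\<And>f. ((\<lambda>S. blinfun_apply (adj S) f) \<longlongrightarrow> f) F \<Longrightarrow> f \<bullet> y = 0"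
  shows "y = 0"
proof -
  interpret D: operator_group_filter "adj ` G" "filtermap adj F" by (rule adj_filter)
  obtain f where f: "f \<in> D.asymptotic_hull y" "D.asymptotically_fixed f"
    using D.asymptotically_fixed_point_exists by blast
  have "((\<lambda>S. blinfun_apply (adj S) y) \<longlongrightarrow> y) (filtermap adj F)"
    using assms(1) by (simp add: asymptotically_fixed_def filterlim_filtermap adj_adj)
  from D.inner_asymptotic_hull[OF this f(1)] have "y \<bullet> f = y \<bullet> y" .
  moreover have "f \<bullet> y = 0"
    using f(2) by (intro assms(2)) (simp add: D.asymptotically_fixed_def filterlim_filtermap)
  ultimately show ?thesis by (simp add: inner_commute)
qed

lemma asymptotically_fixed_apply:
  assumes T: "T \<in> G" and m: "asymptotically_fixed m"
  shows "asymptotically_fixed (blinfun_apply T m)"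
proof -
  obtain R where R: "R \<in> G" "R o\<^sub>L T = id_blinfun" "T o\<^sub>L R = id_blinfun"
    using inverse_mem[OF T] by blast
  have TR: "blinfun_apply T (blinfun_apply R x) = x" for x
    using R(3) by (metis blinfun_apply_blinfun_compose blinfun_apply_id_blinfun)
  have "((\<lambda>S. blinfun_apply (R o\<^sub>L S o\<^sub>L T) m) \<longlongrightarrow> m) F"
    using filterlim_compose[OF m[unfolded asymptotically_fixed_def] filterlim_conjugate[OF T R]] .
  then have "((\<lambda>S. blinfun_apply T (blinfun_apply (R o\<^sub>L S o\<^sub>L T) m)) \<longlongrightarrow> blinfun_apply T m) F"
    by (intro tendsto_intros)
  then show ?thesis by (simp add: asymptotically_fixed_def TR)
qed

lemma asymptotically_fixed_diff:
  "asymptotically_fixed x \<Longrightarrow> asymptotically_fixed y \<Longrightarrow> asymptotically_fixed (x - y)"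
  unfolding asymptotically_fixed_def blinfun.diff_right by (intro tendsto_intros)

lemma asymptotically_fixed_add:
  "asymptotically_fixed x \<Longrightarrow> asymptotically_fixed y \<Longrightarrow> asymptotically_fixed (x + y)"
  unfolding asymptotically_fixed_def blinfun.add_right by (intro tendsto_intros)

lemma asymptotically_fixed_scaleR: "asymptotically_fixed x \<Longrightarrow> asymptotically_fixed (c *\<^sub>R x)"
  unfolding asymptotically_fixed_def blinfun.scaleR_right by (intro tendsto_intros)

lemma closed_asymptotically_fixed: "closed {z. asymptotically_fixed z}"
proof (rule closed_sequential_limits[THEN iffD2], intro allI impI, elim conjE)
  fix x l assume x: "\<forall>n. x n \<in> {z. asymptotically_fixed z}" "x \<longlonglongrightarrow> l"
  have "\<forall>\<^sub>F S in F. dist (blinfun_apply S l) l < \<epsilon>" if \<epsilon>: "0 < \<epsilon>" for \<epsilon>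
  proof -
    have "0 < \<epsilon> / (group_bound + 2)" using \<epsilon> group_bound(1) by simp
    then obtain n where n: "norm (x n - l) < \<epsilon> / (group_bound + 2)"
      using x(2) by (auto simp: LIMSEQ_iff)
    have "\<forall>\<^sub>F S in F. norm (blinfun_apply S (x n) - x n) < \<epsilon> / (group_bound + 2)"
      using x(1) \<open>0 < \<epsilon> / (group_bound + 2)\<close> by (auto simp: asymptotically_fixed_def tendsto_iff dist_norm)
    with eventually_mem show ?thesis
    proof eventually_elim
      fix S assume S: "S \<in> G" "norm (blinfun_apply S (x n) - x n) < \<epsilon> / (group_bound + 2)"
      have "norm (blinfun_apply S l - l) =
          norm (blinfun_apply S (l - x n) + (blinfun_apply S (x n) - x n) + (x n - l))"
        by (simp add: blinfun.diff_right)
      also have "\<dots> \<le> norm (blinfun_apply S (l - x n)) + norm (blinfun_apply S (x n) - x n) + norm (x n - l)"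
        by (meson add_right_mono norm_triangle_ineq order_trans)
      also have "\<dots> < group_bound * (\<epsilon> / (group_bound + 2)) + \<epsilon> / (group_bound + 2) + \<epsilon> / (group_bound + 2)"
      proof (rule add_strict_mono[OF add_le_less_mono[OF _ S(2)] n])
        have "norm (blinfun_apply S (l - x n)) \<le> group_bound * norm (l - x n)" by (rule norm_apply_le[OF S(1)])
        also have "\<dots> \<le> group_bound * (\<epsilon> / (group_bound + 2))"
          using n group_bound(1) by (intro mult_left_mono) (auto simp: norm_minus_commute)
        finally show "norm (blinfun_apply S (l - x n)) \<le> group_bound * (\<epsilon> / (group_bound + 2))" .
      qed
      also have "\<dots> = (group_bound + 2) * (\<epsilon> / (group_bound + 2))" by (simp only: distrib_right mult_2 add.assoc)
      also have "\<dots> = \<epsilon>" using group_bound(1) by simp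
      finally show "dist (blinfun_apply S l) l < \<epsilon>" by (simp add: dist_norm)
    qed
  qed
  then show "l \<in> {z. asymptotically_fixed z}"
    by (simp add: asymptotically_fixed_def tendsto_iff)
qed

lemma asymptotic_hull_apply:
  assumes T: "T \<in> G" and m: "m \<in> asymptotic_hull z"
  shows "blinfun_apply T m \<in> asymptotic_hull (blinfun_apply T z)"
  unfolding asymptotic_hull_def
proof (intro INT_I)
  fix V assume V: "V \<in> {V. \<forall>\<^sub>F S in F. S \<in> V}"
  obtain R where R: "R \<in> G" "R o\<^sub>L T = id_blinfun" "T o\<^sub>L R = id_blinfun"
    using inverse_mem[OF T] by blast
  have RT: "blinfun_apply R (blinfun_apply T x) = x" for x
    using R(2) by (metis blinfun_apply_blinfun_compose blinfun_apply_id_blinfun)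
  let ?W = "{S. T o\<^sub>L S o\<^sub>L R \<in> V}"
  have "eventually (\<lambda>S. S \<in> ?W) F"
    using filterlim_conjugate[OF R(1) T R(3,2), unfolded filterlim_iff, rule_format, of "\<lambda>S. S \<in> V"] V
    by simp
  then have "m \<in> orbit_hull ?W z" using m by (simp add: asymptotic_hull_def)
  then show "blinfun_apply T m \<in> orbit_hull V (blinfun_apply T z)"
  proof (rule bounded_linear_orbit_hull[OF blinfun.bounded_linear_right])
    fix S assume "S \<in> ?W"
    then have "T o\<^sub>L S o\<^sub>L R \<in> V" by simp
    from orbit_hull_mem[OF this, of "blinfun_apply T z"]
    show "blinfun_apply T (blinfun_apply S z) \<in> orbit_hull V (blinfun_apply T z)"
      by (simp add: RT)
  qed
qed

text \<open>
  This is a topological version of the Alaoglu--Birkhoff theorem: the asymptotically fixed vectors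
  are the range of a projection that commutes with the group. Averaging gives \<open>P z\<close> up to a choice, and
  the choice is unique because two candidates have the same inner products with every vector
  that is asymptotically fixed by the adjoints, and those separate asymptotically fixed vectors.
  Uniqueness is also what makes \<open>P\<close> linear and equivariant.
\<close>

lemma equivariant_projection:
  obtains P where "bounded_linear P" "\<And>z. asymptotically_fixed (P z)"
    "\<And>z. asymptotically_fixed z \<Longrightarrow> P z = z" "\<And>z. P z \<in> asymptotic_hull z"
    "\<And>T z. T \<in> G \<Longrightarrow> P (blinfun_apply T z) = blinfun_apply T (P z)"
proof -
  \<comment> \<open>Inner products with the cofixed vectors determine an asymptotically fixed vector.\<close>
  define cofixed where "cofixed f \<longleftrightarrow> ((\<lambda>S. blinfun_apply (adj S) f) \<longlongrightarrow> f) F" for f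
  have uniq: "m = m'" if "asymptotically_fixed m" "asymptotically_fixed m'"
    "\<And>f. cofixed f \<Longrightarrow> f \<bullet> m = f \<bullet> m'" for m m'
  proof -
    have "m - m' = 0"
      by (rule asymptotically_fixed_separated) (use that in \<open>auto simp: asymptotically_fixed_diff cofixed_def inner_diff_right\<close>)
    then show ?thesis by simp
  qed
  obtain P where P: "\<And>z. P z \<in> asymptotic_hull z" "\<And>z. asymptotically_fixed (P z)"
    using asymptotically_fixed_point_exists by metis
  have inner_P: "f \<bullet> P z = f \<bullet> z" if "cofixed f" for f z
    using inner_asymptotic_hull[OF _ P(1)] that by (simp add: cofixed_def)
  show thesis
  proof
    show "bounded_linear P"
    proof (rule bounded_linear_intro)
      show "P (x + y) = P x + P y" for x y
        by (rule uniq) (auto simp: P asymptotically_fixed_add inner_P inner_add_right)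
      show "P (c *\<^sub>R x) = c *\<^sub>R P x" for c x
        by (rule uniq) (auto simp: P asymptotically_fixed_scaleR inner_P)
      fix z
      have "P z \<in> orbit_hull G z"
        using P(1)[of z] eventually_mem by (simp add: asymptotic_hull_def)
      also have "\<dots> \<subseteq> cball 0 (group_bound * norm z)"
        by (intro orbit_hull_least) (auto simp: norm_apply_le)
      finally show "norm (P z) \<le> norm z * group_bound" by (simp add: mult.commute)
    qed
    show "P z = z" if "asymptotically_fixed z" for z
      by (rule uniq) (auto simp: P that inner_P)
    show "P (blinfun_apply T z) = blinfun_apply T (P z)" if T: "T \<in> G" for T z
    proof (rule uniq)
      show "asymptotically_fixed (blinfun_apply T (P z))"
        by (rule asymptotically_fixed_apply[OF T P(2)])
      show "f \<bullet> P (blinfun_apply T z) = f \<bullet> blinfun_apply T (P z)" if "cofixed f" for f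
        using inner_asymptotic_hull[OF _ asymptotic_hull_apply[OF T P(1)]] that inner_P[OF that]
        by (simp add: cofixed_def)
    qed (rule P)
  qed (rule P)+
qed

end

section \<open>The Hilbert space of square-summable functions\<close>

lemma ell2_inner_summable:
  assumes "x \<in> ell2_set" "y \<in> ell2_set"
  shows "(\<lambda>s. x s \<bullet> y s) summable_on UNIV"
proof (rule abs_summable_summable, rule summable_on_comparison_test)
  show "(\<lambda>s. (cmod (x s))\<^sup>2 + (cmod (y s))\<^sup>2) summable_on UNIV"
    using assms by (intro summable_on_add) (auto simp: ell2_set_def)
  show "norm (x s \<bullet> y s) \<le> (cmod (x s))\<^sup>2 + (cmod (y s))\<^sup>2" for s
  proof -
    have "norm (x s \<bullet> y s) \<le> cmod (x s) * cmod (y s)"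
      using Cauchy_Schwarz_ineq2[of "x s" "y s"] by simp
    moreover have "2 * cmod (x s) * cmod (y s) \<le> (cmod (x s))\<^sup>2 + (cmod (y s))\<^sup>2"
      by (rule sum_squares_bound)
    moreover have "0 \<le> cmod (x s) * cmod (y s)" by simp
    ultimately show ?thesis by linarith
  qed
qed simp

instantiation ell2 :: (type) real_inner
begin

text \<open>
  The real part of the usual complex inner product.
\<close>

definition inner_ell2 :: "'a ell2 \<Rightarrow> 'a ell2 \<Rightarrow> real"
  where "inner_ell2 x y = (\<Sum>\<^sub>\<infinity>s. ell2_fun x s \<bullet> ell2_fun y s)"

instance
proof
  fix x y z :: "'a ell2" and r :: real
  note summable = ell2_inner_summable[OF ell2_fun ell2_fun]
  have norm_sq: "x \<bullet> x = (norm x)\<^sup>2" for x :: "'a ell2"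
  proof -
    have "0 \<le> (\<Sum>\<^sub>\<infinity>s. (cmod (ell2_fun x s))\<^sup>2)" by (rule infsum_nonneg) simp
    then show ?thesis by (simp add: inner_ell2_def norm_ell2.rep_eq dot_square_norm)
  qed
  show "x \<bullet> y = y \<bullet> x" by (simp add: inner_ell2_def inner_commute)
  show "(x + y) \<bullet> z = x \<bullet> z + y \<bullet> z"
    by (simp add: inner_ell2_def plus_ell2.rep_eq inner_add_left infsum_add summable)
  show "(r *\<^sub>R x) \<bullet> y = r * (x \<bullet> y)"
    by (simp add: inner_ell2_def scaleR_ell2.rep_eq scaleR_conv_of_real[symmetric] infsum_cmult_right')
  show "0 \<le> x \<bullet> x" by (simp add: norm_sq)
  show "x \<bullet> x = 0 \<longleftrightarrow> x = 0" by (simp add: norm_sq)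
  show "norm x = sqrt (x \<bullet> x)" by (simp add: norm_sq)
qed

end

instance ell2 :: (type) banach
proof
  fix X :: "nat \<Rightarrow> 'a ell2" assume X: "Cauchy X"
  have "Cauchy (\<lambda>n. ell2_fun (X n) s)" for s
  proof (rule CauchyI)
    fix \<epsilon> :: real assume "0 < \<epsilon>"
    then obtain M where M: "\<And>m n. m \<ge> M \<Longrightarrow> n \<ge> M \<Longrightarrow> norm (X m - X n) < \<epsilon>"
      using CauchyD[OF X] by blast
    have "cmod (ell2_fun (X m) s - ell2_fun (X n) s) \<le> norm (X m - X n)" for m n
      using cmod_le_norm_ell2[of "X m - X n" s] by (simp add: minus_ell2.rep_eq)
    then show "\<exists>M. \<forall>m\<ge>M. \<forall>n\<ge>M. cmod (ell2_fun (X m) s - ell2_fun (X n) s) < \<epsilon>"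
      using M by (meson order_le_less_trans)
  qed
  then have "\<exists>l. (\<lambda>n. ell2_fun (X n) s) \<longlonglongrightarrow> l" for s
    by (simp add: Cauchy_convergent_iff convergent_def)
  then obtain x where x: "\<And>s. (\<lambda>n. ell2_fun (X n) s) \<longlonglongrightarrow> x s" by metis
  have tail: "\<exists>M. \<forall>n\<ge>M. \<forall>H. finite H \<longrightarrow> L2_set (\<lambda>s. cmod (x s - ell2_fun (X n) s)) H \<le> \<epsilon>"
    if "0 < \<epsilon>" for \<epsilon>
  proof -
    obtain M where M: "\<And>m n. m \<ge> M \<Longrightarrow> n \<ge> M \<Longrightarrow> norm (X m - X n) < \<epsilon>"
      using CauchyD[OF X \<open>0 < \<epsilon>\<close>] by blast
    have "L2_set (\<lambda>s. cmod (x s - ell2_fun (X n) s)) H \<le> \<epsilon>" if "n \<ge> M" "finite H" for n H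
    proof (rule LIMSEQ_le_const2)
      show "(\<lambda>m. L2_set (\<lambda>s. cmod (ell2_fun (X m) s - ell2_fun (X n) s)) H)
          \<longlonglongrightarrow> L2_set (\<lambda>s. cmod (x s - ell2_fun (X n) s)) H"
        unfolding L2_set_def by (intro tendsto_intros x)
      have "L2_set (\<lambda>s. cmod (ell2_fun (X m) s - ell2_fun (X n) s)) H \<le> norm (X m - X n)" for m
        using L2_set_le_ell2_norm[OF ell2_fun that(2), of "X m - X n"]
        by (simp add: minus_ell2.rep_eq norm_ell2.rep_eq)
      then show "\<exists>N. \<forall>m\<ge>N. L2_set (\<lambda>s. cmod (ell2_fun (X m) s - ell2_fun (X n) s)) H \<le> \<epsilon>"
        using M[OF _ that(1)] by (intro exI[of _ M]) (meson less_imp_le order_trans)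
    qed
    then show ?thesis by blast
  qed
  \<comment> \<open>The pointwise limit is square-summable, since it differs from \<open>X M\<close> by a square-summable function.\<close>
  obtain M where "\<And>H. finite H \<Longrightarrow> L2_set (\<lambda>s. cmod (x s - ell2_fun (X M) s)) H \<le> 1"
    using tail[of 1] by auto
  from ell2_set_add(1)[OF ell2_setI(1)[OF this] ell2_fun[of "X M"]]
  have mem: "x \<in> ell2_set" by simp
  have "X \<longlonglongrightarrow> Abs_ell2 x"
  proof (rule LIMSEQ_I)
    fix \<epsilon> :: real assume "0 < \<epsilon>"
    then obtain M where M: "\<And>n H. n \<ge> M \<Longrightarrow> finite H \<Longrightarrow> L2_set (\<lambda>s. cmod (x s - ell2_fun (X n) s)) H \<le> \<epsilon> / 2"
      using tail[of "\<epsilon> / 2"] by auto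
    have "norm (X n - Abs_ell2 x) < \<epsilon>" if "n \<ge> M" for n
    proof -
      have "norm (Abs_ell2 x - X n) \<le> \<epsilon> / 2"
        using ell2_setI(2)[OF M[OF that]]
        by (simp add: norm_ell2.rep_eq minus_ell2.rep_eq Abs_ell2_inverse[OF mem])
      then show ?thesis using \<open>0 < \<epsilon>\<close> by (simp add: norm_minus_commute)
    qed
    then show "\<exists>M. \<forall>n\<ge>M. norm (X n - Abs_ell2 x) < \<epsilon>" by blast
  qed
  then show "convergent X" by (auto simp: convergent_def)
qed

lemma finite_support_ell2:
  assumes "finite {s. x s \<noteq> 0}"
  shows "x \<in> ell2_set"
proof -
  have "(\<lambda>s. (cmod (x s))\<^sup>2) summable_on {s. x s \<noteq> 0}" using assms by simp
  also have "?this \<longleftrightarrow> (\<lambda>s. (cmod (x s))\<^sup>2) summable_on UNIV"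
    by (rule summable_on_cong_neutral) auto
  finally show ?thesis by (simp add: ell2_set_def)
qed

lift_definition dirac :: "'v \<Rightarrow> 'v ell2" is "\<lambda>s r. if r = s then 1 else 0"
  by (rule finite_support_ell2) simp

lemma ell2_fun_sum: "ell2_fun (\<Sum>s\<in>A. f s) r = (\<Sum>s\<in>A. ell2_fun (f s) r)"
  by (induction A rule: infinite_finite_induct) (simp_all add: zero_ell2.rep_eq plus_ell2.rep_eq)

lemma ell2_eqI: "(\<And>s. ell2_fun x s = ell2_fun y s) \<Longrightarrow> x = y"
  by (metis ell2_fun_inject ext)

lemma norm_finite_sum_dirac:
  assumes "finite A"
  shows "norm (\<Sum>s\<in>A. dirac s) = sqrt (card A)"
proof -
  have "ell2_fun (\<Sum>s\<in>A. dirac s) = (\<lambda>r. if r \<in> A then 1 else 0)"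
    using assms by (auto simp: ell2_fun_sum dirac.rep_eq)
  moreover have "(\<Sum>\<^sub>\<infinity>r. (cmod (if r \<in> A then 1 else 0))\<^sup>2) = (\<Sum>\<^sub>\<infinity>r\<in>A. 1)"
    by (rule infsum_cong_neutral) auto
  ultimately show ?thesis using assms by (simp add: norm_ell2.rep_eq)
qed

lemma ell2_finite_approximation:
  fixes x :: "'v ell2"
  assumes "0 < \<epsilon>"
  shows "\<exists>A. finite A \<and> norm (x - (\<Sum>s\<in>A. ell2_fun x s *\<^sub>C dirac s)) < \<epsilon>"
proof -
  let ?f = "\<lambda>s. (cmod (ell2_fun x s))\<^sup>2"
  have sm: "?f summable_on B" for B
    using ell2_fun[of x] by (auto simp: ell2_set_def intro: summable_on_subset_banach)
  have "(?f has_sum infsum ?f UNIV) UNIV" using sm by simp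
  then have "\<forall>\<^sub>F A in finite_subsets_at_top UNIV. dist (sum ?f A) (infsum ?f UNIV) < \<epsilon>\<^sup>2"
    using assms unfolding has_sum_def tendsto_iff by simp
  then obtain A where A: "finite A" "dist (sum ?f A) (infsum ?f UNIV) < \<epsilon>\<^sup>2"
    by (auto simp: eventually_finite_subsets_at_top)
  have eq: "ell2_fun (x - (\<Sum>s\<in>A. ell2_fun x s *\<^sub>C dirac s)) r = (if r \<in> A then 0 else ell2_fun x r)" for r
    using A(1) by (simp add: minus_ell2.rep_eq ell2_fun_sum scaleC_ell2.rep_eq dirac.rep_eq if_distrib cong: if_cong)
  have "infsum ?f UNIV = infsum ?f A + infsum ?f (- A)"
    using infsum_Un_disjoint[OF sm[of A] sm[of "- A"]] by simp
  moreover have "(\<Sum>\<^sub>\<infinity>r. (cmod (if r \<in> A then 0 else ell2_fun x r))\<^sup>2) = infsum ?f (- A)"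
    by (rule infsum_cong_neutral) auto
  ultimately have "norm (x - (\<Sum>s\<in>A. ell2_fun x s *\<^sub>C dirac s)) = sqrt (infsum ?f UNIV - sum ?f A)"
    using A(1) by (simp add: norm_ell2.rep_eq eq)
  also have "\<dots> < sqrt (\<epsilon>\<^sup>2)"
    using A(2) by (intro real_sqrt_less_mono) (simp add: dist_real_def)
  finally show ?thesis using A(1) assms by auto
qed

section \<open>Automorphisms of the tree\<close>

lemma walk_prefix: "walk E a b (xs @ s # ys) \<Longrightarrow> walk E a s (xs @ [s])"
  by (cases xs) (auto simp: walk_def successively_append_iff successively_Cons hd_append)

lemma geodesic_length_le: "geodesic E a b p \<Longrightarrow> walk E a b q \<Longrightarrow> length p \<le> length q"
  by (simp add: geodesic_def)

lemma geodesic_prefix: "geodesic E a s (p @ [t, s]) \<Longrightarrow> walk E a t (p @ [t])"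
  using walk_prefix[of E a s p t "[s]"] by (simp add: geodesic_def)

text \<open>
  Every edge joins a vertex to its predecessor. If \<open>t\<close> is not the predecessor of \<open>s\<close>, then every walk
  from the root to \<open>t\<close> passes through \<open>s\<close>; cutting a geodesic from the root to \<open>t\<close> at \<open>s\<close> gives a walk from
  the root to \<open>s\<close> that avoids \<open>t\<close>, so \<open>s\<close> is the predecessor of \<open>t\<close>.
\<close>

lemma edge_iff_hat:
  assumes T: "aleph0_regular_tree E"
  shows "E s t \<longleftrightarrow> (s \<noteq> a \<and> hat E a s = t) \<or> (t \<noteq> a \<and> hat E a t = s)"
proof
  have sym: "E t s" if "E s t" for s t
    using T that by (auto simp: aleph0_regular_tree_def symp_def)
  show "E s t" if "(s \<noteq> a \<and> hat E a s = t) \<or> (t \<noteq> a \<and> hat E a t = s)"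
    using that hat_iff[OF T, of s a t] hat_iff[OF T, of t a s] sym by auto
  assume E: "E s t"
  have ne: "s \<noteq> t" using T E by (auto simp: aleph0_regular_tree_def irreflp_def)
  have trivial: "joined_avoiding E s a a" if "s \<noteq> a" for s
    unfolding joined_avoiding_def walk_def using that by (intro exI[of _ "[a]"]) simp
  show "(s \<noteq> a \<and> hat E a s = t) \<or> (t \<noteq> a \<and> hat E a t = s)"
  proof (cases "t = a")
    case True
    then show ?thesis using hat_iff[OF T, of s a t] trivial[of s] ne sym[OF E] by auto
  next
    case False
    show ?thesis
    proof (cases "s \<noteq> a \<and> joined_avoiding E s a t")
      case True
      then show ?thesis using hat_iff[OF T, of s a t] sym[OF E] by auto
    next
      case nja: False
      obtain r p where g: "geodesic E a t (p @ [r, t])"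
        using geodesic_exists[OF T False] by blast
      have w: "walk E a r (p @ [r])" "t \<notin> set (p @ [r])"
      proof -
        show 1: "walk E a r (p @ [r])" by (rule geodesic_prefix[OF g])
        show "t \<notin> set (p @ [r])"
        proof
          assume "t \<in> set (p @ [r])"
          then obtain xs ys where d: "p @ [r] = xs @ t # ys" by (meson split_list)
          from geodesic_length_le[OF g walk_prefix[OF 1[unfolded d]]]
          have "length (p @ [r, t]) \<le> length (xs @ [t])" .
          moreover have "length (p @ [r]) = length (xs @ t # ys)" using d by simp
          ultimately show False by simp
        qed
      qed
      have "joined_avoiding E t a s"
      proof (cases "s = a")
        case True
        then show ?thesis using trivial[OF False] by simp
      next
        case sa: False
        have "walk E a t (p @ [r, t])" using g by (simp add: geodesic_def)
        then have "s \<in> set (p @ [r, t])" using nja sa unfolding joined_avoiding_def by blast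
        then have "s \<in> set (p @ [r])" using ne by auto
        then obtain xs ys where d: "p @ [r] = xs @ s # ys" by (meson split_list)
        from walk_prefix[OF w(1)[unfolded d]] have "walk E a s (xs @ [s])" .
        moreover have "t \<notin> set (xs @ [s])" using w(2) unfolding d by auto
        ultimately show ?thesis unfolding joined_avoiding_def by blast
      qed
      then show ?thesis using hat_iff[OF T False, of s] E False by auto
    qed
  qed
qed

definition children :: "('v \<Rightarrow> 'v \<Rightarrow> bool) \<Rightarrow> 'v \<Rightarrow> 'v \<Rightarrow> 'v set"
  where "children E a t = {s. s \<noteq> a \<and> hat E a s = t}"

lemma neighbours_eq:
  assumes "aleph0_regular_tree E"
  shows "{s. E s t} = children E a t \<union> (if t = a then {} else {hat E a t})"
  using edge_iff_hat[OF assms, of _ t a] by (auto simp: children_def)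

text \<open>
  Otherwise the geodesics to \<open>t\<close> and to its predecessor would each be longer than the other.
\<close>

lemma hat_not_child:
  assumes T: "aleph0_regular_tree E" and "t \<noteq> a"
  shows "hat E a t \<notin> children E a t"
proof
  assume "hat E a t \<in> children E a t"
  then have ne: "hat E a t \<noteq> a" and hh: "hat E a (hat E a t) = t" by (auto simp: children_def)
  obtain r p where g: "geodesic E a t (p @ [r, t])"
    using geodesic_exists[OF T \<open>t \<noteq> a\<close>] by blast
  have r: "hat E a t = r" by (rule hat_geodesic[OF T \<open>t \<noteq> a\<close> g])
  have "r \<noteq> a" using ne r by simp
  obtain t' q' where g': "geodesic E a r (q' @ [t', r])"
    using geodesic_exists[OF T \<open>r \<noteq> a\<close>] by blast
  have "t' = t" using hat_geodesic[OF T \<open>r \<noteq> a\<close> g'] hh r by simp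
  have "length (q' @ [t', r]) \<le> length (p @ [r])"
    by (rule geodesic_length_le[OF g' geodesic_prefix[OF g]])
  moreover have "walk E a t (q' @ [t])" using geodesic_prefix[OF g'] \<open>t' = t\<close> by simp
  from geodesic_length_le[OF g this] have "length (p @ [r, t]) \<le> length (q' @ [t])" .
  ultimately show False by simp
qed

lemma infinite_children:
  assumes T: "aleph0_regular_tree E"
  shows "infinite (children E a t)"
proof -
  have "{s. E t s} = {s. E s t}" using T by (auto simp: aleph0_regular_tree_def symp_def)
  moreover have "infinite {s. E t s}" using T unfolding aleph0_regular_tree_def by blast
  ultimately have "infinite {s. E s t}" by simp
  then show ?thesis unfolding neighbours_eq[OF T, of t a] by (auto split: if_splits)
qed

lemma hat_induct:
  assumes T: "aleph0_regular_tree E"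
    and root: "P a" and step: "\<And>s. s \<noteq> a \<Longrightarrow> P (hat E a s) \<Longrightarrow> P s"
  shows "P s"
proof -
  have "P s" if "walk E a s p" "length p = n" for p n
    using that
  proof (induction n arbitrary: s p rule: less_induct)
    case (less n)
    show ?case
    proof (cases "s = a")
      case True
      then show ?thesis using root by simp
    next
      case False
      obtain t q where g: "geodesic E a s (q @ [t, s])"
        using geodesic_exists[OF T False] by blast
      have t: "hat E a s = t" by (rule hat_geodesic[OF T False g])
      have w: "walk E a t (q @ [t])" by (rule geodesic_prefix[OF g])
      have "length (q @ [t, s]) \<le> length p" by (rule geodesic_length_le[OF g less.prems(1)])
      then have "length (q @ [t]) < n" using less.prems(2) by simp
      then have "P t" using less.IH w by blast
      then show ?thesis using step[OF False] t by simp
    qed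
  qed
  moreover obtain p where "walk E a s p" using T unfolding aleph0_regular_tree_def by blast
  ultimately show ?thesis by blast
qed

text \<open>
  Numbering the children of each vertex gives every vertex an address, the list of child numbers on
  the path from the root \<open>a\<close>, with the last step first. Since each vertex has countably infinitely many
  children, every finite list of natural numbers is an address, whatever the root.
\<close>

primrec addressed :: "('v \<Rightarrow> 'v \<Rightarrow> bool) \<Rightarrow> 'v \<Rightarrow> nat list \<Rightarrow> 'v" where
  "addressed E a [] = a"
| "addressed E a (n # l) = from_nat_into (children E a (addressed E a l)) n"

context
  fixes E :: "'v \<Rightarrow> 'v \<Rightarrow> bool"
  assumes T: "aleph0_regular_tree E"
begin

lemma bij_children: "bij_betw (from_nat_into (children E a t)) UNIV (children E a t)"
proof (rule bij_betw_from_nat_into)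
  have "countable (UNIV :: 'v set)" using T by (simp add: aleph0_regular_tree_def)
  then show "countable (children E a t)" by (rule countable_subset[OF subset_UNIV])
qed (rule infinite_children[OF T])

lemma addressed_child: "addressed E a (n # l) \<in> children E a (addressed E a l)"
  using bij_betwE[OF bij_children] by simp

lemma hat_addressed: "addressed E a (n # l) \<noteq> a" "hat E a (addressed E a (n # l)) = addressed E a l"
  using addressed_child by (auto simp: children_def simp del: addressed.simps)

lemma addressed_inj: "addressed E a l = addressed E a m \<Longrightarrow> l = m"
proof (induction l arbitrary: m)
  case Nil
  then have "addressed E a m = a" by simp
  then show ?case using hat_addressed(1)[of a] by (cases m) (auto simp del: addressed.simps)
next
  case (Cons n l)
  obtain k m' where m: "m = k # m'"
    using Cons.prems hat_addressed(1)[of a n l] by (cases m) (auto simp del: addressed.simps(2))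
  have "l = m'" using Cons.IH hat_addressed(2)[of a n l] hat_addressed(2)[of a k m'] Cons.prems m by simp
  moreover from this have "n = k"
    using Cons.prems m bij_betw_imp_inj_on[OF bij_children] by (auto dest: injD)
  ultimately show ?case using m by simp
qed

lemma bij_addressed: "bij (addressed E a)"
proof (rule bijI)
  show "inj (addressed E a)" using addressed_inj by (auto intro: injI)
  have "\<exists>l. addressed E a l = s" for s
  proof (rule hat_induct[OF T, of _ a])
    show "\<exists>l. addressed E a l = a" by (intro exI[of _ "[]"]) simp
    fix s assume "s \<noteq> a" "\<exists>l. addressed E a l = hat E a s"
    then obtain l where "addressed E a l = hat E a s" by blast
    then have "s \<in> children E a (addressed E a l)" using \<open>s \<noteq> a\<close> by (simp add: children_def)
    then have "s \<in> range (from_nat_into (children E a (addressed E a l)))"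
      by (simp only: bij_betw_imp_surj_on[OF bij_children])
    then obtain n where "from_nat_into (children E a (addressed E a l)) n = s" by (metis rangeE)
    then show "\<exists>l. addressed E a l = s" by (intro exI[of _ "n # l"]) simp
  qed
  then show "surj (addressed E a)" by (metis surjI)
qed

definition address_adjacent :: "nat list \<Rightarrow> nat list \<Rightarrow> bool"
  where "address_adjacent l m \<longleftrightarrow> (\<exists>n. l = n # m) \<or> (\<exists>n. m = n # l)"

lemma edge_addressed: "E (addressed E a l) (addressed E a m) \<longleftrightarrow> address_adjacent l m"
proof -
  have *: "addressed E a l \<noteq> a \<and> hat E a (addressed E a l) = addressed E a m \<longleftrightarrow> (\<exists>n. l = n # m)" for l m
  proof (cases l)
    case Nil
    then show ?thesis by simp
  next
    case (Cons k l')
    then show ?thesis using hat_addressed[of a k l'] addressed_inj by (auto simp del: addressed.simps)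
  qed
  show ?thesis unfolding edge_iff_hat[OF T, of _ _ a] * address_adjacent_def ..
qed

text \<open>
  The addresses identify the tree with one fixed tree on the lists of natural numbers, so
  automorphisms can be written down on lists. The roots \<open>a\<close> and \<open>b\<close> of the two address systems may
  differ, which gives transitivity with the identity on lists.
\<close>

lemma Aut_of_address_automorphism:
  assumes \<sigma>: "bij \<sigma>" "\<And>l m. address_adjacent (\<sigma> l) (\<sigma> m) \<longleftrightarrow> address_adjacent l m"
  shows "\<exists>g\<in>Aut E. \<forall>l. g (addressed E a l) = addressed E b (\<sigma> l)"
proof -
  define g where "g = addressed E b \<circ> \<sigma> \<circ> inv_into UNIV (addressed E a)"
  have g: "g (addressed E a l) = addressed E b (\<sigma> l)" for l
    by (simp add: g_def inv_f_f bij_is_inj[OF bij_addressed])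
  have "E (g s) (g t) \<longleftrightarrow> E s t" for s t
  proof -
    obtain l m where "s = addressed E a l" "t = addressed E a m"
      using bij_is_surj[OF bij_addressed, of a] by (metis surjD)
    then show ?thesis by (simp add: g edge_addressed \<sigma>(2))
  qed
  moreover have "bij g"
    unfolding g_def by (intro bij_comp \<sigma>(1) bij_addressed bij_imp_bij_inv)
  ultimately show ?thesis using g by (auto simp: Aut_def)
qed

lemma Aut_transitive: "\<exists>g\<in>Aut E. g a = b"
proof -
  have "bij (\<lambda>l :: nat list. l)" by (simp add: bij_def)
  from Aut_of_address_automorphism[OF this, of a b] obtain g
    where "g \<in> Aut E" "\<And>l. g (addressed E a l) = addressed E b l" by auto
  then show ?thesis by (metis addressed.simps(1))
qed

text \<open>
  The last entry of an address is the number of a child of the root. Exchanging two numbers in that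
  position permutes the children of the root together with the subtrees below them, and fixes the root.
  This can move the branch of \<open>s\<close> to the branch of any other child.
\<close>

lemma infinite_stabiliser_orbit:
  assumes "s \<noteq> e"
  shows "infinite {g s | g. g \<in> Aut E \<and> g e = e}"
proof -
  obtain l where l: "s = addressed E e l"
    using bij_is_surj[OF bij_addressed, of e] by (metis surjD)
  then have "l \<noteq> []" using assms by auto
  then obtain l' k where lk: "l = l' @ [k]" by (metis append_butlast_last_id)
  define \<sigma> :: "nat \<Rightarrow> nat list \<Rightarrow> nat list"
    where "\<sigma> j m = (if m = [] then [] else butlast m @ [Transposition.transpose k j (last m)])" for j m
  have "addressed E e (l' @ [j]) \<in> {g s | g. g \<in> Aut E \<and> g e = e}" for j
  proof -
    have inv: "\<sigma> j (\<sigma> j m) = m" for m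
      by (auto simp: \<sigma>_def)
    have adj: "address_adjacent (\<sigma> j p) (\<sigma> j m)" if "address_adjacent p m" for p m
      using that by (auto simp: address_adjacent_def \<sigma>_def)
    have "bij (\<sigma> j)" using inv by (rule involuntory_imp_bij)
    moreover have "address_adjacent (\<sigma> j p) (\<sigma> j m) \<longleftrightarrow> address_adjacent p m" for p m
      using adj[of p m] adj[of "\<sigma> j p" "\<sigma> j m"] inv by auto
    ultimately obtain g where g: "g \<in> Aut E" "\<And>m. g (addressed E e m) = addressed E e (\<sigma> j m)"
      using Aut_of_address_automorphism[of "\<sigma> j" e e] by auto
    have "g e = e" using g(2)[of "[]"] by (simp add: \<sigma>_def)
    moreover have "g s = addressed E e (l' @ [j])" using g(2)[of l] by (simp add: l lk \<sigma>_def)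
    ultimately show ?thesis using g(1) by (metis (mono_tags, lifting) mem_Collect_eq)
  qed
  then have "range (\<lambda>j. addressed E e (l' @ [j])) \<subseteq> {g s | g. g \<in> Aut E \<and> g e = e}" by blast
  moreover have "inj (\<lambda>j. addressed E e (l' @ [j]))"
    using addressed_inj by (auto intro!: injI)
  ultimately show ?thesis
    by (meson infinite_UNIV_nat finite_imageD finite_subset)
qed

end

section \<open>The regular representation and its derivation\<close>

lemma bounded_linear_ell2_fun: "bounded_linear (\<lambda>x. ell2_fun x s)"
  by (rule bounded_linear_intro[where K = 1])
    (simp_all add: plus_ell2.rep_eq scaleR_ell2.rep_eq cmod_le_norm_ell2 scaleR_conv_of_real)

lemma ell2_eq_0_of_infinite_constant:
  assumes "infinite A" "\<And>r. r \<in> A \<Longrightarrow> ell2_fun x r = c"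
  shows "c = 0"
proof (rule ccontr)
  assume "c \<noteq> 0"
  obtain n :: nat where n: "(norm x / cmod c)\<^sup>2 < real n" using reals_Archimedean2 by blast
  obtain B where B: "B \<subseteq> A" "finite B" "card B = n"
    using infinite_arbitrarily_large[OF assms(1)] by blast
  have "L2_set (\<lambda>s. cmod (ell2_fun x s)) B = L2_set (\<lambda>s. cmod c) B"
    using B(1) assms(2) by (intro L2_set_cong) auto
  then have "sqrt (real n) * cmod c \<le> norm x"
    using L2_set_le_ell2_norm[OF ell2_fun B(2), of x] B(3)
    by (simp add: L2_set_def real_sqrt_mult norm_ell2.rep_eq)
  then have "sqrt (real n) \<le> norm x / cmod c" using \<open>c \<noteq> 0\<close> by (simp add: field_simps)
  then have "(sqrt (real n))\<^sup>2 \<le> (norm x / cmod c)\<^sup>2" by (intro power_mono) auto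
  then show False using n by simp
qed

lemma Aut_id: "(\<lambda>s. s) \<in> Aut E"
  by (simp add: Aut_def bij_def)

lemma Aut_comp: "g \<in> Aut E \<Longrightarrow> h \<in> Aut E \<Longrightarrow> (\<lambda>s. g (h s)) \<in> Aut E"
  using bij_comp[of h g] by (auto simp: Aut_def o_def)

lemma Aut_inv: "g \<in> Aut E \<Longrightarrow> inv_into UNIV g \<in> Aut E"
proof -
  assume g: "g \<in> Aut E"
  have "E (inv_into UNIV g s) (inv_into UNIV g t) \<longleftrightarrow> E (g (inv_into UNIV g s)) (g (inv_into UNIV g t))" for s t
    using g by (simp add: Aut_def)
  then show ?thesis using bij_inv_Aut[OF g] by (simp add: Aut_def Aut_inv_apply[OF g])
qed

lemma inv_into_eqI: "g \<in> Aut E \<Longrightarrow> g s = t \<Longrightarrow> inv_into UNIV g t = s"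
  using Aut_inv_apply(1) by metis

lemma lam_comp:
  assumes "g \<in> Aut E" "h \<in> Aut E"
  shows "lam (\<lambda>s. g (h s)) x = lam g (lam h x)"
proof
  fix s
  have "inv_into UNIV (\<lambda>s. g (h s)) s = inv_into UNIV h (inv_into UNIV g s)"
    by (rule inv_into_eqI[OF Aut_comp[OF assms]]) (simp add: Aut_inv_apply[OF assms(1)] Aut_inv_apply[OF assms(2)])
  then show "lam (\<lambda>s. g (h s)) x s = lam g (lam h x) s" by (simp add: lam_def)
qed

lemma lam_id: "lam (\<lambda>s. s) x = x"
  by (simp add: lam_def inv_into_eqI[OF Aut_id])

lemma lam2_comp: "g \<in> Aut E \<Longrightarrow> h \<in> Aut E \<Longrightarrow> lam2 (\<lambda>s. g (h s)) x = lam2 g (lam2 h x)"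
  by (rule iffD1[OF ell2_fun_inject]) (simp add: ell2_fun_lam2[of _ E] Aut_comp lam_comp)

lemma lam2_id: "lam2 (\<lambda>s. s) x = x"
  by (rule iffD1[OF ell2_fun_inject]) (simp add: ell2_fun_lam2[OF Aut_id] lam_id)

lemma lam2_dirac:
  assumes "g \<in> Aut E"
  shows "lam2 g (dirac s) = dirac (g s)"
proof (rule ell2_eqI)
  show "ell2_fun (lam2 g (dirac s)) r = ell2_fun (dirac (g s)) r" for r
    using Aut_inv_apply[OF assms, of s] Aut_inv_apply[OF assms, of r]
    by (auto simp: ell2_fun_lam2[OF assms] lam_def dirac.rep_eq)
qed

definition stabiliser :: "('v \<Rightarrow> 'v \<Rightarrow> bool) \<Rightarrow> 'v \<Rightarrow> ('v \<Rightarrow> 'v) set"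
  where "stabiliser E e = {g \<in> Aut E. g e = e}"

text \<open>
  A function fixed by the stabiliser of \<open>e\<close> is constant on its orbits, which are infinite except
  for \<open>{e}\<close>; square-summable functions vanish on infinite sets where they are constant.
\<close>

lemma stabiliser_fixed:
  assumes T: "aleph0_regular_tree E" and x: "\<And>g. g \<in> stabiliser E e \<Longrightarrow> lam2 g x = x"
  shows "x = ell2_fun x e *\<^sub>C dirac e"
proof (rule ell2_eqI)
  fix s
  have "ell2_fun x s = 0" if "s \<noteq> e"
  proof (rule ell2_eq_0_of_infinite_constant[OF infinite_stabiliser_orbit[OF T that]])
    fix r assume "r \<in> {g s |g. g \<in> Aut E \<and> g e = e}"
    then obtain g where g: "g \<in> Aut E" "g e = e" "r = g s" by blast
    have "lam2 g x = x" using g by (intro x) (simp add: stabiliser_def)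
    then have "ell2_fun x r = lam g (ell2_fun x) r" by (metis ell2_fun_lam2[OF g(1)])
    then show "ell2_fun x r = ell2_fun x s" using g by (simp add: lam_def Aut_inv_apply[OF g(1)])
  qed
  then show "ell2_fun x s = ell2_fun (ell2_fun x e *\<^sub>C dirac e) s"
    by (simp add: scaleC_ell2.rep_eq dirac.rep_eq)
qed

lemma blinfun_apply_lam2: "g \<in> Aut E \<Longrightarrow> blinfun_apply (Blinfun (lam2 g)) = lam2 g"
  by (simp add: bounded_linear_Blinfun_apply lam2_bounded_linear)

lemma stabiliser_operator_group:
  fixes E :: "'v \<Rightarrow> 'v \<Rightarrow> bool"
  shows "bounded_operator_group ((\<lambda>g. Blinfun (lam2 g)) ` stabiliser E e)"
proof
  have comp: "Blinfun (lam2 g) o\<^sub>L Blinfun (lam2 h) = Blinfun (lam2 (\<lambda>s. g (h s)))"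
    if "g \<in> Aut E" "h \<in> Aut E" for g h
    by (rule blinfun_eqI) (simp add: blinfun_apply_lam2[of _ E] that Aut_comp lam2_comp[OF that])
  have id: "Blinfun (lam2 (\<lambda>s::'v. s)) = id_blinfun"
    by (rule blinfun_eqI) (simp add: blinfun_apply_lam2[OF Aut_id] lam2_id)
  show "id_blinfun \<in> (\<lambda>g. Blinfun (lam2 g)) ` stabiliser E e"
    using id Aut_id[of E] by (intro image_eqI[of _ _ "\<lambda>s. s"]) (auto simp: stabiliser_def)
  show "S o\<^sub>L R \<in> (\<lambda>g. Blinfun (lam2 g)) ` stabiliser E e"
    if SR: "S \<in> (\<lambda>g. Blinfun (lam2 g)) ` stabiliser E e" "R \<in> (\<lambda>g. Blinfun (lam2 g)) ` stabiliser E e" for S R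
  proof -
    obtain g h where "g \<in> Aut E" "g e = e" "S = Blinfun (lam2 g)" "h \<in> Aut E" "h e = e" "R = Blinfun (lam2 h)"
      using SR unfolding stabiliser_def by blast
    then show ?thesis
      by (intro image_eqI[of _ _ "\<lambda>s. g (h s)"]) (auto simp: stabiliser_def comp Aut_comp)
  qed
  show "\<exists>R\<in>(\<lambda>g. Blinfun (lam2 g)) ` stabiliser E e. R o\<^sub>L S = id_blinfun \<and> S o\<^sub>L R = id_blinfun"
    if S: "S \<in> (\<lambda>g. Blinfun (lam2 g)) ` stabiliser E e" for S
  proof -
    obtain g where g: "g \<in> Aut E" "g e = e" "S = Blinfun (lam2 g)"
      using S unfolding stabiliser_def by blast
    let ?h = "inv_into UNIV g"
    have h: "?h \<in> stabiliser E e" using g Aut_inv inv_into_eqI[OF g(1,2)] by (simp add: stabiliser_def)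
    moreover have "Blinfun (lam2 ?h) o\<^sub>L S = id_blinfun" "S o\<^sub>L Blinfun (lam2 ?h) = id_blinfun"
      using comp[OF Aut_inv[OF g(1)] g(1)] comp[OF g(1) Aut_inv[OF g(1)]]
      by (simp_all add: g(3) Aut_inv_apply[OF g(1)] id)
    ultimately show ?thesis by blast
  qed
  show "bounded ((\<lambda>g. Blinfun (lam2 g)) ` stabiliser E e)"
    unfolding bounded_iff
    by (intro exI[of _ 1])
      (auto simp: stabiliser_def blinfun_apply_lam2 norm_lam2 intro!: norm_blinfun_bound)
qed

text \<open>
  Irreducibility of the regular representation. Move a point of the support of \<open>x\<close> to \<open>e\<close> and average
  over the stabiliser of \<open>e\<close>: the result stays in \<open>W\<close>, keeps its value at \<open>e\<close>, and is fixed by the stabiliser,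
  hence is a nonzero multiple of the Dirac function at \<open>e\<close>. By transitivity \<open>W\<close> contains all Dirac
  functions, which span a dense subspace.
\<close>

lemma invariant_subspace_UNIV:
  fixes W :: "'v ell2 set"
  assumes T: "aleph0_regular_tree E"
    and W: "closed W" "\<And>x y. x \<in> W \<Longrightarrow> y \<in> W \<Longrightarrow> x + y \<in> W" "\<And>c x. x \<in> W \<Longrightarrow> c *\<^sub>C x \<in> W"
    and inv: "\<And>g x. g \<in> Aut E \<Longrightarrow> x \<in> W \<Longrightarrow> lam2 g x \<in> W"
    and x: "x \<in> W" "x \<noteq> 0"
  shows "W = UNIV"
proof -
  obtain e where xe: "ell2_fun x e \<noteq> 0" using x(2) ell2_eqI[of x 0] by (auto simp: zero_ell2.rep_eq)
  let ?G = "(\<lambda>g. Blinfun (lam2 g)) ` stabiliser E e"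
  interpret G: bounded_operator_group ?G by (rule stabiliser_operator_group)
  \<comment> \<open>Along this filter, asymptotically fixed means fixed by the stabiliser.\<close>
  interpret operator_group_filter ?G "principal ?G"
  proof
    show "principal ?G \<noteq> bot" using G.id_mem by (auto simp: principal_eq_bot_iff)
    show "\<exists>Q'. eventually Q' (principal ?G) \<and> (\<forall>S T. Q' S \<longrightarrow> Q' T \<longrightarrow> Q (S o\<^sub>L T))"
      if "eventually Q (principal ?G)" for Q
      using that G.compose_mem unfolding eventually_principal by (intro exI[of _ "\<lambda>S. S \<in> ?G"]) blast
  qed (simp add: eventually_principal)
  obtain m where m: "m \<in> asymptotic_hull x" "asymptotically_fixed m"
    using asymptotically_fixed_point_exists by blast
  have cW: "convex W"
    using W(2,3) by (intro convexI) (simp add: scaleC_of_real[symmetric])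
  have lin: "bounded_linear (\<lambda>w. ell2_fun w e)" by (rule bounded_linear_ell2_fun)
  have "m \<in> orbit_hull ?G x"
    using m(1) by (simp add: asymptotic_hull_def eventually_principal)
  also have "\<dots> \<subseteq> W \<inter> (\<lambda>w. ell2_fun w e) -` {ell2_fun x e}"
  proof (intro orbit_hull_least closed_Int convex_Int W(1) cW)
    show "closed ((\<lambda>w. ell2_fun w e) -` {ell2_fun x e})"
      by (intro continuous_closed_vimage linear_continuous_at lin) simp
    show "convex ((\<lambda>w. ell2_fun w e) -` {ell2_fun x e})"
      by (intro convex_linear_vimage bounded_linear.linear lin) simp
    fix S assume "S \<in> ?G"
    then obtain g where g: "g \<in> Aut E" "g e = e" "S = Blinfun (lam2 g)" by (auto simp: stabiliser_def)
    have "ell2_fun (lam2 g x) e = ell2_fun x e"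
      by (simp add: ell2_fun_lam2[OF g(1)] lam_def inv_into_eqI[OF g(1,2)])
    then show "blinfun_apply S x \<in> W \<inter> (\<lambda>w. ell2_fun w e) -` {ell2_fun x e}"
      using inv[OF g(1) x(1)] by (simp add: g(3) blinfun_apply_lam2[OF g(1)])
  qed
  finally have mW: "m \<in> W" and me: "ell2_fun m e = ell2_fun x e" by auto
  have fixed: "lam2 g m = m" if g: "g \<in> stabiliser E e" for g
  proof -
    have "g \<in> Aut E" using g by (simp add: stabiliser_def)
    have "dist (blinfun_apply (Blinfun (lam2 g)) m) m < \<epsilon>" if "0 < \<epsilon>" for \<epsilon>
      by (rule m(2)[unfolded asymptotically_fixed_def tendsto_iff eventually_principal, rule_format, OF that imageI[OF g]])
    then have "dist (lam2 g m) m \<le> 0"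
      unfolding blinfun_apply_lam2[OF \<open>g \<in> Aut E\<close>] by (rule_tac field_le_epsilon) (simp add: less_imp_le)
    then show ?thesis by simp
  qed
  have "m = ell2_fun x e *\<^sub>C dirac e"
    using stabiliser_fixed[where e = e and x = m, OF T fixed] me by simp
  then have "inverse (ell2_fun x e) *\<^sub>C m = dirac e"
    using xe scaleC_of_real[of 1 "dirac e"] by (simp add: scaleC_scaleC)
  then have de: "dirac e \<in> W" using W(3)[OF mW] by metis
  have dirac: "dirac s \<in> W" for s
  proof -
    obtain g where g: "g \<in> Aut E" "g e = s" using Aut_transitive[OF T] by blast
    show ?thesis using inv[OF g(1) de] by (simp add: lam2_dirac[OF g(1)] g(2))
  qed
  have zero: "0 \<in> W" using W(3)[OF x(1), of 0] scaleC_of_real[of 0 x] by simp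
  have sums: "(\<Sum>s\<in>A. f s *\<^sub>C dirac s) \<in> W" for A f
    by (induction A rule: infinite_finite_induct) (auto simp: zero W dirac)
  have "y \<in> closure W" for y
    unfolding closure_approachable
  proof (intro allI impI)
    fix \<epsilon> :: real assume "0 < \<epsilon>"
    then obtain A where "norm (y - (\<Sum>s\<in>A. ell2_fun y s *\<^sub>C dirac s)) < \<epsilon>"
      using ell2_finite_approximation by blast
    then show "\<exists>w\<in>W. dist w y < \<epsilon>"
      by (intro bexI[OF _ sums]) (simp add: dist_norm norm_minus_commute)
  qed
  then show ?thesis using W(1) by auto
qed

text \<open>
  The derivation vanishes on the stabiliser of the root, so \<open>\<theta>\<close> maps the Dirac function at \<open>e\<close> to a
  multiple of itself. Transporting this along an automorphism from \<open>e\<close> to a neighbour \<open>s\<close> shows that \<open>\<theta>\<close>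
  maps the Dirac function at \<open>s\<close> to a function with value \<open>-1\<close> at \<open>e\<close>. On the sum of \<open>n\<close> such Dirac
  functions, of norm \<open>\<surd>n\<close>, the value at \<open>e\<close> is \<open>-n\<close>, so \<open>\<theta>\<close> is unbounded.
\<close>

lemma derivation_not_inner:
  assumes T: "aleph0_regular_tree E" and \<theta>: "bounded_linear \<theta>"
    and eq: "\<And>g y. g \<in> Aut E \<Longrightarrow> \<theta> (lam2 g y) = lam2 g (\<theta> y) + deriv_op E e g y"
  shows False
proof -
  interpret \<theta>: bounded_linear \<theta> by fact
  have "lam2 g (\<theta> (dirac e)) = \<theta> (dirac e)" if "g \<in> stabiliser E e" for g
  proof -
    have g: "g \<in> Aut E" "g e = e" using that by (auto simp: stabiliser_def)
    have "inv_into UNIV g s = e \<longleftrightarrow> s = e" for s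
      using inv_into_eqI[OF g] Aut_inv_apply[OF g(1), of s] g(2) by auto
    moreover have "hat E e (inv_into UNIV g s) = inv_into UNIV g (hat E e s)" for s
      using hat_Aut[OF T g(1), of e "inv_into UNIV g s"] g(2) by (simp add: Aut_inv_apply[OF g(1)] inv_into_eqI[OF g(1)])
    ultimately have "deriv_op E e g (dirac e) = 0"
      by (intro ell2_eqI) (simp add: deriv_op(1)[OF T g(1)] Lstar_def lam_def zero_ell2.rep_eq)
    then show ?thesis using eq[OF g(1), of "dirac e"] by (simp add: lam2_dirac[OF g(1)] g(2))
  qed
  from stabiliser_fixed[OF T this] obtain c where c: "\<theta> (dirac e) = c *\<^sub>C dirac e" by blast
  have coeff: "ell2_fun (\<theta> (dirac s)) e = -1" if s: "s \<in> children E e e" for s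
  proof -
    have se: "s \<noteq> e" "E e s"
      using s edge_iff_hat[OF T, of e s e] by (auto simp: children_def)
    obtain g where g: "g \<in> Aut E" "g e = s" using Aut_transitive[OF T] by blast
    let ?r = "inv_into UNIV g e"
    \<comment> \<open>The preimage of \<open>e\<close> is a neighbour of \<open>e\<close>, because \<open>e\<close> is a neighbour of \<open>s = g e\<close>.\<close>
    have "E ?r e \<longleftrightarrow> E (g ?r) (g e)" using g(1) by (simp add: Aut_def)
    then have "E ?r e" using se(2) by (simp add: Aut_inv_apply[OF g(1)] g(2))
    then have r: "?r \<noteq> e" "hat E e ?r = e" using edge_iff_hat[OF T, of ?r e e] by auto
    have "\<theta> (dirac s) = lam2 g (\<theta> (dirac e)) + deriv_op E e g (dirac e)"
      using eq[OF g(1), of "dirac e"] by (simp add: lam2_dirac[OF g(1)] g(2))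
    then show ?thesis
      by (simp add: c plus_ell2.rep_eq ell2_fun_lam2[OF g(1)] deriv_op(1)[OF T g(1)] lam_def Lstar_def
          r scaleC_ell2.rep_eq dirac.rep_eq)
  qed
  obtain K where K: "0 < K" "\<And>x. norm (\<theta> x) \<le> norm x * K" using \<theta>.pos_bounded by blast
  obtain n :: nat where n: "K\<^sup>2 < real n" using reals_Archimedean2 by blast
  obtain A where A: "A \<subseteq> children E e e" "finite A" "card A = n"
    using infinite_arbitrarily_large[OF infinite_children[OF T]] by blast
  have "ell2_fun (\<theta> (\<Sum>s\<in>A. dirac s)) e = - of_nat n"
    using A coeff by (simp add: \<theta>.sum ell2_fun_sum subset_iff)
  then have "real n \<le> norm (\<theta> (\<Sum>s\<in>A. dirac s))"
    using cmod_le_norm_ell2[of "\<theta> (\<Sum>s\<in>A. dirac s)" e] by simp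
  also have "\<dots> \<le> sqrt (real n) * K"
    using K(2)[of "\<Sum>s\<in>A. dirac s"] A by (simp add: norm_finite_sum_dirac)
  finally have "sqrt (real n) * sqrt (real n) \<le> sqrt (real n) * K" by simp
  moreover have "0 < real n" using n by (meson order_le_less_trans zero_le_power2)
  ultimately have "sqrt (real n) \<le> K"
    by (intro mult_left_le_imp_le[of "sqrt (real n)" "sqrt (real n)" K]) simp_all
  then have "(sqrt (real n))\<^sup>2 \<le> K\<^sup>2" by (intro power_mono) auto
  then show False using n by simp
qed

lemma lam_ell1:
  assumes g: "g \<in> Aut E" and x: "x \<in> ell1_set"
  shows "lam g x \<in> ell1_set"
  using x summable_on_reindex_bij_betw[OF bij_inv_Aut[OF g], of "\<lambda>s. cmod (x s)"]
  by (simp add: ell1_set_def lam_def)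

text \<open>
  On summable functions \<open>L\<^sup>* + L\<close> is the adjacency operator of the tree, which does not depend on the
  root. Hence it commutes with all automorphisms.
\<close>

lemma Lstar_add_Lop:
  assumes T: "aleph0_regular_tree E" and x: "x \<in> ell1_set"
  shows "Lstar E e x t + Lop E e x t = (\<Sum>\<^sub>\<infinity>s\<in>{s. E s t}. x s)"
proof -
  have sm: "x summable_on B" for B
  proof (rule abs_summable_summable)
    have "(\<lambda>s. cmod (x s)) summable_on UNIV" using x by (simp add: ell1_set_def)
    then show "(\<lambda>s. cmod (x s)) summable_on B" by (rule summable_on_subset_banach) simp
  qed
  have L: "Lop E e x t = infsum x (children E e t)" by (simp add: Lop_def children_def)
  show ?thesis
  proof (cases "t = e")
    case True
    then show ?thesis using L neighbours_eq[OF T, of t e] by (simp add: Lstar_def)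
  next
    case False
    have "infsum x (children E e t \<union> {hat E e t}) = infsum x (children E e t) + infsum x {hat E e t}"
      using hat_not_child[OF T False] by (intro infsum_Un_disjoint sm) auto
    then show ?thesis using False by (simp add: L neighbours_eq[OF T, of t e] Lstar_def)
  qed
qed

lemma Lstar_add_Lop_lam:
  assumes T: "aleph0_regular_tree E" and x: "x \<in> ell1_set" and g: "g \<in> Aut E"
  shows "Lstar E e (lam g x) t + Lop E e (lam g x) t = lam g (Lstar E e x) t + lam g (Lop E e x) t"
proof -
  have "bij_betw (inv_into UNIV g) {s. E s t} {s. E s (inv_into UNIV g t)}"
  proof (rule bij_betwI[where g = g])
    show "inv_into UNIV g \<in> {s. E s t} \<rightarrow> {s. E s (inv_into UNIV g t)}"
      using Aut_inv[OF g] by (auto simp: Aut_def)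
    show "g \<in> {s. E s (inv_into UNIV g t)} \<rightarrow> {s. E s t}"
    proof
      fix s assume "s \<in> {s. E s (inv_into UNIV g t)}"
      then have "E (g s) (g (inv_into UNIV g t))" using g by (simp add: Aut_def)
      then show "g s \<in> {s. E s t}" by (simp add: Aut_inv_apply[OF g])
    qed
  qed (simp_all add: Aut_inv_apply[OF g])
  from infsum_reindex_bij_betw[OF this, of x] show ?thesis
    unfolding Lstar_add_Lop[OF T lam_ell1[OF g x]]
    by (simp add: lam_def Lstar_add_Lop[OF T x])
qed

section \<open>Bounded groups in the strong operator topology\<close>

lemma norm_compose_diff_le:
  fixes S :: "'a::real_normed_vector \<Rightarrow>\<^sub>L 'b::real_normed_vector"
  assumes "norm S \<le> K"
  shows "norm (blinfun_apply S y' - x) \<le> K * norm (y' - y) + norm (blinfun_apply S y - x)"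
proof -
  have "norm (blinfun_apply S y' - x) \<le> norm (blinfun_apply S (y' - y)) + norm (blinfun_apply S y - x)"
    using norm_triangle_ineq[of "blinfun_apply S (y' - y)" "blinfun_apply S y - x"]
    by (simp add: blinfun.diff_right)
  also have "norm (blinfun_apply S (y' - y)) \<le> K * norm (y' - y)"
    by (rule order_trans[OF norm_blinfun mult_right_mono[OF assms norm_ge_zero]])
  finally show ?thesis by simp
qed

text \<open>
  Evaluation is jointly continuous on bounded sets of operators, although not on all operators. This
  is why boundedness makes the strong operator topology a group topology.
\<close>

lemma tendsto_bounded_operators_apply:
  fixes S :: "'c \<Rightarrow> 'a::real_normed_vector \<Rightarrow>\<^sub>L 'b::real_normed_vector"
  assumes "\<forall>\<^sub>F i in F. norm (S i) \<le> K" "(y \<longlongrightarrow> y0) F" "((\<lambda>i. blinfun_apply (S i) y0) \<longlongrightarrow> x) F"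
  shows "((\<lambda>i. blinfun_apply (S i) (y i)) \<longlongrightarrow> x) F"
proof (rule LIM_zero_cancel, rule Lim_null_comparison)
  show "\<forall>\<^sub>F i in F. norm (blinfun_apply (S i) (y i) - x) \<le>
      K * norm (y i - y0) + norm (blinfun_apply (S i) y0 - x)"
    using assms(1) by (rule eventually_mono) (rule norm_compose_diff_le)
  have "((\<lambda>i. K * norm (y i - y0) + norm (blinfun_apply (S i) y0 - x)) \<longlongrightarrow>
      K * norm (y0 - y0) + norm (x - x)) F"
    by (intro tendsto_intros assms)
  then show "((\<lambda>i. K * norm (y i - y0) + norm (blinfun_apply (S i) y0 - x)) \<longlongrightarrow> 0) F" by simp
qed

text \<open>
  The neighbourhoods of the identity in the topology on \<open>G\<close> pulled back along \<open>f\<close> from the strong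
  operator topology.
\<close>

definition corner_filter ::
    "(('a::real_normed_vector \<Rightarrow>\<^sub>L 'a) \<Rightarrow> ('b::real_normed_vector \<Rightarrow>\<^sub>L 'b)) \<Rightarrow> ('a \<Rightarrow>\<^sub>L 'a) set \<Rightarrow> ('a \<Rightarrow>\<^sub>L 'a) filter"
  where "corner_filter f G = inf (INF x. filtercomap (\<lambda>S. blinfun_apply (f S) x) (nhds x)) (principal G)"

lemma filterlim_corner_filter:
  "filterlim h (corner_filter f G) F \<longleftrightarrow>
    (\<forall>x. ((\<lambda>i. blinfun_apply (f (h i)) x) \<longlongrightarrow> x) F) \<and> (\<forall>\<^sub>F i in F. h i \<in> G)"
  by (simp add: corner_filter_def filterlim_inf filterlim_INF filterlim_filtercomap_iff
      filterlim_principal o_def)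

lemma corner_filter_tendsto: "((\<lambda>S. blinfun_apply (f S) x) \<longlongrightarrow> x) (corner_filter f G)"
  and eventually_corner_filter: "\<forall>\<^sub>F S in corner_filter f G. S \<in> G"
  using filterlim_ident[of "corner_filter f G"] unfolding filterlim_corner_filter by auto

text \<open>
  In the topology pulled back along \<open>f\<close>, multiplication is continuous at the identity because \<open>f\<close> maps
  \<open>G\<close> to a bounded set of operators. Conjugation by an element of \<open>G\<close> becomes conjugation by a fixed operator.
\<close>

lemma (in bounded_operator_group) normal_corner_filter:
  assumes id: "f id_blinfun = id_blinfun"
    and mult: "\<And>S T. S \<in> G \<Longrightarrow> T \<in> G \<Longrightarrow> f (S o\<^sub>L T) = f S o\<^sub>L f T"
    and le: "\<And>S. norm (f S) \<le> norm S"
  shows "normal_operator_filter G (corner_filter f G)"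
proof
  let ?F = "corner_filter f G"
  show "\<forall>\<^sub>F S in ?F. S \<in> G" by (rule eventually_corner_filter)
  \<comment> \<open>The identity belongs to every member of the filter.\<close>
  have "filterlim (\<lambda>_. id_blinfun) ?F (principal {()})"
    unfolding filterlim_corner_filter by (simp add: id id_mem)
  then show "?F \<noteq> bot"
    by (metis filtermap_bot_iff filterlim_def le_bot principal_eq_bot_iff insert_not_empty)
  have K: "norm (f S) \<le> group_bound" if "S \<in> G" for S using le[of S] group_bound(2)[OF that] by linarith
  show "\<exists>Q'. eventually Q' ?F \<and> (\<forall>S T. Q' S \<longrightarrow> Q' T \<longrightarrow> Q (S o\<^sub>L T))" if Q: "eventually Q ?F" for Q
  proof -
    have fst: "filterlim fst ?F (?F \<times>\<^sub>F ?F)" and snd: "filterlim snd ?F (?F \<times>\<^sub>F ?F)"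
      by (rule filterlim_fst, rule filterlim_snd)
    have ev: "\<forall>\<^sub>F p in ?F \<times>\<^sub>F ?F. fst p \<in> G" "\<forall>\<^sub>F p in ?F \<times>\<^sub>F ?F. snd p \<in> G"
      using fst snd by (simp_all add: filterlim_corner_filter)
    have "filterlim (\<lambda>p. fst p o\<^sub>L snd p) ?F (?F \<times>\<^sub>F ?F)"
      unfolding filterlim_corner_filter
    proof (intro conjI allI)
      show "\<forall>\<^sub>F p in ?F \<times>\<^sub>F ?F. fst p o\<^sub>L snd p \<in> G"
        using ev by eventually_elim (rule compose_mem)
      fix x
      have "((\<lambda>p. blinfun_apply (f (fst p)) (blinfun_apply (f (snd p)) x)) \<longlongrightarrow> x) (?F \<times>\<^sub>F ?F)"
      proof (rule tendsto_bounded_operators_apply[where K = group_bound and ?y0.0 = x])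
        show "\<forall>\<^sub>F p in ?F \<times>\<^sub>F ?F. norm (f (fst p)) \<le> group_bound"
          using ev(1) by eventually_elim (rule K)
      qed (use fst snd in \<open>simp_all add: filterlim_corner_filter\<close>)
      also have "?this \<longleftrightarrow> ((\<lambda>p. blinfun_apply (f (fst p o\<^sub>L snd p)) x) \<longlongrightarrow> x) (?F \<times>\<^sub>F ?F)"
        by (rule tendsto_cong) (use ev in \<open>eventually_elim, simp add: mult\<close>)
      finally show "((\<lambda>p. blinfun_apply (f (fst p o\<^sub>L snd p)) x) \<longlongrightarrow> x) (?F \<times>\<^sub>F ?F)" .
    qed
    then have "eventually (\<lambda>p. Q (fst p o\<^sub>L snd p)) (?F \<times>\<^sub>F ?F)"
      using Q by (simp add: filterlim_iff)
    then show ?thesis unfolding eventually_prod_same by simp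
  qed
  show "filterlim (\<lambda>S. R o\<^sub>L S o\<^sub>L T) ?F ?F"
    if TR: "T \<in> G" "R \<in> G" "R o\<^sub>L T = id_blinfun" "T o\<^sub>L R = id_blinfun" for T R
    unfolding filterlim_corner_filter
  proof (intro conjI allI)
    note ev = eventually_corner_filter[of G f]
    show "\<forall>\<^sub>F S in ?F. R o\<^sub>L S o\<^sub>L T \<in> G"
      using ev by eventually_elim (intro compose_mem TR)
    fix x
    have "((\<lambda>S. blinfun_apply (f R) (blinfun_apply (f S) (blinfun_apply (f T) x)))
        \<longlongrightarrow> blinfun_apply (f R) (blinfun_apply (f T) x)) ?F"
      by (intro tendsto_intros corner_filter_tendsto)
    also have "blinfun_apply (f R) (blinfun_apply (f T) x) = x"
      using mult[OF TR(2,1)] by (simp add: TR(3) id flip: blinfun_apply_blinfun_compose)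
    also have "((\<lambda>S. blinfun_apply (f R) (blinfun_apply (f S) (blinfun_apply (f T) x))) \<longlongrightarrow> x) ?F \<longleftrightarrow>
        ((\<lambda>S. blinfun_apply (f (R o\<^sub>L S o\<^sub>L T)) x) \<longlongrightarrow> x) ?F"
      by (rule tendsto_cong) (use ev in \<open>eventually_elim, simp add: mult compose_mem TR\<close>)
    finally show "((\<lambda>S. blinfun_apply (f (R o\<^sub>L S o\<^sub>L T)) x) \<longlongrightarrow> x) ?F" .
  qed
qed

lemma continuous_map_euclidean_iff_tendsto:
  "continuous_map X euclidean h \<longleftrightarrow> (\<forall>a\<in>topspace X. (h \<longlongrightarrow> h a) (atin X a))"
  by (simp add: continuous_map_atin)

lemma eventually_atin_topspace: "\<forall>\<^sub>F b in atin X a. b \<in> topspace X"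
  by (auto simp: eventually_atin intro!: exI[of _ "topspace X"])

lemma continuous_map_SOT_evaluation:
  "continuous_map (subtopology strong_operator_topology H) euclidean (\<lambda>a. blinfun_apply a x)"
  by (rule continuous_map_from_subtopology[OF strong_operator_topology_continuous_evaluation])

lemma continuous_map_into_SOT_subtopology:
  assumes "\<And>x. continuous_map X euclidean (\<lambda>a. blinfun_apply (h a) x)" "\<And>a. a \<in> topspace X \<Longrightarrow> h a \<in> H"
  shows "continuous_map X (subtopology strong_operator_topology H) h"
  using assms by (auto simp: continuous_map_in_subtopology continuous_on_strong_operator_topo_iff_coordinatewise)

lemma topspace_SOT_subtopology: "topspace (subtopology strong_operator_topology H) = H"
  by (simp add: strong_operator_topology_topspace)

lemma tendsto_SOT_evaluation:
  assumes "a \<in> H"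
  shows "((\<lambda>b. blinfun_apply b x) \<longlongrightarrow> blinfun_apply a x) (atin (subtopology strong_operator_topology H) a)"
  using continuous_map_SOT_evaluation[of H x] assms
  unfolding continuous_map_euclidean_iff_tendsto topspace_SOT_subtopology by blast

lemma GL_simps: "a \<otimes>\<^bsub>GL\<^esub> b = a o\<^sub>L b" "\<one>\<^bsub>GL\<^esub> = id_blinfun"
  "a \<otimes>\<^bsub>GL\<lparr>carrier := H\<rparr>\<^esub> b = a o\<^sub>L b"
  by (simp_all add: GL_def)

lemma inv_GL:
  assumes "a \<in> carrier GL"
  shows "inv\<^bsub>GL\<^esub> a o\<^sub>L a = id_blinfun" "a o\<^sub>L inv\<^bsub>GL\<^esub> a = id_blinfun"
  using group.l_inv[OF group_GL assms] group.r_inv[OF group_GL assms] by (simp_all add: GL_simps)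

lemma inv_GL_apply:
  assumes "a \<in> carrier GL"
  shows "blinfun_apply (inv\<^bsub>GL\<^esub> a) (blinfun_apply a x) = x" "blinfun_apply a (blinfun_apply (inv\<^bsub>GL\<^esub> a) x) = x"
  using inv_GL[OF assms] by (metis blinfun_apply_blinfun_compose blinfun_apply_id_blinfun)+

text \<open>
  The inverse is continuous since
  \<open>b\<^sup>-\<^sup>1 x - a\<^sup>-\<^sup>1 x = b\<^sup>-\<^sup>1 (a - b) a\<^sup>-\<^sup>1 x\<close> and the inverses of the members of \<open>H\<close> are bounded.
\<close>

lemma topological_group_SOT:
  assumes H: "subgroup H GL" and bdd: "bounded H"
  shows "topological_group (GL\<lparr>carrier := H\<rparr>) (subtopology strong_operator_topology H)"
proof -
  let ?X = "subtopology strong_operator_topology H"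
  interpret group GL by (rule group_GL)
  interpret subgroup H GL by (rule H)
  obtain K where K: "\<And>a. a \<in> H \<Longrightarrow> norm a \<le> K" using bdd by (auto simp: bounded_iff)
  have X: "topspace ?X = H" by (rule topspace_SOT_subtopology)
  have inv_eq: "inv\<^bsub>GL\<lparr>carrier := H\<rparr>\<^esub> a = inv\<^bsub>GL\<^esub> a" if "a \<in> H" for a
    using m_inv_consistent[OF H that] .
  have inv_mem: "inv\<^bsub>GL\<^esub> a \<in> H" if "a \<in> H" for a using that by simp
  have mult: "continuous_map (prod_topology ?X ?X) ?X (\<lambda>(a, b). a o\<^sub>L b)"
  proof (rule continuous_map_into_SOT_subtopology)
    let ?P = "prod_topology ?X ?X"
    show "(case p of (a, b) \<Rightarrow> a o\<^sub>L b) \<in> H" if "p \<in> topspace ?P" for p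
      using that m_closed by (auto simp: X GL_simps)
    fix x
    have ev: "continuous_map ?P euclidean (\<lambda>p. blinfun_apply (fst p) y)"
      "continuous_map ?P euclidean (\<lambda>p. blinfun_apply (snd p) y)" for y
      using continuous_map_compose[OF continuous_map_fst[of ?X ?X] continuous_map_SOT_evaluation[of H y]]
        continuous_map_compose[OF continuous_map_snd[of ?X ?X] continuous_map_SOT_evaluation[of H y]]
      by (simp_all add: o_def)
    show "continuous_map ?P euclidean (\<lambda>p. blinfun_apply (case p of (a, b) \<Rightarrow> a o\<^sub>L b) x)"
      unfolding continuous_map_euclidean_iff_tendsto case_prod_beta blinfun_apply_blinfun_compose
    proof
      fix p assume p: "p \<in> topspace ?P"
      show "((\<lambda>q. blinfun_apply (fst q) (blinfun_apply (snd q) x)) \<longlongrightarrow>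
          blinfun_apply (fst p) (blinfun_apply (snd p) x)) (atin ?P p)"
      proof (rule tendsto_bounded_operators_apply)
        show "\<forall>\<^sub>F q in atin ?P p. norm (fst q) \<le> K"
          using eventually_atin_topspace[of ?P p] by (rule eventually_mono) (auto simp: X K)
        show "((\<lambda>q. blinfun_apply (snd q) x) \<longlongrightarrow> blinfun_apply (snd p) x) (atin ?P p)"
          using ev(2)[of x] p unfolding continuous_map_euclidean_iff_tendsto by blast
        show "((\<lambda>q. blinfun_apply (fst q) (blinfun_apply (snd p) x)) \<longlongrightarrow>
            blinfun_apply (fst p) (blinfun_apply (snd p) x)) (atin ?P p)"
          using ev(1)[of "blinfun_apply (snd p) x"] p unfolding continuous_map_euclidean_iff_tendsto by blast
      qed
    qed
  qed
  have inv: "continuous_map ?X ?X (\<lambda>a. inv\<^bsub>GL\<lparr>carrier := H\<rparr>\<^esub> a)"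
  proof (rule continuous_map_into_SOT_subtopology)
    show "inv\<^bsub>GL\<lparr>carrier := H\<rparr>\<^esub> a \<in> H" if "a \<in> topspace ?X" for a
      using that inv_eq inv_mem X by metis
    fix x
    show "continuous_map ?X euclidean (\<lambda>a. blinfun_apply (inv\<^bsub>GL\<lparr>carrier := H\<rparr>\<^esub> a) x)"
      unfolding continuous_map_euclidean_iff_tendsto X
    proof
      fix a assume a: "a \<in> H"
      have mem: "\<forall>\<^sub>F b in atin ?X a. b \<in> H" using eventually_atin_topspace[of ?X a] by (simp only: X)
      let ?y = "blinfun_apply (inv\<^bsub>GL\<^esub> a) x"
      show "((\<lambda>b. blinfun_apply (inv\<^bsub>GL\<lparr>carrier := H\<rparr>\<^esub> b) x) \<longlongrightarrow>
          blinfun_apply (inv\<^bsub>GL\<lparr>carrier := H\<rparr>\<^esub> a) x) (atin ?X a)"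
      proof (rule LIM_zero_cancel, rule Lim_null_comparison)
        show "\<forall>\<^sub>F b in atin ?X a. norm (blinfun_apply (inv\<^bsub>GL\<lparr>carrier := H\<rparr>\<^esub> b) x -
            blinfun_apply (inv\<^bsub>GL\<lparr>carrier := H\<rparr>\<^esub> a) x) \<le> K * norm (blinfun_apply a ?y - blinfun_apply b ?y)"
          using mem
        proof eventually_elim
          fix b assume b: "b \<in> H"
          have "blinfun_apply (inv\<^bsub>GL\<^esub> b) (blinfun_apply a ?y - blinfun_apply b ?y) =
              blinfun_apply (inv\<^bsub>GL\<^esub> b) x - ?y"
            using inv_GL_apply(2)[of a x] inv_GL_apply(1)[of b ?y] a b by (simp add: blinfun.diff_right)
          moreover have "norm (blinfun_apply (inv\<^bsub>GL\<^esub> b) (blinfun_apply a ?y - blinfun_apply b ?y)) \<le>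
              K * norm (blinfun_apply a ?y - blinfun_apply b ?y)"
            by (rule order_trans[OF norm_blinfun mult_right_mono[OF K[OF inv_mem[OF b]] norm_ge_zero]])
          ultimately show "norm (blinfun_apply (inv\<^bsub>GL\<lparr>carrier := H\<rparr>\<^esub> b) x -
              blinfun_apply (inv\<^bsub>GL\<lparr>carrier := H\<rparr>\<^esub> a) x) \<le> K * norm (blinfun_apply a ?y - blinfun_apply b ?y)"
            by (simp add: inv_eq a b)
        qed
        have "((\<lambda>b. blinfun_apply b ?y) \<longlongrightarrow> blinfun_apply a ?y) (atin ?X a)"
          by (rule tendsto_SOT_evaluation[OF a])
        then have "((\<lambda>b. K * norm (blinfun_apply a ?y - blinfun_apply b ?y)) \<longlongrightarrow>
            K * norm (blinfun_apply a ?y - blinfun_apply a ?y)) (atin ?X a)"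
          by (intro tendsto_mult tendsto_norm tendsto_diff tendsto_const)
        then show "((\<lambda>b. K * norm (blinfun_apply a ?y - blinfun_apply b ?y)) \<longlongrightarrow> 0) (atin ?X a)" by simp
      qed
    qed
  qed
  show ?thesis
    unfolding topological_group_def GL_simps
    using subgroup_is_group[OF is_group] mult inv by (simp add: strong_operator_topology_topspace)
qed

text \<open>
  By homogeneity of groups it is enough to look at the identity: the last assumption says that \<open>S\<close> is close
  to the identity whenever \<open>f S\<close> is. An element of the kernel lies in every such neighbourhood, so the
  same assumption gives injectivity.
\<close>

lemma SOT_iso_onto_imageI:
  fixes G :: "('a::complex_normed_vector \<Rightarrow>\<^sub>L 'a) set"
    and f :: "('a \<Rightarrow>\<^sub>L 'a) \<Rightarrow> ('b::complex_normed_vector \<Rightarrow>\<^sub>L 'b)"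
  assumes G: "subgroup G GL" and bdd: "bounded G"
    and GL: "\<And>S. S \<in> G \<Longrightarrow> f S \<in> carrier GL"
    and id: "f id_blinfun = id_blinfun"
    and mult: "\<And>S T. S \<in> G \<Longrightarrow> T \<in> G \<Longrightarrow> f (S o\<^sub>L T) = f S o\<^sub>L f T"
    and le: "\<And>S. norm (f S) \<le> norm S"
    and cont: "\<And>x. continuous_map strong_operator_topology euclidean (\<lambda>S. blinfun_apply (f S) x)"
    and lim: "\<And>z. ((\<lambda>S. blinfun_apply S z) \<longlongrightarrow> z) (corner_filter f G)"
  shows "SOT_iso_onto_image G f"
proof -
  interpret group "GL :: ('a \<Rightarrow>\<^sub>L 'a) monoid" by (rule group_GL)
  interpret subgroup G GL by (rule G)
  interpret B: group "GL :: ('b \<Rightarrow>\<^sub>L 'b) monoid" by (rule group_GL)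
  let ?X = "subtopology strong_operator_topology G" and ?Y = "subtopology strong_operator_topology (f ` G)"
  have X: "topspace ?X = G" and Y: "topspace ?Y = f ` G" by (rule topspace_SOT_subtopology)+
  have inv_mem: "inv\<^bsub>GL\<^esub> S \<in> G" if "S \<in> G" for S using that by simp
  have f_inv: "f (inv\<^bsub>GL\<^esub> S) o\<^sub>L f S = id_blinfun" if "S \<in> G" for S
    using mult[OF inv_mem[OF that] that] inv_GL(1)[of S] that id by simp
  have inv_f: "inv\<^bsub>GL\<^esub> (f S) = f (inv\<^bsub>GL\<^esub> S)" if "S \<in> G" for S
    using B.inv_equality[OF _ GL[OF that] GL[OF inv_mem[OF that]]] f_inv[OF that] by (simp add: GL_simps)
  have fG: "subgroup (f ` G) GL"
  proof
    show "f ` G \<subseteq> carrier GL" using GL by blast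
    show "a \<otimes>\<^bsub>GL\<^esub> b \<in> f ` G" if ab: "a \<in> f ` G" "b \<in> f ` G" for a b
    proof -
      obtain S T where "S \<in> G" "T \<in> G" "a = f S" "b = f T" using ab by blast
      then show ?thesis using m_closed[of S T] by (auto simp: GL_simps mult[symmetric])
    qed
    show "\<one>\<^bsub>GL\<^esub> \<in> f ` G" using one_closed id by (metis GL_simps(2) imageI)
    show "inv\<^bsub>GL\<^esub> a \<in> f ` G" if "a \<in> f ` G" for a
      using that inv_f inv_mem by force
  qed
  have fbdd: "bounded (f ` G)"
  proof -
    obtain K where "\<forall>S\<in>G. norm S \<le> K" using bdd by (auto simp: bounded_iff)
    then show ?thesis by (auto simp: bounded_iff intro!: exI[of _ K] order_trans[OF le])
  qed
  note lim_iff = filterlim_corner_filter[of _ f G]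
  have inj: "S = S'" if S: "S \<in> G" "S' \<in> G" "f S = f S'" for S S'
  proof (rule blinfun_eqI)
    fix z
    let ?R = "inv\<^bsub>GL\<^esub> S o\<^sub>L S'"
    have "?R \<in> G" using m_closed[OF inv_mem[OF S(1)] S(2)] by (simp add: GL_simps)
    moreover have "f ?R = id_blinfun" using mult[OF inv_mem[OF S(1)] S(2)] f_inv[OF S(1)] S(3) by simp
    ultimately have "filterlim (\<lambda>_. ?R) (corner_filter f G) (principal {()})" by (simp add: lim_iff)
    from filterlim_compose[OF lim[of z] this]
    have "((\<lambda>_. blinfun_apply ?R z) \<longlongrightarrow> z) (principal {()})" .
    then have "blinfun_apply ?R z = z"
      by (metis tendsto_unique tendsto_const principal_eq_bot_iff insert_not_empty)
    then have "blinfun_apply S (blinfun_apply (inv\<^bsub>GL\<^esub> S) (blinfun_apply S' z)) = blinfun_apply S z" by simp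
    then show "blinfun_apply S z = blinfun_apply S' z" using S(1) by (simp add: inv_GL_apply)
  qed
  then have inj_on: "inj_on f G" by (auto intro: inj_onI)
  let ?g = "inv_into G f"
  have g: "?g (f S) = S" if "S \<in> G" for S using inv_into_f_f[OF inj_on that] .
  have g_mem: "?g a \<in> G" if "a \<in> f ` G" for a using inv_into_into[OF that] .
  have fg: "f (?g a) = a" if "a \<in> f ` G" for a using f_inv_into_f[OF that] .
  have contf: "continuous_map ?X ?Y f"
    by (rule continuous_map_into_SOT_subtopology) (auto simp: X intro: continuous_map_from_subtopology cont)
  have contg: "continuous_map ?Y ?X ?g"
  proof (rule continuous_map_into_SOT_subtopology)
    show "?g a \<in> G" if "a \<in> topspace ?Y" for a using that g_mem Y by simp
    fix z
    show "continuous_map ?Y euclidean (\<lambda>a. blinfun_apply (?g a) z)"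
      unfolding continuous_map_euclidean_iff_tendsto Y
    proof
      fix a assume a: "a \<in> f ` G"
      define S where "S = ?g a"
      have S: "S \<in> G" "f S = a" using g_mem[OF a] fg[OF a] by (simp_all add: S_def)
      let ?R = "inv\<^bsub>GL\<^esub> S"
      have mem: "\<forall>\<^sub>F b in atin ?Y a. b \<in> f ` G" using eventually_atin_topspace[of ?Y a] by (simp only: Y)
      \<comment> \<open>As \<open>b\<close> tends to \<open>a = f S\<close>, the image of \<open>S\<^sup>-\<^sup>1 (?g b)\<close> under \<open>f\<close> tends to the identity.\<close>
      have "filterlim (\<lambda>b. ?R o\<^sub>L ?g b) (corner_filter f G) (atin ?Y a)"
        unfolding lim_iff
      proof (intro conjI allI)
        show "\<forall>\<^sub>F b in atin ?Y a. ?R o\<^sub>L ?g b \<in> G"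
          using mem by eventually_elim (use m_closed[OF inv_mem[OF S(1)] g_mem] in \<open>simp add: GL_simps\<close>)
        fix x
        have "((\<lambda>b. blinfun_apply b x) \<longlongrightarrow> blinfun_apply a x) (atin ?Y a)"
          by (rule tendsto_SOT_evaluation[OF a])
        then have "((\<lambda>b. blinfun_apply (f ?R) (blinfun_apply b x)) \<longlongrightarrow>
            blinfun_apply (f ?R) (blinfun_apply a x)) (atin ?Y a)"
          by (rule blinfun.tendsto[OF tendsto_const])
        also have "blinfun_apply (f ?R) (blinfun_apply a x) = x"
          using f_inv[OF S(1)] S(2) by (metis blinfun_apply_blinfun_compose blinfun_apply_id_blinfun)
        also have "((\<lambda>b. blinfun_apply (f ?R) (blinfun_apply b x)) \<longlongrightarrow> x) (atin ?Y a) \<longleftrightarrow>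
            ((\<lambda>b. blinfun_apply (f (?R o\<^sub>L ?g b)) x) \<longlongrightarrow> x) (atin ?Y a)"
          by (rule tendsto_cong) (use mem in \<open>eventually_elim, simp add: mult inv_mem S g_mem fg\<close>)
        finally show "((\<lambda>b. blinfun_apply (f (?R o\<^sub>L ?g b)) x) \<longlongrightarrow> x) (atin ?Y a)" .
      qed
      from filterlim_compose[OF lim[of z] this]
      have "((\<lambda>b. blinfun_apply S (blinfun_apply (?R o\<^sub>L ?g b) z)) \<longlongrightarrow> blinfun_apply S z) (atin ?Y a)"
        by (intro tendsto_intros)
      then show "((\<lambda>b. blinfun_apply (?g b) z) \<longlongrightarrow> blinfun_apply (?g a) z) (atin ?Y a)"
        using S(1) by (simp add: inv_GL_apply S_def[symmetric])
    qed
  qed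
  have "homeomorphic_maps ?X ?Y f ?g"
    unfolding homeomorphic_maps_def using contf contg g fg by (simp add: strong_operator_topology_topspace)
  then have "homeomorphic_map ?X ?Y f" using homeomorphic_map_maps by blast
  moreover have "f \<in> iso (GL\<lparr>carrier := G\<rparr>) (GL\<lparr>carrier := f ` G\<rparr>)"
    using inj_on by (auto simp: iso_def hom_def bij_betw_def GL_simps mult)
  ultimately show ?thesis
    unfolding SOT_iso_onto_image_def topological_group_iso_def
    using topological_group_SOT[OF G bdd] topological_group_SOT[OF fG fbdd] GL by blast
qed

section \<open>Bounded extensions of the derivation representation\<close>

lemma tendsto_scaleC:
  fixes h :: "'c \<Rightarrow> 'a::complex_normed_vector"
  assumes "(h \<longlongrightarrow> l) F"
  shows "((\<lambda>i. c *\<^sub>C h i) \<longlongrightarrow> c *\<^sub>C l) F"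
proof (rule bounded_linear.tendsto[OF _ assms], rule bounded_linear_intro)
  show "c *\<^sub>C (r *\<^sub>R x) = r *\<^sub>R (c *\<^sub>C x)" for r and x :: 'a
    by (simp add: scaleC_of_real[symmetric] scaleC_scaleC mult.commute)
  show "norm (c *\<^sub>C x) \<le> norm x * cmod c" for x :: 'a
    by (simp add: norm_scaleC mult.commute)
qed (rule scaleC_add_right)

lemma scaleC_zero_right: "c *\<^sub>C (0::'a::complex_normed_vector) = 0"
  using scaleC_scaleC[of c 0 "0::'a"] scaleC_of_real[of 0 "0::'a"] by simp

text \<open>
  The hypotheses of the theorem. In matrix form, an element \<open>S\<close> of \<open>G\<close> has the rows \<open>(u, w)\<close> and \<open>(0, v)\<close>
  with \<open>u = upper_left S\<close>, \<open>v = lower_right S\<close> and \<open>w y = fst (S (0, y))\<close>.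
\<close>

locale bounded_extension =
  fixes E :: "'v \<Rightarrow> 'v \<Rightarrow> bool" and e :: 'v
    and G :: "(('v ell2 \<times> 'v ell2) \<Rightarrow>\<^sub>L ('v ell2 \<times> 'v ell2)) set"
  assumes tree: "aleph0_regular_tree E"
    and subgroup: "subgroup G GL"
    and bounded: "bounded G"
    and invariant: "\<forall>S\<in>G. blinfun_apply S ` (UNIV \<times> {0}) \<subseteq> UNIV \<times> {0}"
    and contains: "lambda_d E e ` Aut E \<subseteq> G"
begin

lemma mem_GL: "S \<in> G \<Longrightarrow> S \<in> carrier GL"
  using subgroup.subset[OF subgroup] by blast

sublocale bounded_operator_group G
proof
  show "id_blinfun \<in> G" using subgroup.one_closed[OF subgroup] by (simp add: GL_simps)
  show "S o\<^sub>L T \<in> G" if "S \<in> G" "T \<in> G" for S T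
    using subgroup.m_closed[OF subgroup that] by (simp add: GL_simps)
  show "\<exists>R\<in>G. R o\<^sub>L S = id_blinfun \<and> S o\<^sub>L R = id_blinfun" if "S \<in> G" for S
    using subgroup.m_inv_closed[OF subgroup that] inv_GL[OF mem_GL[OF that]] by blast
qed (rule bounded)

lemma apply_scaleC: "S \<in> G \<Longrightarrow> blinfun_apply S (c *\<^sub>C z) = c *\<^sub>C blinfun_apply S z"
  using mem_GL[of S] by (cases z) (simp add: GL_def homogeneous_def)

lemma apply_upper:
  assumes "S \<in> G"
  shows "blinfun_apply S (x, 0) = (blinfun_apply (upper_left S) x, 0)"
proof -
  have "blinfun_apply S (x, 0) \<in> UNIV \<times> {0}" using invariant assms by blast
  then show ?thesis by (auto simp: blinfun_apply_upper_left prod_eq_iff)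
qed

lemma apply_decompose:
  assumes "S \<in> G"
  shows "blinfun_apply S (x, y) =
    (blinfun_apply (upper_left S) x + fst (blinfun_apply S (0, y)), blinfun_apply (lower_right S) y)"
proof -
  have "(x, y) = (x, 0) + (0, y)" by simp
  then have "blinfun_apply S (x, y) = blinfun_apply S (x, 0) + blinfun_apply S (0, y)"
    by (metis blinfun.add_right)
  also have "\<dots> = (blinfun_apply (upper_left S) x, 0) + blinfun_apply S (0, y)"
    by (simp only: apply_upper[OF assms])
  also have "\<dots> = (blinfun_apply (upper_left S) x + fst (blinfun_apply S (0, y)), blinfun_apply (lower_right S) y)"
    unfolding blinfun_apply_lower_right by (cases "blinfun_apply S (0, y)") simp
  finally show ?thesis .
qed

lemma snd_apply: "S \<in> G \<Longrightarrow> snd (blinfun_apply S z) = blinfun_apply (lower_right S) (snd z)"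
  using apply_decompose[of S "fst z" "snd z"] by simp

lemma lambda_d_apply:
  "g \<in> Aut E \<Longrightarrow> blinfun_apply (lambda_d E e g) (x, y) = (lam2 g x + deriv_op E e g y, lam2 g y)"
  by (simp add: blinfun_apply_lambda_d[OF tree] upper_triangular_def)

lemma lambda_d_mem: "g \<in> Aut E \<Longrightarrow> lambda_d E e g \<in> G"
  using contains by blast

lemma upper_left_id: "upper_left id_blinfun = id_blinfun"
  and lower_right_id: "lower_right id_blinfun = id_blinfun"
  by (rule blinfun_eqI, simp add: blinfun_apply_upper_left blinfun_apply_lower_right)+

lemma upper_left_compose: "S \<in> G \<Longrightarrow> T \<in> G \<Longrightarrow> upper_left (S o\<^sub>L T) = upper_left S o\<^sub>L upper_left T"
  by (rule blinfun_eqI) (simp add: blinfun_apply_upper_left[of "S o\<^sub>L T"] apply_upper)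

lemma lower_right_compose: "S \<in> G \<Longrightarrow> T \<in> G \<Longrightarrow> lower_right (S o\<^sub>L T) = lower_right S o\<^sub>L lower_right T"
  by (rule blinfun_eqI) (simp add: blinfun_apply_lower_right[of "S o\<^sub>L T"] snd_apply)

lemma norm_corner_le: "norm (upper_left S) \<le> norm S" "norm (lower_right S) \<le> norm S"
proof -
  show "norm (upper_left S) \<le> norm S"
  proof (rule norm_blinfun_bound)
    show "norm (upper_left S x) \<le> norm S * norm x" for x
      using norm_fst_le[of "fst (blinfun_apply S (x, 0))" "snd (blinfun_apply S (x, 0))"] norm_blinfun[of S "(x, 0)"]
      by (simp add: blinfun_apply_upper_left norm_Pair)
  qed simp
  show "norm (lower_right S) \<le> norm S"
  proof (rule norm_blinfun_bound)
    show "norm (lower_right S x) \<le> norm S * norm x" for x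
      using norm_snd_le[of "snd (blinfun_apply S (0, x))" "fst (blinfun_apply S (0, x))"] norm_blinfun[of S "(0, x)"]
      by (simp add: blinfun_apply_lower_right norm_Pair)
  qed simp
qed

lemma corner_mem_GL:
  assumes S: "S \<in> G"
  shows "upper_left S \<in> carrier GL" "lower_right S \<in> carrier GL"
proof -
  obtain R where R: "R \<in> G" "R o\<^sub>L S = id_blinfun" "S o\<^sub>L R = id_blinfun" using inverse_mem[OF S] by blast
  have "upper_left S (c *\<^sub>C x) = c *\<^sub>C upper_left S x" "lower_right S (c *\<^sub>C x) = c *\<^sub>C lower_right S x" for c x
    using apply_scaleC[OF S, of c "(x, 0)"] apply_scaleC[OF S, of c "(0, x)"]
    by (simp_all add: blinfun_apply_upper_left blinfun_apply_lower_right scaleC_prod_def scaleC_zero_right)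
  moreover have "upper_left S o\<^sub>L upper_left R = id_blinfun" "upper_left R o\<^sub>L upper_left S = id_blinfun"
    "lower_right S o\<^sub>L lower_right R = id_blinfun" "lower_right R o\<^sub>L lower_right S = id_blinfun"
    by (simp_all add: upper_left_compose[symmetric] lower_right_compose[symmetric] R S upper_left_id lower_right_id)
  ultimately show "upper_left S \<in> carrier GL" "lower_right S \<in> carrier GL"
    unfolding GL_def homogeneous_def by auto
qed

lemma invariant_subspace_trivial:
  fixes W :: "'v ell2 set"
  assumes "closed W" "\<And>x y. x \<in> W \<Longrightarrow> y \<in> W \<Longrightarrow> x + y \<in> W" "\<And>c x. x \<in> W \<Longrightarrow> c *\<^sub>C x \<in> W"
    "\<And>g x. g \<in> Aut E \<Longrightarrow> x \<in> W \<Longrightarrow> lam2 g x \<in> W"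
  shows "W \<subseteq> {0} \<or> W = UNIV"
  using invariant_subspace_UNIV[OF tree assms] by blast

lemma tendsto_apply_scaleC:
  assumes G: "\<forall>\<^sub>F S in F. S \<in> G" and z: "((\<lambda>S. blinfun_apply S z) \<longlongrightarrow> z) F"
  shows "((\<lambda>S. blinfun_apply S (c *\<^sub>C z)) \<longlongrightarrow> c *\<^sub>C z) F"
proof -
  have "((\<lambda>S. c *\<^sub>C blinfun_apply S z) \<longlongrightarrow> c *\<^sub>C z) F" by (rule tendsto_scaleC[OF z])
  also have "?this \<longleftrightarrow> ?thesis"
    by (rule tendsto_cong) (use G in \<open>eventually_elim, simp add: apply_scaleC\<close>)
  finally show ?thesis .
qed

text \<open>
  Let \<open>Y\<close> be the space of vectors fixed asymptotically as \<open>upper_left S\<close> tends to the identity. It contains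
  the first summand, so by irreducibility it is the first summand or everything. In the first
  case the equivariant projection onto \<open>Y\<close> is a bounded projection onto the first summand, and
  its kernel is the graph of a bounded \<open>\<theta>\<close> that would make the derivation inner.
\<close>

lemma tendsto_id_of_upper_left:
  "((\<lambda>S. blinfun_apply S z) \<longlongrightarrow> z) (corner_filter upper_left G)"
proof -
  let ?F = "corner_filter upper_left G"
  interpret normal_operator_filter G ?F
    by (rule normal_corner_filter) (simp_all add: upper_left_id upper_left_compose norm_corner_le)
  have upper: "asymptotically_fixed (x, 0)" for x
  proof -
    have "((\<lambda>S. (blinfun_apply (upper_left S) x, 0 :: 'v ell2)) \<longlongrightarrow> (x, 0)) ?F"
      by (intro tendsto_intros corner_filter_tendsto)
    also have "?this \<longleftrightarrow> ((\<lambda>S. blinfun_apply S (x, 0)) \<longlongrightarrow> (x, 0)) ?F"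
      by (rule tendsto_cong) (use eventually_mem in \<open>eventually_elim, simp add: apply_upper\<close>)
    finally show ?thesis unfolding asymptotically_fixed_def .
  qed
  have split: "asymptotically_fixed (x, y) \<longleftrightarrow> asymptotically_fixed (0, y)" for x y
    using asymptotically_fixed_add[OF upper[of x], of "(0, y)"]
      asymptotically_fixed_diff[OF _ upper[of x], of "(x, y)"] by auto
  \<comment> \<open>The image of the asymptotically fixed space in the quotient by the first summand.\<close>
  define W where "W = {y. asymptotically_fixed (0, y)}"
  have "W \<subseteq> {0} \<or> W = UNIV"
  proof (rule invariant_subspace_trivial)
    have "W = (\<lambda>y. (0, y)) -` {z. asymptotically_fixed z}" by (auto simp: W_def)
    also have "closed \<dots>"
      by (intro continuous_closed_vimage closed_asymptotically_fixed continuous_intros)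
    finally show "closed W" .
    show "x + y \<in> W" if "x \<in> W" "y \<in> W" for x y
      using that asymptotically_fixed_add[of "(0, x)" "(0, y)"] by (simp add: W_def)
    show "c *\<^sub>C x \<in> W" if "x \<in> W" for c x
      using tendsto_apply_scaleC[OF eventually_mem, of "(0, x)" c] that
      by (simp add: W_def asymptotically_fixed_def scaleC_prod_def scaleC_zero_right)
    show "lam2 g x \<in> W" if "g \<in> Aut E" "x \<in> W" for g x
      using asymptotically_fixed_apply[OF lambda_d_mem[OF that(1)], of "(0, x)"] that
      by (simp add: W_def lambda_d_apply split[of "_ + _"])
  qed
  then show ?thesis
  proof
    assume "W = UNIV"
    then show ?thesis using split[of "fst z" "snd z"] by (auto simp: W_def asymptotically_fixed_def)
  next
    assume W0: "W \<subseteq> {0}"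
    obtain P where P: "bounded_linear P" "\<And>z. asymptotically_fixed (P z)"
      "\<And>z. asymptotically_fixed z \<Longrightarrow> P z = z" "\<And>z. P z \<in> asymptotic_hull z"
      "\<And>T z. T \<in> G \<Longrightarrow> P (blinfun_apply T z) = blinfun_apply T (P z)"
      using equivariant_projection by metis
    interpret P: bounded_linear P by (rule P(1))
    define \<theta> where "\<theta> y = - fst (P (0, y))" for y
    have P_eq: "P (0, y) = (- \<theta> y, 0)" for y
      using P(2)[of "(0, y)"] W0 split[of "fst (P (0, y))" "snd (P (0, y))"]
      by (auto simp: \<theta>_def W_def prod_eq_iff)
    have "bounded_linear \<theta>"
      unfolding \<theta>_def
      by (intro bounded_linear_minus bounded_linear_fst[THEN bounded_linear_compose]
          bounded_linear_compose[OF P(1)] bounded_linear_Pair bounded_linear_zero bounded_linear_ident)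
    moreover have "\<theta> (lam2 g y) = lam2 g (\<theta> y) + deriv_op E e g y" if g: "g \<in> Aut E" for g y
    proof -
      interpret lam2: bounded_linear "lam2 g" by (rule lam2_bounded_linear(1)[OF g])
      interpret d: bounded_linear "deriv_op E e g" by (rule deriv_op(2)[OF tree g])
      have "P (deriv_op E e g y, lam2 g y) = P ((deriv_op E e g y, 0) + (0, lam2 g y))" by simp
      also have "\<dots> = (deriv_op E e g y - \<theta> (lam2 g y), 0)"
        unfolding P.add P_eq P(3)[OF upper] by simp
      finally have "(deriv_op E e g y - \<theta> (lam2 g y), 0) = P (blinfun_apply (lambda_d E e g) (0, y))"
        by (simp add: lambda_d_apply[OF g] lam2.zero)
      also have "\<dots> = (- lam2 g (\<theta> y), 0)"
        unfolding P(5)[OF lambda_d_mem[OF g]] P_eq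
        by (simp add: lambda_d_apply[OF g] lam2.zero lam2.neg d.zero)
      finally show ?thesis by (simp add: algebra_simps)
    qed
    ultimately show ?thesis using derivation_not_inner[OF tree, of \<theta> e] by blast
  qed
qed

text \<open>
  Now averaging changes only the first coordinate, because the second coordinates of \<open>S z\<close> already
  converge. So \<open>P z - z\<close> lies in the first summand. By irreducibility the asymptotically fixed space
  contains the first summand, and then every \<open>z\<close>, or meets it trivially. In the second case the
  asymptotically fixed space is an invariant complement, the graph of a bounded \<open>\<theta>\<close> that would make the
  derivation inner.
\<close>

lemma tendsto_id_of_lower_right:
  "((\<lambda>S. blinfun_apply S z) \<longlongrightarrow> z) (corner_filter lower_right G)"
proof -
  let ?F = "corner_filter lower_right G"
  interpret normal_operator_filter G ?F
    by (rule normal_corner_filter) (simp_all add: lower_right_id lower_right_compose norm_corner_le)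
  obtain P where P: "bounded_linear P" "\<And>z. asymptotically_fixed (P z)"
    "\<And>z. asymptotically_fixed z \<Longrightarrow> P z = z" "\<And>z. P z \<in> asymptotic_hull z"
    "\<And>T z. T \<in> G \<Longrightarrow> P (blinfun_apply T z) = blinfun_apply T (P z)"
    using equivariant_projection by metis
  interpret P: bounded_linear P by (rule P(1))
  have snd_P: "snd (P z) = snd z" for z
  proof -
    have "dist (snd z) (snd (P z)) \<le> 0 + \<epsilon>" if "0 < \<epsilon>" for \<epsilon>
    proof -
      let ?V = "{S \<in> G. dist (blinfun_apply (lower_right S) (snd z)) (snd z) < \<epsilon>}"
      have "\<forall>\<^sub>F S in ?F. dist (blinfun_apply (lower_right S) (snd z)) (snd z) < \<epsilon>"
        using corner_filter_tendsto that by (rule tendstoD)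
      with eventually_mem have "\<forall>\<^sub>F S in ?F. S \<in> ?V" by eventually_elim simp
      then have "P z \<in> orbit_hull ?V z" using P(4)[of z] by (simp add: asymptotic_hull_def)
      also have "\<dots> \<subseteq> snd -` cball (snd z) \<epsilon>"
        by (intro orbit_hull_least continuous_closed_vimage convex_linear_vimage)
          (auto simp: snd_apply dist_commute intro: linear_snd continuous_intros)
      finally show ?thesis by simp
    qed
    then have "dist (snd z) (snd (P z)) \<le> 0" by (rule field_le_epsilon)
    then show ?thesis by simp
  qed
  \<comment> \<open>The intersection of the asymptotically fixed space with the first summand.\<close>
  define W where "W = {x. asymptotically_fixed (x, 0)}"
  have "W \<subseteq> {0} \<or> W = UNIV"
  proof (rule invariant_subspace_trivial)
    have "W = (\<lambda>x. (x, 0)) -` {z. asymptotically_fixed z}" by (auto simp: W_def)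
    also have "closed \<dots>"
      by (intro continuous_closed_vimage closed_asymptotically_fixed continuous_intros)
    finally show "closed W" .
    show "x + y \<in> W" if "x \<in> W" "y \<in> W" for x y
      using that asymptotically_fixed_add[of "(x, 0)" "(y, 0)"] by (simp add: W_def)
    show "c *\<^sub>C x \<in> W" if "x \<in> W" for c x
      using tendsto_apply_scaleC[OF eventually_mem, of "(x, 0)" c] that
      by (simp add: W_def asymptotically_fixed_def scaleC_prod_def scaleC_zero_right)
    show "lam2 g x \<in> W" if g: "g \<in> Aut E" "x \<in> W" for g x
    proof -
      interpret lam2: bounded_linear "lam2 g" by (rule lam2_bounded_linear(1)[OF g(1)])
      interpret d: bounded_linear "deriv_op E e g" by (rule deriv_op(2)[OF tree g(1)])
      show ?thesis using asymptotically_fixed_apply[OF lambda_d_mem[OF g(1)], of "(x, 0)"] g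
        by (simp add: W_def lambda_d_apply lam2.zero d.zero)
    qed
  qed
  then show ?thesis
  proof
    assume "W = UNIV"
    then have "asymptotically_fixed (fst z - fst (P z), 0)" by (auto simp: W_def)
    from asymptotically_fixed_add[OF P(2)[of z] this] have "asymptotically_fixed z"
      using snd_P[of z] by (simp add: prod_eq_iff plus_prod_def)
    then show ?thesis by (simp add: asymptotically_fixed_def)
  next
    assume W0: "W \<subseteq> {0}"
    define \<theta> where "\<theta> y = fst (P (0, y))" for y
    have P_lower: "P (0, y) = (\<theta> y, y)" for y
      using snd_P[of "(0, y)"] by (simp add: \<theta>_def prod_eq_iff)
    have P_upper: "P (x, 0) = 0" for x
      using P(2)[of "(x, 0)"] snd_P[of "(x, 0)"] W0
      by (cases "P (x, 0)") (auto simp: W_def zero_prod_def)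
    have "bounded_linear \<theta>"
      unfolding \<theta>_def
      by (intro bounded_linear_fst[THEN bounded_linear_compose]
          bounded_linear_compose[OF P(1)] bounded_linear_Pair bounded_linear_zero bounded_linear_ident)
    moreover have "\<theta> (lam2 g y) = lam2 g (\<theta> y) + deriv_op E e g y" if g: "g \<in> Aut E" for g y
    proof -
      interpret lam2: bounded_linear "lam2 g" by (rule lam2_bounded_linear(1)[OF g])
      have "P (deriv_op E e g y, lam2 g y) = P ((deriv_op E e g y, 0) + (0, lam2 g y))" by simp
      also have "\<dots> = (\<theta> (lam2 g y), lam2 g y)"
        unfolding P.add P_lower P_upper by simp
      finally have "(\<theta> (lam2 g y), lam2 g y) = P (blinfun_apply (lambda_d E e g) (0, y))"
        by (simp add: lambda_d_apply[OF g] lam2.zero)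
      also have "\<dots> = (lam2 g (\<theta> y) + deriv_op E e g y, lam2 g y)"
        unfolding P(5)[OF lambda_d_mem[OF g]] P_lower by (simp add: lambda_d_apply[OF g])
      finally show ?thesis by simp
    qed
    ultimately show ?thesis using derivation_not_inner[OF tree, of \<theta> e] by blast
  qed
qed

lemma SOT_iso_corners: "SOT_iso_onto_image G upper_left" "SOT_iso_onto_image G lower_right"
proof -
  have "continuous_map strong_operator_topology euclidean (\<lambda>S. blinfun_apply (upper_left S) x)"
    "continuous_map strong_operator_topology euclidean (\<lambda>S. blinfun_apply (lower_right S) x)" for x :: "'v ell2"
  proof -
    have c: "continuous_map euclidean euclidean (fst :: 'v ell2 \<times> 'v ell2 \<Rightarrow> _)"
      "continuous_map euclidean euclidean (snd :: 'v ell2 \<times> 'v ell2 \<Rightarrow> _)"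
      by (auto intro: continuous_intros)
    show "continuous_map strong_operator_topology euclidean (\<lambda>S. blinfun_apply (upper_left S) x)"
      using continuous_map_compose[OF strong_operator_topology_continuous_evaluation c(1)]
      by (simp add: o_def blinfun_apply_upper_left)
    show "continuous_map strong_operator_topology euclidean (\<lambda>S. blinfun_apply (lower_right S) x)"
      using continuous_map_compose[OF strong_operator_topology_continuous_evaluation c(2)]
      by (simp add: o_def blinfun_apply_lower_right)
  qed
  note cont = this
  show "SOT_iso_onto_image G upper_left"
    by (rule SOT_iso_onto_imageI[OF subgroup bounded corner_mem_GL(1) upper_left_id upper_left_compose
          norm_corner_le(1) cont(1) tendsto_id_of_upper_left])
  show "SOT_iso_onto_image G lower_right"
    by (rule SOT_iso_onto_imageI[OF subgroup bounded corner_mem_GL(2) lower_right_id lower_right_compose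
          norm_corner_le(2) cont(2) tendsto_id_of_lower_right])
qed

lemma invariant_norm_scaleC: "invariant_norm (c *\<^sub>C z) = cmod c * invariant_norm z"
proof -
  have le: "invariant_norm (c *\<^sub>C z) \<le> cmod c * invariant_norm z" for c z
  proof (rule invariant_norm_leI)
    fix S assume S: "S \<in> G"
    show "norm (blinfun_apply S (c *\<^sub>C z)) \<le> cmod c * invariant_norm z"
      by (simp add: apply_scaleC[OF S] norm_scaleC mult_left_mono norm_apply_le_invariant_norm[OF S])
  qed
  show ?thesis
  proof (cases "c = 0")
    case True
    then show ?thesis using le[of 0 z] invariant_norm_nonneg[of "0 *\<^sub>C z"] by simp
  next
    case False
    have "z = inverse c *\<^sub>C (c *\<^sub>C z)"
      using False scaleC_of_real[of 1 z] by (simp add: scaleC_scaleC)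
    then have "invariant_norm z \<le> inverse (cmod c) * invariant_norm (c *\<^sub>C z)"
      using le[of "inverse c" "c *\<^sub>C z"] by (simp add: norm_inverse)
    then have "cmod c * invariant_norm z \<le> invariant_norm (c *\<^sub>C z)" using False by (simp add: field_simps)
    then show ?thesis using le[of c z] by simp
  qed
qed

lemma fibre_minimum:
  "\<exists>x. \<forall>x'. 2 * convexity_modulus * (norm (x' - x))\<^sup>2 \<le> (invariant_norm (x', y))\<^sup>2 - (invariant_norm (x, y))\<^sup>2"
proof -
  have "closed (UNIV \<times> {y})" "convex (UNIV \<times> {y})" "UNIV \<times> {y} \<noteq> {}"
    by (auto intro!: closed_Times convex_Times)
  from invariant_norm_minimum[OF this] obtain m :: "'v ell2 \<times> 'v ell2" where m: "m \<in> UNIV \<times> {y}"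
    "\<And>a. a \<in> UNIV \<times> {y} \<Longrightarrow> 2 * convexity_modulus * (norm (a - m))\<^sup>2 \<le> (invariant_norm a)\<^sup>2 - (invariant_norm m)\<^sup>2" by metis
  then obtain x where x: "m = (x, y)" by auto
  show ?thesis
    using m(2)[of "(x', y)" for x'] by (intro exI[of _ x] allI) (simp add: x norm_Pair)
qed

text \<open>
  The first coordinate of the point of least invariant norm in the fibre over \<open>y\<close>, the set of all
  pairs with second coordinate \<open>y\<close>.
\<close>

definition fibre_minimiser :: "'v ell2 \<Rightarrow> 'v ell2"
  where "fibre_minimiser y = (SOME x. \<forall>x'. 2 * convexity_modulus * (norm (x' - x))\<^sup>2 \<le> (invariant_norm (x', y))\<^sup>2 - (invariant_norm (x, y))\<^sup>2)"

lemma fibre_minimiser: "2 * convexity_modulus * (norm (x - fibre_minimiser y))\<^sup>2 \<le> (invariant_norm (x, y))\<^sup>2 - (invariant_norm (fibre_minimiser y, y))\<^sup>2"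
  using someI_ex[OF fibre_minimum[of y]] unfolding fibre_minimiser_def[symmetric] by blast

lemma invariant_norm_fibre_minimiser_le: "invariant_norm (fibre_minimiser y, y) \<le> invariant_norm (x, y)"
proof -
  have "0 \<le> 2 * convexity_modulus * (norm (x - fibre_minimiser y))\<^sup>2" using convexity_modulus_pos by simp
  then have "(invariant_norm (fibre_minimiser y, y))\<^sup>2 \<le> (invariant_norm (x, y))\<^sup>2" using fibre_minimiser[of x y] by linarith
  then show ?thesis by (rule power2_le_imp_le[OF _ invariant_norm_nonneg])
qed

lemma fibre_minimiser_eqI:
  assumes "invariant_norm (x, y) \<le> invariant_norm (fibre_minimiser y, y)"
  shows "fibre_minimiser y = x"
proof -
  have "(invariant_norm (x, y))\<^sup>2 \<le> (invariant_norm (fibre_minimiser y, y))\<^sup>2" using assms invariant_norm_nonneg by (rule power_mono)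
  then have "2 * convexity_modulus * (norm (x - fibre_minimiser y))\<^sup>2 \<le> 0" using fibre_minimiser[of x y] by linarith
  then show ?thesis using convexity_modulus_pos by (simp add: mult_le_0_iff)
qed

text \<open>
  The group permutes the fibres and preserves the norm, so it permutes their minimal points.
\<close>

lemma fibre_minimiser_equivariant:
  assumes S: "S \<in> G"
  shows "blinfun_apply S (fibre_minimiser y, y) = (fibre_minimiser (blinfun_apply (lower_right S) y), blinfun_apply (lower_right S) y)"
proof -
  let ?v = "blinfun_apply (lower_right S)"
  obtain R where R: "R \<in> G" "R o\<^sub>L S = id_blinfun" using inverse_mem[OF S] by blast
  have RS: "blinfun_apply R (blinfun_apply S z) = z" for z
    using R(2) by (metis blinfun_apply_blinfun_compose blinfun_apply_id_blinfun)
  have Rv: "blinfun_apply (lower_right R) (?v y) = y" for y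
    using RS[of "(0, y)"] snd_apply[OF R(1), of "blinfun_apply S (0, y)"] snd_apply[OF S, of "(0, y)"] by simp
  define x where "x = fst (blinfun_apply S (fibre_minimiser y, y))"
  have x: "blinfun_apply S (fibre_minimiser y, y) = (x, ?v y)"
    using snd_apply[OF S, of "(fibre_minimiser y, y)"] by (simp add: x_def prod_eq_iff)
  define x' where "x' = fst (blinfun_apply R (fibre_minimiser (?v y), ?v y))"
  have x': "blinfun_apply R (fibre_minimiser (?v y), ?v y) = (x', y)"
    using snd_apply[OF R(1), of "(fibre_minimiser (?v y), ?v y)"] by (simp add: x'_def prod_eq_iff Rv)
  have "invariant_norm (x, ?v y) = invariant_norm (fibre_minimiser y, y)" using invariant_norm_apply[OF S] x by metis
  also have "\<dots> \<le> invariant_norm (x', y)" by (rule invariant_norm_fibre_minimiser_le)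
  also have "\<dots> = invariant_norm (fibre_minimiser (?v y), ?v y)" using invariant_norm_apply[OF R(1)] x' by metis
  finally have "fibre_minimiser (?v y) = x" by (rule fibre_minimiser_eqI)
  then show ?thesis using x by simp
qed

lemma fibre_minimiser_scaleC: "fibre_minimiser (c *\<^sub>C y) = c *\<^sub>C fibre_minimiser y"
proof (rule fibre_minimiser_eqI)
  have eq: "invariant_norm (c *\<^sub>C x, c *\<^sub>C y) = cmod c * invariant_norm (x, y)" for c x y
    using invariant_norm_scaleC[of c "(x, y)"] by (simp add: scaleC_prod_def)
  show "invariant_norm (c *\<^sub>C fibre_minimiser y, c *\<^sub>C y) \<le> invariant_norm (fibre_minimiser (c *\<^sub>C y), c *\<^sub>C y)"
  proof (cases "c = 0")
    case True
    then show ?thesis by (simp add: eq invariant_norm_nonneg)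
  next
    case False
    let ?x = "inverse c *\<^sub>C fibre_minimiser (c *\<^sub>C y)"
    have "c *\<^sub>C ?x = fibre_minimiser (c *\<^sub>C y)"
      using False scaleC_of_real[of 1 "fibre_minimiser (c *\<^sub>C y)"] by (simp add: scaleC_scaleC)
    then show ?thesis
      using eq[of c ?x y] invariant_norm_fibre_minimiser_le[of y ?x] by (simp add: eq mult_left_mono)
  qed
qed

text \<open>
  Shifting between the fibres over \<open>y\<close> and \<open>y'\<close> changes the invariant norm by at most a
  multiple of \<open>\<parallel>y' - y\<parallel>\<close>. So the minimal point over \<open>y'\<close>, moved to the fibre over \<open>y\<close>, is nearly minimal
  there, and strong convexity bounds its distance from the minimal point.
\<close>

lemma continuous_fibre_minimiser: "continuous_on UNIV fibre_minimiser"
proof -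
  have "(fibre_minimiser \<longlongrightarrow> fibre_minimiser y) (at y)" for y
  proof -
    define m where "m = invariant_norm (fibre_minimiser y, y)"
    define h where "h y' = (((m + 2 * (group_bound * norm (y' - y)))\<^sup>2 - m\<^sup>2) / (2 * convexity_modulus))" for y'
    have bound: "norm (fibre_minimiser y' - fibre_minimiser y) \<le> sqrt (h y')" for y'
    proof -
      have shift: "invariant_norm (x, a) \<le> invariant_norm (x, b) + group_bound * norm (a - b)" for x a b
        using invariant_norm_diff_le[of "(x, a)" "(x, b)"] by (simp add: norm_Pair)
      have "invariant_norm (fibre_minimiser y', y) \<le> invariant_norm (fibre_minimiser y', y') + group_bound * norm (y' - y)"
        using shift[of "fibre_minimiser y'" y y'] by (simp add: norm_minus_commute)
      also have "invariant_norm (fibre_minimiser y', y') \<le> invariant_norm (fibre_minimiser y, y')" by (rule invariant_norm_fibre_minimiser_le)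
      also have "\<dots> \<le> m + group_bound * norm (y' - y)" unfolding m_def by (rule shift)
      finally have "invariant_norm (fibre_minimiser y', y) \<le> m + 2 * (group_bound * norm (y' - y))" by simp
      then have "(invariant_norm (fibre_minimiser y', y))\<^sup>2 \<le> (m + 2 * (group_bound * norm (y' - y)))\<^sup>2"
        using invariant_norm_nonneg by (rule power_mono)
      with fibre_minimiser[of "fibre_minimiser y'" y]
      have "2 * convexity_modulus * (norm (fibre_minimiser y' - fibre_minimiser y))\<^sup>2 \<le> (m + 2 * (group_bound * norm (y' - y)))\<^sup>2 - m\<^sup>2"
        by (simp add: m_def)
      then have "(norm (fibre_minimiser y' - fibre_minimiser y))\<^sup>2 \<le> h y'"
        unfolding h_def using convexity_modulus_pos by (simp add: pos_le_divide_eq mult.commute)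
      then show ?thesis by (rule real_le_rsqrt)
    qed
    have "((\<lambda>y'. sqrt (h y')) \<longlongrightarrow> sqrt (((m + 2 * (group_bound * norm (y - y)))\<^sup>2 - m\<^sup>2) / (2 * convexity_modulus))) (at y)"
      unfolding h_def using convexity_modulus_pos by (intro tendsto_intros) auto
    then have "((\<lambda>y'. sqrt (h y')) \<longlongrightarrow> 0) (at y)" by simp
    then have "((\<lambda>y'. fibre_minimiser y' - fibre_minimiser y) \<longlongrightarrow> 0) (at y)"
      by (rule Lim_null_comparison[OF always_eventually[OF allI[OF bound]]])
    then show ?thesis by (rule LIM_zero_cancel)
  qed
  then show ?thesis by (simp add: continuous_on_def)
qed

definition \<psi> :: "'v ell2 \<Rightarrow> 'v ell2" where "\<psi> y = - fibre_minimiser y"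

lemma continuous_\<psi>: "continuous_on UNIV \<psi>"
  unfolding \<psi>_def by (intro continuous_intros continuous_fibre_minimiser)

lemma homogeneous_\<psi>: "homogeneous \<psi>"
proof -
  have "- (c *\<^sub>C x) = c *\<^sub>C (- x)" for c and x :: "'v ell2"
    by (rule ell2_eqI) (simp add: uminus_ell2.rep_eq scaleC_ell2.rep_eq)
  then show ?thesis by (simp add: homogeneous_def \<psi>_def fibre_minimiser_scaleC)
qed

lemma upper_right_eq:
  assumes S: "S \<in> G"
  shows "fst (blinfun_apply S (0, y)) =
    blinfun_apply (upper_left S) (\<psi> y) - \<psi> (blinfun_apply (lower_right S) y)"
  using fibre_minimiser_equivariant[OF S, of y] unfolding apply_decompose[OF S, of "fibre_minimiser y"]
  by (simp add: \<psi>_def blinfun.minus_right algebra_simps)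

lemma upper_triangular_form:
  assumes S: "S \<in> G"
  shows "blinfun_apply S = upper_triangular (blinfun_apply (upper_left S))
    (\<lambda>y. blinfun_apply (upper_left S) (\<psi> y) - \<psi> (blinfun_apply (lower_right S) y)) (blinfun_apply (lower_right S))"
proof
  fix z
  show "blinfun_apply S z = upper_triangular (blinfun_apply (upper_left S))
      (\<lambda>y. blinfun_apply (upper_left S) (\<psi> y) - \<psi> (blinfun_apply (lower_right S) y))
      (blinfun_apply (lower_right S)) z"
    using apply_decompose[OF S, of "fst z" "snd z"]
    by (simp add: upper_triangular_def upper_right_eq[OF S] case_prod_beta)
qed

lemma deriv_op_eq:
  assumes g: "g \<in> Aut E"
  shows "deriv_op E e g y = lam2 g (\<psi> y) - \<psi> (lam2 g y)"
proof -
  interpret lam2: bounded_linear "lam2 g" by (rule lam2_bounded_linear(1)[OF g])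
  interpret d: bounded_linear "deriv_op E e g" by (rule deriv_op(2)[OF tree g])
  show ?thesis
    using upper_right_eq[OF lambda_d_mem[OF g], of y]
    by (simp add: lambda_d_apply[OF g] blinfun_apply_upper_left blinfun_apply_lower_right lam2.zero d.zero)
qed

text \<open>
  The upper right corner of \<open>\<lambda>\<^sub>d(g)\<close>, computed once from its definition and once from the minimal
  points. Both commutation statements are rearrangements of this identity.
\<close>

lemma deriv_op_fun_eq:
  assumes g: "g \<in> Aut E" and x: "x \<in> ell2_set"
  shows "Lstar E e (lam g x) s - lam g (Lstar E e x) s = lam g (on_fun \<psi> x) s - on_fun \<psi> (lam g x) s"
proof -
  have "lam2 g (Abs_ell2 x) = Abs_ell2 (lam g x)"
    by (simp add: lam2_def on_ell2_def Abs_ell2_inverse[OF x])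
  then have "ell2_fun (deriv_op E e g (Abs_ell2 x)) s = lam g (on_fun \<psi> x) s - on_fun \<psi> (lam g x) s"
    by (simp add: deriv_op_eq[OF g] minus_ell2.rep_eq ell2_fun_lam2[OF g] on_fun_def)
  then show ?thesis by (simp add: deriv_op(1)[OF tree g] Abs_ell2_inverse[OF x])
qed

lemma commutes_Lstar: "commutes_with_Aut E ell2_set ellinf_set (\<lambda>x s. Lstar E e x s + on_fun \<psi> x s)"
  unfolding commutes_with_Aut_def
proof (intro conjI ballI ext)
  fix x :: "'v \<Rightarrow> complex" assume x: "x \<in> ell2_set"
  show "(\<lambda>s. Lstar E e x s + on_fun \<psi> x s) \<in> ellinf_set"
  proof -
    let ?x = "Abs_ell2 x"
    have "cmod (Lstar E e x s) \<le> norm ?x" for s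
      using cmod_le_norm_ell2[of ?x "hat E e s"] by (simp add: Lstar_def Abs_ell2_inverse[OF x])
    moreover have "cmod (on_fun \<psi> x s) \<le> norm (\<psi> ?x)" for s
      by (simp add: on_fun_def cmod_le_norm_ell2)
    ultimately have "cmod (Lstar E e x s + on_fun \<psi> x s) \<le> norm ?x + norm (\<psi> ?x)" for s
      by (meson add_mono norm_triangle_ineq order_trans)
    then show ?thesis by (auto simp: ellinf_set_def bounded_iff)
  qed
  fix g s assume g: "g \<in> Aut E"
  show "Lstar E e (lam g x) s + on_fun \<psi> (lam g x) s = lam g (\<lambda>s. Lstar E e x s + on_fun \<psi> x s) s"
    using deriv_op_fun_eq[OF g x, of s] by (simp add: lam_def algebra_simps)
qed

lemma commutes_Lop: "commutes_with_Aut E ell1_set ell2_set (\<lambda>x s. Lop E e x s - on_fun \<psi> x s)"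
  unfolding commutes_with_Aut_def
proof (intro conjI ballI ext)
  fix x :: "'v \<Rightarrow> complex" assume x: "x \<in> ell1_set"
  have x2: "x \<in> ell2_set" using x ell1_subset_ell2 by blast
  show "(\<lambda>s. Lop E e x s - on_fun \<psi> x s) \<in> ell2_set"
  proof (rule ell2_set_diff)
    show "Lop E e x \<in> ell2_set" using Lop_ell1(1)[OF x] ell1_subset_ell2 by blast
    show "on_fun \<psi> x \<in> ell2_set" by (simp add: on_fun_def ell2_fun)
  qed
  fix g s assume g: "g \<in> Aut E"
  show "Lop E e (lam g x) s - on_fun \<psi> (lam g x) s = lam g (\<lambda>s. Lop E e x s - on_fun \<psi> x s) s"
    using deriv_op_fun_eq[OF g x2, of s] Lstar_add_Lop_lam[OF tree x g, of e s]
    unfolding lam_def by algebra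
qed

end

theorem theorem7:
  fixes E :: "'v \<Rightarrow> 'v \<Rightarrow> bool" and e :: 'v
    and G :: "(('v ell2 \<times> 'v ell2) \<Rightarrow>\<^sub>L ('v ell2 \<times> 'v ell2)) set"
  assumes tree: "aleph0_regular_tree E"
    and subgroup: "subgroup G GL"
    and bounded: "bounded G"
    and invariant: "\<forall>S\<in>G. blinfun_apply S ` (UNIV \<times> {0}) \<subseteq> UNIV \<times> {0}"
    and contains: "lambda_d E e ` Aut E \<subseteq> G"
  shows "\<exists>\<psi> :: 'v ell2 \<Rightarrow> 'v ell2.
    continuous_on UNIV \<psi> \<and> homogeneous \<psi> \<and>
    commutes_with_Aut E ell2_set ellinf_set (\<lambda>x s. Lstar E e x s + on_fun \<psi> x s) \<and>
    commutes_with_Aut E ell1_set ell2_set (\<lambda>x s. Lop E e x s - on_fun \<psi> x s) \<and>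
    (\<forall>S\<in>G. \<exists>u\<in>carrier GL. \<exists>v\<in>carrier GL.
       blinfun_apply S =
         upper_triangular (blinfun_apply u)
           (\<lambda>y. blinfun_apply u (\<psi> y) - \<psi> (blinfun_apply v y)) (blinfun_apply v)) \<and>
    SOT_iso_onto_image G upper_left \<and>
    SOT_iso_onto_image G lower_right"
proof -
  interpret bounded_extension E e G
    by (rule bounded_extension.intro) (fact assms)+
  show ?thesis
    using continuous_\<psi> homogeneous_\<psi> commutes_Lstar commutes_Lop SOT_iso_corners
      corner_mem_GL upper_triangular_form by blast
qed

end
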